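(* Fix $(\omega_0,A_0)\in\mathcal{P}_1\cup\mathcal{P}_3$ and let $\phi_{(\omega_0,A_0)}$ be an even periodic solution, not changing sign, of $-\phi''+\omega_0\phi-\phi\log\phi^2+A_0=0$ as described in items (i)–(iv) below, with period $L_0$. Then there are an open neighborhood $\mathcal{O}$ of $(\omega_0,A_0)$ and a family $(\omega,A)\in\mathcal{O}\mapsto\psi_{(\omega,A)}\in H^2_{per,e}([0,L_0])$ of $L_0$-periodic solutions of $-\psi''+\omega\psi-\psi\log\psi^2+A=0$, depending smoothly on $(\omega,A)$, with $\psi_{(\omega_0,A_0)}=\phi_{(\omega_0,A_0)}$.
   Context: $\mathcal{P}_1=\{(\omega,A):|A|<2e^{\omega/2-1}\}$, $\mathcal{P}_3=\{(\omega,A):|A|>2e^{\omega/2-1}\}$. With $g(\omega,A,\phi)=\omega\phi-\phi\log\phi^2+A$: on $\mathcal{P}_1$, $g(\omega,A,\cdot)$ has three zeros $r_0<r_1<r_2$; on $\mathcal{P}_3$ a unique zero $r_2$. The sign-definite even periodic solutions considered are: (i) on $\mathcal{P}_1$, $A<0$: positive solutions turning around $(r_2,0)$, or negative solutions turning around $(r_0,0)$ close to it; (ii) on $\mathcal{P}_1$, $A>0$: negative solutions around $(r_0,0)$, or positive ones around $(r_2,0)$ close to it; (iii)–(iv) on $\mathcal{P}_3$: solutions around $(r_2,0)$ close to it (negative if $A<0$, positive if $A>0$). $H^2_{per,e}([0,L_0])$ denotes even functions in $H^2_{per}([0,L_0])$. *)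

theory Defs
  imports "HOL-Analysis.Analysis"
begin

definition P1 :: "(real \<times> real) set" where
  "P1 = {(\<omega>, A). \<bar>A\<bar> < 2 * exp (\<omega> / 2 - 1)}"

definition P3 :: "(real \<times> real) set" where
  "P3 = {(\<omega>, A). \<bar>A\<bar> > 2 * exp (\<omega> / 2 - 1)}"

definition g :: "real \<Rightarrow> real \<Rightarrow> real \<Rightarrow> real" where
  "g \<omega> A s = \<omega> * s - s * ln (s ^ 2) + A"

definition smallest_zero :: "real \<Rightarrow> real \<Rightarrow> real \<Rightarrow> bool" where
  "smallest_zero \<omega> A r \<longleftrightarrow> g \<omega> A r = 0 \<and> (\<forall>s. g \<omega> A s = 0 \<longrightarrow> r \<le> s)"

definition largest_zero :: "real \<Rightarrow> real \<Rightarrow> real \<Rightarrow> bool" where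
  "largest_zero \<omega> A r \<longleftrightarrow> g \<omega> A r = 0 \<and> (\<forall>s. g \<omega> A s = 0 \<longrightarrow> s \<le> r)"

text \<open>u is L-periodic, even, C^1 with absolutely continuous derivative whose
  (a.e.) derivative is square integrable on one period.\<close>
definition H2pe :: "real \<Rightarrow> (real \<Rightarrow> real) \<Rightarrow> bool" where
  "H2pe L u \<longleftrightarrow> 0 < L \<and> (\<forall>x. u (x + L) = u x) \<and> (\<forall>x. u (- x) = u x)
     \<and> (\<forall>x. u differentiable (at x))
     \<and> (\<forall>a b. a \<le> b \<longrightarrow> set_integrable lebesgue {a..b} (deriv (deriv u))
            \<and> deriv u b - deriv u a = (LINT t:{a..b}|lebesgue. deriv (deriv u) t))
     \<and> set_integrable lebesgue {0..L} (\<lambda>t. (deriv (deriv u) t) ^ 2)"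

definition h2norm :: "real \<Rightarrow> (real \<Rightarrow> real) \<Rightarrow> real" where
  "h2norm L u = sqrt (LINT t:{0..L}|lebesgue.
       (u t) ^ 2 + (deriv u t) ^ 2 + (deriv (deriv u) t) ^ 2)"

text \<open>C^k dependence of a family U -> H^2_{per,e}([0,L]) (U an open subset of R^2),
  measured in the H^2 norm: C^0 = continuity, C^(k+1) = Frechet differentiable with
  partial derivatives (elements of H^2_{per,e}) depending in a C^k way.\<close>
fun h2_Ck :: "real \<Rightarrow> nat \<Rightarrow> (real \<times> real) set \<Rightarrow> (real \<times> real \<Rightarrow> real \<Rightarrow> real) \<Rightarrow> bool" where
  "h2_Ck L 0 U \<Psi> \<longleftrightarrow>
     (\<forall>p\<in>U. H2pe L (\<Psi> p) \<and>
        ((\<lambda>q. h2norm L (\<lambda>x. \<Psi> q x - \<Psi> p x)) \<longlongrightarrow> 0) (at p))"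
| "h2_Ck L (Suc k) U \<Psi> \<longleftrightarrow> h2_Ck L 0 U \<Psi> \<and>
     (\<exists>D1 D2. h2_Ck L k U D1 \<and> h2_Ck L k U D2 \<and>
        (\<forall>p\<in>U. ((\<lambda>q. h2norm L (\<lambda>x. \<Psi> q x - \<Psi> p x - fst (q - p) * D1 p x - snd (q - p) * D2 p x)
                      / norm (q - p)) \<longlongrightarrow> 0) (at p)))"

definition h2_smooth :: "real \<Rightarrow> (real \<times> real) set \<Rightarrow> (real \<times> real \<Rightarrow> real \<Rightarrow> real) \<Rightarrow> bool" where
  "h2_smooth L U \<Psi> \<longleftrightarrow> (\<forall>k. h2_Ck L k U \<Psi>)"

definition solves :: "real \<Rightarrow> real \<Rightarrow> (real \<Rightarrow> real) \<Rightarrow> bool" where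
  "solves \<omega> A u \<longleftrightarrow> (AE x in lebesgue. - deriv (deriv u) x + \<omega> * u x - u x * ln ((u x) ^ 2) + A = 0)"

definition minimal_period :: "real \<Rightarrow> (real \<Rightarrow> real) \<Rightarrow> bool" where
  "minimal_period L u \<longleftrightarrow> 0 < L \<and> (\<forall>x. u (x + L) = u x)
      \<and> (\<forall>T. 0 < T \<and> T < L \<longrightarrow> \<not> (\<forall>x. u (x + T) = u x))"

text \<open>The orbit (u,u') turns around the equilibrium (r,0): u oscillates on both sides of r.\<close>
definition turns_around :: "(real \<Rightarrow> real) \<Rightarrow> real \<Rightarrow> bool" where
  "turns_around u r \<longleftrightarrow> (\<exists>x. u x < r) \<and> (\<exists>x. r < u x)"

definition close_to :: "real \<Rightarrow> (real \<Rightarrow> real) \<Rightarrow> real \<Rightarrow> bool" where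
  "close_to \<delta> u r \<longleftrightarrow> (\<forall>x. \<bar>u x - r\<bar> < \<delta>)"

text \<open>The solutions of items (i)--(iv); delta quantifies "close to the equilibrium".\<close>
definition admissible :: "real \<Rightarrow> real \<Rightarrow> real \<Rightarrow> (real \<Rightarrow> real) \<Rightarrow> bool" where
  "admissible \<omega> A \<delta> u \<longleftrightarrow>
     ((\<omega>, A) \<in> P1 \<and> A < 0 \<and>
        ((\<forall>x. 0 < u x) \<and> (\<exists>r. largest_zero \<omega> A r \<and> turns_around u r)
         \<or> (\<forall>x. u x < 0) \<and> (\<exists>r. smallest_zero \<omega> A r \<and> turns_around u r \<and> close_to \<delta> u r)))
   \<or> ((\<omega>, A) \<in> P1 \<and> 0 < A \<and>
        ((\<forall>x. u x < 0) \<and> (\<exists>r. smallest_zero \<omega> A r \<and> turns_around u r)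
         \<or> (\<forall>x. 0 < u x) \<and> (\<exists>r. largest_zero \<omega> A r \<and> turns_around u r \<and> close_to \<delta> u r)))
   \<or> ((\<omega>, A) \<in> P3 \<and> A < 0 \<and> (\<forall>x. u x < 0) \<and>
        (\<exists>r. largest_zero \<omega> A r \<and> turns_around u r \<and> close_to \<delta> u r))
   \<or> ((\<omega>, A) \<in> P3 \<and> 0 < A \<and> (\<forall>x. 0 < u x) \<and>
        (\<exists>r. largest_zero \<omega> A r \<and> turns_around u r \<and> close_to \<delta> u r))"

end

theory Submission
  imports Defs
begin

text \<open>
  The equation reads \<open>\<phi>'' = g(\<phi>)\<close> and its linearisation at \<open>\<phi>\<close> is \<open>- y'' + Q y = h\<close> with
  \<open>Q = \<omega> - 2 - ln \<phi>\<^sup>2\<close>. Writing \<open>G\<close> for the primitive of \<open>g\<close> that vanishes at the equilibrium, besides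
  \<open>\<phi>'\<close> the homogeneous equation has the even solution \<open>P \<phi>' + G(\<phi>)/g(\<phi>)\<close> for a suitable primitive \<open>P\<close>, and the
  linearisation is invertible on even \<open>L\<close>-periodic functions as soon as \<open>P(L/2) \<noteq> 0\<close>, that is, as soon
  as the period depends on the energy to first order. This follows from Chicone's criterion,
  convexity of \<open>- G/g\<^sup>2\<close>, which for this potential is deduced from Schaaf's criterion.

  The family \<open>\<psi>\<close> is then obtained by a contraction argument, and its parameter derivatives solve
  linearised equations whose right-hand sides are built from \<open>\<psi>\<close>, \<open>1/\<psi>\<close>, \<open>Q\<close> and solutions of such
  equations; this class of families is closed under differentiation, which gives all orders at once.
\<close>

section \<open>Even periodic solutions of linear second order equations\<close>

text \<open>Evenness does two jobs: it excludes the odd kernel element \<phi>', the translation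
  mode, and it turns periodicity into Neumann conditions at 0 and L/2. The delicate point for the
  second solution is that the orbit crosses the equilibrium, where g vanishes. There G/g and the
  derivative of G/g^2 have to be extended continuously, and monotonicity can be tested only off a
  finite set of points.

  All estimates are made in the sup norm, where the nonlinearity is handled pointwise. The equation
  then returns the second derivative and evenness the first, which gives the norm of H^2.

  The solutions are chosen separately for each parameter, so the choice itself gives no continuity.
  Regularity is forced afterwards: any two chosen solutions stay close to \<phi>, so the quadratic
  part of their difference can be absorbed into the linear estimate. This gives a Lipschitz bound
  first and quadratic remainders next. The neighbourhood is the same for every order of
  differentiation.\<close>

definition second_deriv :: "(real \<Rightarrow> real) \<Rightarrow> (real \<Rightarrow> real) \<Rightarrow> bool" where
  "second_deriv y z \<longleftrightarrow> (\<exists>d. (\<forall>x. (y has_real_derivative d x) (at x)) \<and>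
     (\<forall>x. (d has_real_derivative z x) (at x)))"

definition even_periodic :: "real \<Rightarrow> (real \<Rightarrow> real) \<Rightarrow> bool" where
  "even_periodic L y \<longleftrightarrow> continuous_on UNIV y \<and> (\<forall>x. y (- x) = y x) \<and> (\<forall>x. y (x + L) = y x)"

text \<open>Quantitative unique solvability of \<open>- y'' + Q y = h\<close> among even \<open>L\<close>-periodic functions.
  Taking \<open>M = 0\<close> in the last clause gives uniqueness.\<close>
definition green_bound :: "real \<Rightarrow> (real \<Rightarrow> real) \<Rightarrow> real \<Rightarrow> bool" where
  "green_bound L Q C \<longleftrightarrow> 0 < C \<and>
     (\<forall>h. even_periodic L h \<longrightarrow> (\<exists>y. even_periodic L y \<and> second_deriv y (\<lambda>x. Q x * y x - h x))) \<and>
     (\<forall>y h M. even_periodic L y \<longrightarrow> even_periodic L h \<longrightarrow> second_deriv y (\<lambda>x. Q x * y x - h x) \<longrightarrow>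
        (\<forall>x. \<bar>h x\<bar> \<le> M) \<longrightarrow> (\<forall>x. \<bar>y x\<bar> \<le> C * M))"

section \<open>Calculus of classical second derivatives\<close>

lemma second_derivI:
  "(\<And>x. (y has_real_derivative d x) (at x)) \<Longrightarrow> (\<And>x. (d has_real_derivative z x) (at x)) \<Longrightarrow>
   second_deriv y z"
  unfolding second_deriv_def by blast

lemma second_deriv_diff:
  assumes "second_deriv y z" "second_deriv y1 z1"
  shows "second_deriv (\<lambda>x. y x - y1 x) (\<lambda>x. z x - z1 x)"
proof -
  obtain d d1 where "\<And>x. (y has_real_derivative d x) (at x)" "\<And>x. (d has_real_derivative z x) (at x)"
    "\<And>x. (y1 has_real_derivative d1 x) (at x)" "\<And>x. (d1 has_real_derivative z1 x) (at x)"
    using assms unfolding second_deriv_def by blast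
  then show ?thesis
    by (intro second_derivI[where d = "\<lambda>x. d x - d1 x"] DERIV_diff)
qed

lemma second_deriv_add:
  assumes "second_deriv y z" "second_deriv y1 z1"
  shows "second_deriv (\<lambda>x. y x + y1 x) (\<lambda>x. z x + z1 x)"
proof -
  obtain d d1 where "\<And>x. (y has_real_derivative d x) (at x)" "\<And>x. (d has_real_derivative z x) (at x)"
    "\<And>x. (y1 has_real_derivative d1 x) (at x)" "\<And>x. (d1 has_real_derivative z1 x) (at x)"
    using assms unfolding second_deriv_def by blast
  then show ?thesis
    by (intro second_derivI[where d = "\<lambda>x. d x + d1 x"] DERIV_add)
qed

lemma second_deriv_cmult:
  assumes "second_deriv y z"
  shows "second_deriv (\<lambda>x. c * y x) (\<lambda>x. c * z x)"
proof -
  obtain d where "\<And>x. (y has_real_derivative d x) (at x)" "\<And>x. (d has_real_derivative z x) (at x)"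
    using assms unfolding second_deriv_def by blast
  then show ?thesis
    by (intro second_derivI[where d = "\<lambda>x. c * d x"] DERIV_cmult)
qed

lemma second_deriv_cong:
  assumes "second_deriv y z" "\<And>x. z x = z1 x"
  shows "second_deriv y z1"
proof -
  have "z = z1" using assms(2) by auto
  with assms(1) show ?thesis by simp
qed

lemma second_deriv_continuous:
  assumes "second_deriv y z"
  shows "continuous_on UNIV y"
  using assms unfolding second_deriv_def
  by (metis DERIV_isCont continuous_at_imp_continuous_on)

section \<open>Even periodic functions\<close>

lemma even_periodic_const: "even_periodic L (\<lambda>x. c)"
  by (simp add: even_periodic_def)

lemma even_periodic_add:
  "even_periodic L y \<Longrightarrow> even_periodic L z \<Longrightarrow> even_periodic L (\<lambda>x. y x + z x)"
  by (auto simp: even_periodic_def intro: continuous_intros)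

lemma even_periodic_diff:
  "even_periodic L y \<Longrightarrow> even_periodic L z \<Longrightarrow> even_periodic L (\<lambda>x. y x - z x)"
  by (auto simp: even_periodic_def intro: continuous_intros)

lemma even_periodic_mult:
  "even_periodic L y \<Longrightarrow> even_periodic L z \<Longrightarrow> even_periodic L (\<lambda>x. y x * z x)"
  by (auto simp: even_periodic_def intro: continuous_intros)

lemma even_periodic_inverse:
  "even_periodic L y \<Longrightarrow> (\<And>x. y x \<noteq> 0) \<Longrightarrow> even_periodic L (\<lambda>x. inverse (y x))"
  by (auto simp: even_periodic_def intro!: continuous_intros)

lemma even_periodic_ln_square:
  "even_periodic L y \<Longrightarrow> (\<And>x. y x \<noteq> 0) \<Longrightarrow> even_periodic L (\<lambda>x. ln ((y x)\<^sup>2))"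
  by (auto simp: even_periodic_def intro!: continuous_intros)

lemmas even_periodic_intros = even_periodic_const even_periodic_add even_periodic_diff
  even_periodic_mult even_periodic_inverse even_periodic_ln_square

text \<open>The distance from \<open>x\<close> to the nearest multiple of \<open>L\<close> serves
  every \<open>y\<close> at once, so sup bounds involving several functions reduce to
  \<open>[0, L/2]\<close> together.\<close>

lemma even_periodic_reduce:
  fixes x :: real
  assumes "0 < L"
  obtains t where "0 \<le> t" "t \<le> L / 2" "\<And>y. even_periodic L y \<Longrightarrow> y x = y t"
proof -
  define n where "n = round (x / L)"
  have shift: "y (x + of_nat k * L) = y x" if "even_periodic L y" for y :: "real \<Rightarrow> real" and x k
  proof (induction k)
    case (Suc k)
    have "y (x + of_nat (Suc k) * L) = y ((x + of_nat k * L) + L)"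
      by (simp add: algebra_simps)
    with Suc that show ?case by (simp add: even_periodic_def)
  qed simp
  have ishift: "y (x - of_int n * L) = y x" if "even_periodic L y" for y :: "real \<Rightarrow> real" and x n
  proof (cases "n \<ge> 0")
    case True
    then show ?thesis using shift[OF that, of "x - of_int n * L" "nat n"] by simp
  next
    case False
    then show ?thesis using shift[OF that, of x "nat (- n)"] by simp
  qed
  have "\<bar>x / L - of_int n\<bar> \<le> 1 / 2"
    unfolding n_def using of_int_round_abs_le[of "x / L"] by (simp add: abs_minus_commute)
  then have "\<bar>x / L - of_int n\<bar> * L \<le> 1 / 2 * L"
    using assms by (intro mult_right_mono) auto
  moreover have "\<bar>x / L - of_int n\<bar> * L = \<bar>x - of_int n * L\<bar>"
  proof -
    have "\<bar>x / L - of_int n\<bar> * L = \<bar>(x / L - of_int n) * L\<bar>"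
      using assms by (simp add: abs_mult)
    then show ?thesis using assms by (simp add: algebra_simps)
  qed
  ultimately have "\<bar>x - of_int n * L\<bar> \<le> L / 2" by simp
  moreover have "y x = y \<bar>x - of_int n * L\<bar>" if "even_periodic L y" for y :: "real \<Rightarrow> real"
  proof -
    have "y \<bar>t\<bar> = y t" for t
      using that by (simp add: even_periodic_def abs_if)
    with ishift[OF that, of x n] show ?thesis by simp
  qed
  ultimately show ?thesis by (intro that[of "\<bar>x - of_int n * L\<bar>"]) auto
qed

lemma even_periodic_bounded:
  assumes "0 < L" "even_periodic L y"
  shows "\<exists>B>0. \<forall>x. \<bar>y x\<bar> \<le> B"
proof -
  have "compact (y ` {0..L/2})"
    using assms(2) unfolding even_periodic_def
    by (intro compact_continuous_image) (auto intro: continuous_on_subset)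
  then obtain B where B: "0 < B" "\<And>t. t \<in> {0..L/2} \<Longrightarrow> \<bar>y t\<bar> \<le> B"
    by (auto simp: bounded_pos dest!: compact_imp_bounded)
  have "\<bar>y x\<bar> \<le> B" for x
  proof -
    obtain t where "0 \<le> t" "t \<le> L/2" "y x = y t"
      by (rule even_periodic_reduce[OF assms(1), of x]) (use assms(2) in blast)
    then show ?thesis using B(2)[of t] by auto
  qed
  with B(1) show ?thesis by blast
qed

lemma even_periodic_attains_inf:
  assumes "0 < L" "even_periodic L y"
  shows "\<exists>x0. \<forall>x. y x0 \<le> y x"
proof -
  have "continuous_on {0..L/2} y"
    using assms(2) by (auto simp: even_periodic_def intro: continuous_on_subset)
  then obtain x0 where x0: "x0 \<in> {0..L/2}" "\<And>t. t \<in> {0..L/2} \<Longrightarrow> y x0 \<le> y t"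
    using continuous_attains_inf[of "{0..L/2}" y] assms(1) by auto
  have "y x0 \<le> y x" for x
  proof -
    obtain t where "0 \<le> t" "t \<le> L/2" "y x = y t"
      by (rule even_periodic_reduce[OF assms(1), of x]) (use assms(2) in blast)
    then show ?thesis using x0(2)[of t] by auto
  qed
  then show ?thesis by blast
qed

lemma symmetric_deriv_zero:
  fixes y :: "real \<Rightarrow> real"
  assumes "\<And>x. y (2 * a - x) = y x" "(y has_real_derivative d) (at a)"
  shows "d = 0"
proof -
  have "((\<lambda>x. y (2 * a - x)) has_real_derivative d * (0 - 1)) (at a)"
    by (rule DERIV_chain2[where f = y]) (use assms(2) in \<open>auto intro!: derivative_eq_intros\<close>)
  moreover have "(\<lambda>x. y (2 * a - x)) = y" using assms(1) by auto
  ultimately have "(y has_real_derivative - d) (at a)" by simp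
  from DERIV_unique[OF this assms(2)] show ?thesis by simp
qed

text \<open>Evenness and periodicity amount to reflection symmetry about both \<open>0\<close> and
  \<open>L / 2\<close>. The common shape \<open>2 * a - x\<close> lets one argument treat both end
  points.\<close>

lemma even_periodic_symmetric:
  assumes "even_periodic L y"
  shows "y (2 * 0 - x) = y x" "y (2 * (L / 2) - x) = y x"
proof -
  show "y (2 * 0 - x) = y x" using assms by (simp add: even_periodic_def)
  have "y (- x + L) = y (- x)" using assms by (simp only: even_periodic_def)
  then show "y (2 * (L / 2) - x) = y x" using assms by (simp add: even_periodic_def add.commute)
qed

lemma antiderivative_on_reals:
  fixes f :: "real \<Rightarrow> real"
  assumes "continuous_on UNIV f"
  obtains F where "\<And>x. (F has_real_derivative f x) (at x)" "F c = 0"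
proof -
  have "\<exists>F. \<forall>x :: real. - \<infinity> < ereal x \<longrightarrow> ereal x < \<infinity> \<longrightarrow> (F has_vector_derivative f x) (at x)"
    by (rule einterval_antiderivative) (use assms in \<open>auto simp: continuous_on_eq_continuous_at\<close>)
  then obtain F where F: "\<And>x. (F has_vector_derivative f x) (at x)" by auto
  have "((\<lambda>x. F x - F c) has_real_derivative f x) (at x)" for x
    using F[of x] by (auto simp: has_real_derivative_iff_has_vector_derivative intro!: derivative_eq_intros)
  then show ?thesis by (rule that) simp
qed

lemma DERIV_reflect:
  fixes f :: "real \<Rightarrow> real"
  assumes "(f has_real_derivative D) (at (c - x))"
  shows "((\<lambda>x. f (c - x)) has_real_derivative - D) (at x)"
proof -
  have "((\<lambda>x. f (c - x)) has_real_derivative D * (- 1)) (at x)"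
    by (rule DERIV_chain2[where g = "\<lambda>x. c - x"]) (use assms in \<open>auto intro!: derivative_eq_intros\<close>)
  then show ?thesis by simp
qed

text \<open>Variation of constants from two solutions \<open>w1\<close>, \<open>w2\<close> of \<open>w'' = Q w\<close>, where \<open>w1\<close> satisfies
  the Neumann condition at \<open>0\<close> only and \<open>w2\<close> the one at \<open>L/2\<close>.\<close>

lemma green_bound_fundamental_system:
  fixes w1 w2 d1 d2 Q :: "real \<Rightarrow> real"
  assumes L: "0 < L" and Q: "even_periodic L Q"
    and w1: "\<And>x. (w1 has_real_derivative d1 x) (at x)"
    and d1: "\<And>x. (d1 has_real_derivative Q x * w1 x) (at x)"
    and w2: "\<And>x. (w2 has_real_derivative d2 x) (at x)"
    and d2: "\<And>x. (d2 has_real_derivative Q x * w2 x) (at x)"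
    and W: "\<And>x. d1 x * w2 x - w1 x * d2 x = W" "W \<noteq> 0"
    and bc: "d1 0 = 0" "d2 (L / 2) = 0" "d1 (L / 2) \<noteq> 0"
  shows "\<exists>C. green_bound L Q C"
proof -
  \<comment> \<open>The Wronskians of \<open>z\<close> with \<open>w1\<close> and \<open>w2\<close>
    are constant and vanish at \<open>a\<close>; independence of \<open>w1\<close> and
    \<open>w2\<close> then forces \<open>z = 0\<close>.\<close>
  have ivp: "z x = 0"
    if z: "\<And>x. (z has_real_derivative dz x) (at x)"
      and dz: "\<And>x. (dz has_real_derivative Q x * z x) (at x)" and 0: "z a = 0" "dz a = 0"
    for z dz :: "real \<Rightarrow> real" and a x
  proof -
    have c1: "dz x * w1 x - z x * d1 x = dz a * w1 a - z a * d1 a"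
      by (rule DERIV_isconst_all[of "\<lambda>x. dz x * w1 x - z x * d1 x"])
        (auto intro!: derivative_eq_intros z dz w1 d1 simp: algebra_simps)
    have c2: "dz x * w2 x - z x * d2 x = dz a * w2 a - z a * d2 a"
      by (rule DERIV_isconst_all[of "\<lambda>x. dz x * w2 x - z x * d2 x"])
        (auto intro!: derivative_eq_intros z dz w2 d2 simp: algebra_simps)
    have "z x * (d1 x * w2 x - w1 x * d2 x) = 0"
      using c1 c2 0 by algebra
    then show ?thesis using W by simp
  qed
  \<comment> \<open>A solution with zero slope at \<open>a\<close> and its mirror image have the
    same initial data there and solve the same equation, so \<open>ivp\<close> applies to their
    difference.\<close>
  have reflect: "y (2 * a - x) = y x"
    if y: "\<And>x. (y has_real_derivative dy x) (at x)"
      and dy: "\<And>x. (dy has_real_derivative Q x * y x - h x) (at x)"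
      and 0: "dy a = 0" and sym: "\<And>x. Q (2 * a - x) = Q x" "\<And>x. h (2 * a - x) = h x"
    for y dy h :: "real \<Rightarrow> real" and a x
  proof -
    have y': "((\<lambda>x. y (2 * a - x)) has_real_derivative - dy (2 * a - x)) (at x)" for x
      by (intro DERIV_reflect y)
    have dy': "((\<lambda>x. - dy (2 * a - x)) has_real_derivative Q x * y (2 * a - x) - h x) (at x)" for x
      using DERIV_minus[OF DERIV_reflect[OF dy[of "2 * a - x"]]] by (simp add: sym)
    have "y (2 * a - x) - y x = 0"
    proof (rule ivp[where z = "\<lambda>x. y (2 * a - x) - y x" and dz = "\<lambda>x. - dy (2 * a - x) - dy x" and a = a])
      show "((\<lambda>x. y (2 * a - x) - y x) has_real_derivative - dy (2 * a - x) - dy x) (at x)" for x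
        by (intro DERIV_diff y' y)
      show "((\<lambda>x. - dy (2 * a - x) - dy x) has_real_derivative Q x * (y (2 * a - x) - y x)) (at x)" for x
        using DERIV_diff[OF dy'[of x] dy[of x]] by (simp add: algebra_simps)
      show "y (2 * a - a) - y a = 0" "- dy (2 * a - a) - dy a = 0" using 0 by auto
    qed
    then show ?thesis by simp
  qed
  have cw: "continuous_on UNIV w1" "continuous_on UNIV w2"
    using w1 w2 by (meson DERIV_isCont continuous_at_imp_continuous_on)+
  have bnd: "\<exists>m>0. \<forall>x\<in>{0..L/2}. \<bar>w x\<bar> \<le> m" if "continuous_on UNIV w" for w :: "real \<Rightarrow> real"
  proof -
    have "compact (w ` {0..L/2})"
      using that by (intro compact_continuous_image) (auto intro: continuous_on_subset)
    then show ?thesis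
      by (metis bounded_pos compact_imp_bounded imageI real_norm_def)
  qed
  obtain m1 m2 where m1: "0 < m1" "\<And>x. x \<in> {0..L/2} \<Longrightarrow> \<bar>w1 x\<bar> \<le> m1"
    and m2: "0 < m2" "\<And>x. x \<in> {0..L/2} \<Longrightarrow> \<bar>w2 x\<bar> \<le> m2"
    using bnd[OF cw(1)] bnd[OF cw(2)] by blast
  \<comment> \<open>Each of the two products in the formula for \<open>y\<close> below is at most
    \<open>m1 * m2 * M * (L / 2)\<close> on \<open>[0, L/2]\<close>.\<close>
  define C where "C = m1 * m2 * L / \<bar>W\<bar>"
  have Cpos: "0 < C" unfolding C_def using m1 m2 L W by simp
  have ex: "\<exists>y. even_periodic L y \<and> second_deriv y (\<lambda>x. Q x * y x - h x) \<and>
      (\<forall>M. (\<forall>x. \<bar>h x\<bar> \<le> M) \<longrightarrow> (\<forall>x. \<bar>y x\<bar> \<le> C * M))"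
    if h: "even_periodic L h" for h
  proof -
    have ch: "continuous_on UNIV h" using h by (simp add: even_periodic_def)
    \<comment> \<open>The base points are matched to the boundary conditions: \<open>F1\<close>
      vanishes at \<open>0\<close>, where \<open>d1\<close> does, and \<open>F2\<close> at
      \<open>L / 2\<close>, where \<open>d2\<close> does. Hence \<open>dy\<close> vanishes at both
      ends.\<close>
    obtain F1 where F1: "\<And>x. (F1 has_real_derivative w1 x * h x) (at x)" "F1 0 = 0"
      using antiderivative_on_reals[of "\<lambda>x. w1 x * h x"] cw ch by (metis continuous_on_mult)
    obtain F2 where F2: "\<And>x. (F2 has_real_derivative w2 x * h x) (at x)" "F2 (L / 2) = 0"
      using antiderivative_on_reals[of "\<lambda>x. w2 x * h x"] cw ch by (metis continuous_on_mult)
    define y where "y x = (w2 x * F1 x - w1 x * F2 x) / W" for x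
    define dy where "dy x = (d2 x * F1 x - d1 x * F2 x) / W" for x
    have y: "(y has_real_derivative dy x) (at x)" for x
    proof -
      have "(y has_real_derivative
          ((d2 x * F1 x + w1 x * h x * w2 x) - (d1 x * F2 x + w2 x * h x * w1 x)) / W) (at x)"
        unfolding y_def by (intro DERIV_cdivide DERIV_diff DERIV_mult w1 w2 F1 F2)
      then show ?thesis by (simp add: dy_def algebra_simps)
    qed
    have dy: "(dy has_real_derivative Q x * y x - h x) (at x)" for x
    proof -
      have "(dy has_real_derivative
          ((Q x * w2 x * F1 x + w1 x * h x * d2 x) - (Q x * w1 x * F2 x + w2 x * h x * d1 x)) / W) (at x)"
        unfolding dy_def by (intro DERIV_cdivide DERIV_diff DERIV_mult d1 d2 F1 F2)
      moreover have "((Q x * w2 x * F1 x + w1 x * h x * d2 x) - (Q x * w1 x * F2 x + w2 x * h x * d1 x)) / W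
          = Q x * y x - (d1 x * w2 x - w1 x * d2 x) * h x / W"
        unfolding y_def by (simp add: diff_divide_distrib add_divide_distrib algebra_simps)
      ultimately show ?thesis using W by simp
    qed
    have sd: "second_deriv y (\<lambda>x. Q x * y x - h x)" by (rule second_derivI[OF y dy])
    have ev: "y (2 * 0 - x) = y x" for x
      by (rule reflect[OF y dy]) (use bc F1 even_periodic_symmetric[OF Q] even_periodic_symmetric[OF h] in \<open>auto simp: dy_def\<close>)
    have evL: "y (2 * (L / 2) - x) = y x" for x
      by (rule reflect[OF y dy]) (use bc F2 even_periodic_symmetric[OF Q] even_periodic_symmetric[OF h] in \<open>auto simp: dy_def\<close>)
    have per: "y (x + L) = y x" for x
      using ev[of x] evL[of "- x"] by (simp add: add.commute)
    have ep: "even_periodic L y"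
      unfolding even_periodic_def using second_deriv_continuous[OF sd] ev per by auto
    have "\<bar>y x\<bar> \<le> C * M" if M: "\<And>x. \<bar>h x\<bar> \<le> M" for M x
    proof -
      obtain t where t: "0 \<le> t" "t \<le> L/2" "y x = y t"
        by (rule even_periodic_reduce[OF L, of x]) (use ep in blast)
      have M0: "0 \<le> M" using M[of 0] by linarith
      have lip: "\<bar>F b - F a\<bar> \<le> m * M * (L / 2)"
        if F: "\<And>x. (F has_real_derivative w x * h x) (at x)"
          and w: "\<And>x. x \<in> {0..L/2} \<Longrightarrow> \<bar>w x\<bar> \<le> m" and ab: "0 \<le> a" "a \<le> b" "b \<le> L/2"
        for F w :: "real \<Rightarrow> real" and m a b
      proof -
        have m0: "0 \<le> m" using w[of 0] L by auto
        have "norm (F b - F a) \<le> m * M * norm (b - a)"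
        proof (rule field_differentiable_bound[of "{0..L/2}"])
          show "norm (w z * h z) \<le> m * M" if "z \<in> {0..L/2}" for z
            using w[OF that] M[of z] m0 by (auto simp: abs_mult intro: mult_mono)
        qed (use ab F in \<open>auto intro: has_field_derivative_at_within\<close>)
        also have "\<dots> \<le> m * M * (L / 2)"
          using ab m0 M0 by (intro mult_left_mono) auto
        finally show ?thesis by simp
      qed
      have l1: "\<bar>F1 t\<bar> \<le> m1 * M * (L / 2)"
        using lip[OF F1(1) m1(2), of 0 t] t F1(2) by auto
      have l2: "\<bar>F2 t\<bar> \<le> m2 * M * (L / 2)"
        using lip[OF F2(1) m2(2), of t "L/2"] t F2(2) by auto
      have "\<bar>w2 t * F1 t - w1 t * F2 t\<bar> \<le> \<bar>w2 t\<bar> * \<bar>F1 t\<bar> + \<bar>w1 t\<bar> * \<bar>F2 t\<bar>"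
        by (metis abs_mult abs_triangle_ineq4)
      also have "\<dots> \<le> m2 * (m1 * M * (L / 2)) + m1 * (m2 * M * (L / 2))"
        using l1 l2 m1 m2 t by (intro add_mono mult_mono) auto
      also have "\<dots> = m1 * m2 * L * M" by (simp add: algebra_simps)
      finally have "\<bar>w2 t * F1 t - w1 t * F2 t\<bar> / \<bar>W\<bar> \<le> m1 * m2 * L * M / \<bar>W\<bar>"
        by (rule divide_right_mono) simp
      then have "\<bar>y t\<bar> \<le> C * M" by (simp add: y_def C_def)
      then show ?thesis using t(3) by simp
    qed
    with ep sd show ?thesis by blast
  qed
  \<comment> \<open>The Wronskian of \<open>z\<close> with \<open>w1\<close> is zero at
    \<open>0\<close>, hence at \<open>L / 2\<close>. There the slope of \<open>z\<close> vanishes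
    and \<open>d1\<close> does not, so \<open>z\<close> itself vanishes and \<open>ivp\<close>
    finishes.\<close>
  have uniq: "z x = 0" if z: "even_periodic L z" "second_deriv z (\<lambda>x. Q x * z x)" for z x
  proof -
    obtain dz where dz: "\<And>x. (z has_real_derivative dz x) (at x)"
      "\<And>x. (dz has_real_derivative Q x * z x) (at x)"
      using z(2) unfolding second_deriv_def by blast
    have n: "dz 0 = 0" "dz (L / 2) = 0"
      using symmetric_deriv_zero even_periodic_symmetric[OF z(1)] dz(1) by blast+
    have "dz (L / 2) * w1 (L / 2) - z (L / 2) * d1 (L / 2) = dz 0 * w1 0 - z 0 * d1 0"
      by (rule DERIV_isconst_all[of "\<lambda>x. dz x * w1 x - z x * d1 x"])
        (auto intro!: derivative_eq_intros dz w1 d1 simp: algebra_simps)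
    then have "z (L / 2) = 0" using n bc by simp
    then show ?thesis using ivp[OF dz] n by blast
  qed
  have "green_bound L Q C"
    unfolding green_bound_def
  proof (intro conjI allI impI)
    show "0 < C" by (rule Cpos)
    show "\<exists>y. even_periodic L y \<and> second_deriv y (\<lambda>x. Q x * y x - h x)" if "even_periodic L h" for h
      using ex[OF that] by blast
    show "\<bar>y x\<bar> \<le> C * M"
      if y: "even_periodic L y" and h: "even_periodic L h"
        and sd: "second_deriv y (\<lambda>x. Q x * y x - h x)" and M: "\<forall>x. \<bar>h x\<bar> \<le> M" for y h M x
    proof -
      obtain v where v: "even_periodic L v" "second_deriv v (\<lambda>x. Q x * v x - h x)" "\<forall>x. \<bar>v x\<bar> \<le> C * M"
        using ex[OF h] M by blast
      have "y x - v x = 0"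
        by (rule uniq[OF even_periodic_diff[OF y v(1)] second_deriv_cong[OF second_deriv_diff[OF sd v(2)]]])
          (simp add: algebra_simps)
      with v(3) show ?thesis by simp
    qed
  qed
  then show ?thesis by blast
qed

section \<open>The logarithmic potential\<close>

lemma isCont_if_removable:
  fixes f :: "real \<Rightarrow> real"
  assumes "(f \<longlongrightarrow> c) (at a)"
  shows "isCont (\<lambda>s. if s = a then c else f s) a"
proof -
  have "\<forall>\<^sub>F s in at a. f s = (if s = a then c else f s)"
    by (simp add: eventually_at_filter)
  from Lim_transform_eventually[OF assms this] show ?thesis by (simp add: isCont_def)
qed

lemma isCont_if_away:
  fixes f :: "real \<Rightarrow> real"
  assumes "isCont f s" "s \<noteq> a"
  shows "isCont (\<lambda>s. if s = a then c else f s) s"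
proof -
  have "\<forall>\<^sub>F t in nhds s. (if t = a then c else f t) = f t"
    by (rule eventually_mono[OF t1_space_nhds[OF assms(2)]]) auto
  with assms(1) show ?thesis by (simp add: isCont_cong)
qed

text \<open>The point \<open>exp (\<omega> / 2 - 1)\<close> is where g attains its maximum over the
  positive axis. Lying beyond it makes g'(r) negative, so (r, 0) is a centre of the phase
  plane.\<close>

locale log_potential =
  fixes \<omega> A r :: real
  assumes g_r: "\<omega> * r - 2 * r * ln r + A = 0"
    and r_gt: "exp (\<omega> / 2 - 1) < r"
begin

definition g0 :: "real \<Rightarrow> real" where "g0 s = \<omega> * s - 2 * s * ln s + A"
definition g1 :: "real \<Rightarrow> real" where "g1 s = \<omega> - 2 - 2 * ln s"
definition prim :: "real \<Rightarrow> real" where "prim s = \<omega> * s\<^sup>2 / 2 - s\<^sup>2 * ln s + s\<^sup>2 / 2 + A * s"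
definition G :: "real \<Rightarrow> real" where "G s = prim s - prim r"

text \<open>The region of the positive axis inside the well of the potential - G around
  \<open>r\<close>: on it - G strictly decreases up to \<open>r\<close> and strictly increases
  afterwards.\<close>

definition dom :: "real set" where "dom = {s. 0 < s \<and> (\<forall>t. s \<le> t \<and> t < r \<longrightarrow> 0 < g0 t)}"

lemma r_pos: "0 < r"
  using r_gt by (meson exp_gt_zero less_trans)

lemma g0_r: "g0 r = 0" and G_r: "G r = 0"
  using g_r by (auto simp: g0_def G_def)

lemma DERIV_g0: "0 < s \<Longrightarrow> (g0 has_real_derivative g1 s) (at s)"
  unfolding g0_def g1_def by (auto intro!: derivative_eq_intros simp: field_simps)

lemma DERIV_g1: "0 < s \<Longrightarrow> (g1 has_real_derivative - 2 / s) (at s)"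
  unfolding g1_def by (auto intro!: derivative_eq_intros)

lemma DERIV_G: "0 < s \<Longrightarrow> (G has_real_derivative g0 s) (at s)"
  unfolding G_def prim_def g0_def
  by (auto intro!: derivative_eq_intros simp: field_simps power2_eq_square)

lemma g1_neg: "exp (\<omega> / 2 - 1) < s \<Longrightarrow> g1 s < 0"
proof -
  assume a: "exp (\<omega> / 2 - 1) < s"
  then have "0 < s" by (meson exp_gt_zero less_trans)
  then have "\<omega> / 2 - 1 < ln s" using a by (metis exp_less_cancel_iff exp_ln)
  then show ?thesis by (simp add: g1_def)
qed

lemma g1_nonneg: "0 < s \<Longrightarrow> s \<le> exp (\<omega> / 2 - 1) \<Longrightarrow> 0 \<le> g1 s"
proof -
  assume a: "0 < s" "s \<le> exp (\<omega> / 2 - 1)"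
  then have "ln s \<le> \<omega> / 2 - 1" by (metis ln_exp ln_le_cancel_iff exp_gt_zero)
  then show ?thesis by (simp add: g1_def)
qed

lemma g1_r: "g1 r < 0"
  using g1_neg r_gt by blast

lemma g0_neg: "r < s \<Longrightarrow> g0 s < 0"
proof -
  assume s: "r < s"
  have "g0 s < g0 r"
    by (rule DERIV_neg_imp_decreasing[OF s])
      (use r_pos r_gt g1_neg DERIV_g0 in \<open>meson less_le_trans\<close>)
  then show ?thesis by (simp add: g0_r)
qed

lemma dom_pos: "s \<in> dom \<Longrightarrow> 0 < s"
  by (simp add: dom_def)

lemma r_in_dom: "r \<in> dom"
  by (simp add: dom_def r_pos)

lemma g0_pos: "s \<in> dom \<Longrightarrow> s < r \<Longrightarrow> 0 < g0 s"
  by (simp add: dom_def)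

lemma dom_upward: "s \<in> dom \<Longrightarrow> s \<le> t \<Longrightarrow> t \<in> dom"
  unfolding dom_def by auto

lemma g0_nonzero: "s \<in> dom \<Longrightarrow> s \<noteq> r \<Longrightarrow> g0 s \<noteq> 0"
  using g0_pos g0_neg by (metis less_irrefl linorder_neqE_linordered_idom)

lemma G_neg:
  assumes "s \<in> dom" "s \<noteq> r"
  shows "G s < 0"
proof (cases "s < r")
  case True
  have "G s < G r"
  proof (rule DERIV_pos_imp_increasing_open[OF True])
    show "\<exists>y. (G has_real_derivative y) (at x) \<and> 0 < y" if "s < x" "x < r" for x
      using that DERIV_G[of x] g0_pos[of x] dom_upward[OF assms(1), of x] dom_pos[of x] by auto
    show "continuous_on {s..r} G"
      using DERIV_G dom_pos[OF assms(1)]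
      by (intro DERIV_atLeastAtMost_imp_continuous_on) (meson less_le_trans)
  qed
  then show ?thesis by (simp add: G_r)
next
  case False
  then have rs: "r < s" using assms(2) by simp
  have "G s < G r"
  proof (rule DERIV_neg_imp_decreasing_open[OF rs])
    show "\<exists>y. (G has_real_derivative y) (at x) \<and> y < 0" if "r < x" "x < s" for x
      using that DERIV_G[of x] g0_neg[of x] r_pos by auto
    show "continuous_on {r..s} G"
      using DERIV_G r_pos
      by (intro DERIV_atLeastAtMost_imp_continuous_on) (meson less_le_trans)
  qed
  then show ?thesis by (simp add: G_r)
qed

section \<open>Chicone's condition by way of Schaaf's criterion\<close>

text \<open>The numerator of Chicone's convexity condition for the potential \<open>- G\<close>. Where \<open>g1 < 0\<close> it
  factors as \<open>schaaf_denom * M\<close> with \<open>M = - G + 3 g0\<^sup>2 g1 / schaaf_denom\<close>; differentiating \<open>M\<close> eliminates \<open>G\<close> and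
  leaves Schaaf's expression, which has the sign of \<open>- g0\<close>.\<close>

definition chicone :: "real \<Rightarrow> real" where
  "chicone s = - 6 * G s * (g1 s)\<^sup>2 + 3 * (g0 s)\<^sup>2 * g1 s - 4 * G s * g0 s / s"

definition schaaf_denom :: "real \<Rightarrow> real" where
  "schaaf_denom s = 6 * (g1 s)\<^sup>2 + 4 * g0 s / s"

lemma DERIV_schaaf_denom:
  assumes x: "0 < x"
  shows "(schaaf_denom has_real_derivative - 20 * g1 x / x - 4 * g0 x / x\<^sup>2) (at x)"
proof -
  have "(schaaf_denom has_real_derivative
      6 * (2 * (g1 x * (- 2 / x))) + (4 * g1 x * x - 4 * g0 x * 1) / (x * x)) (at x)"
    unfolding schaaf_denom_def using x
    by (intro DERIV_add DERIV_cmult DERIV_divide DERIV_g0 DERIV_ident)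
      (auto intro!: derivative_eq_intros DERIV_g1)
  moreover have "6 * (2 * (g1 x * (- 2 / x))) + (4 * g1 x * x - 4 * g0 x * 1) / (x * x)
      = - 20 * g1 x / x - 4 * g0 x / x\<^sup>2"
    using x by (simp add: field_simps power2_eq_square)
  ultimately show ?thesis by simp
qed

text \<open>To the left of \<open>r\<close> both summands are nonnegative and the first is positive.
  To the right \<open>g0\<close> is negative, and positivity is transported from \<open>r\<close> by
  monotonicity: with \<open>g1 < 0\<close> and \<open>g0 \<le> 0\<close> both terms of the
  derivative have the right sign.\<close>

lemma schaaf_denom_pos:
  assumes "s \<in> dom" "exp (\<omega> / 2 - 1) < s"
  shows "0 < schaaf_denom s"
proof (cases "s \<le> r")
  case True
  have "0 \<le> g0 s" using True g0_pos[OF assms(1)] g0_r by (cases "s = r") auto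
  moreover have "0 < (g1 s)\<^sup>2" using g1_neg[OF assms(2)] by simp
  ultimately show ?thesis
    unfolding schaaf_denom_def using dom_pos[OF assms(1)] by (intro add_pos_nonneg) auto
next
  case False
  then have rs: "r < s" by simp
  have "schaaf_denom r < schaaf_denom s"
  proof (rule DERIV_pos_imp_increasing[OF rs], intro exI conjI)
    fix x assume x: "r \<le> x" "x \<le> s"
    then have x0: "0 < x" using r_pos by linarith
    show "(schaaf_denom has_real_derivative - 20 * g1 x / x - 4 * g0 x / x\<^sup>2) (at x)"
      by (rule DERIV_schaaf_denom[OF x0])
    have "0 < - 20 * g1 x / x" using g1_neg[of x] x r_gt x0 by (simp add: divide_neg_pos mult_pos_neg)
    moreover have "0 \<le> - 4 * g0 x / x\<^sup>2"
      using g0_neg[of x] g0_r x by (cases "x = r") (auto simp: divide_nonpos_nonneg)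
    ultimately show "0 < - 20 * g1 x / x - 4 * g0 x / x\<^sup>2" by simp
  qed
  moreover have "0 < schaaf_denom r" using g1_r by (simp add: schaaf_denom_def g0_r)
  ultimately show ?thesis by simp
qed

lemma chicone_pos:
  assumes s: "s \<in> dom" "s \<noteq> r"
  shows "0 < chicone s"
proof (cases "s \<le> exp (\<omega> / 2 - 1)")
  \<comment> \<open>Here \<open>g1 \<ge> 0\<close> and \<open>g0 > 0\<close>, so the three terms of
    \<open>chicone\<close> are nonnegative one by one, the last one strictly positive.\<close>
  case True
  have s0: "0 < s" using dom_pos[OF s(1)] .
  have "s < r" using True r_gt by simp
  then have g: "0 < g0 s" using g0_pos s by blast
  have G: "G s < 0" using G_neg s by blast
  have a: "0 \<le> - 6 * G s * (g1 s)\<^sup>2" using G by (simp add: mult_nonpos_nonneg)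
  have b: "0 \<le> 3 * (g0 s)\<^sup>2 * g1 s" using g1_nonneg[OF s0 True] by simp
  have c: "0 < - 4 * G s * g0 s / s" using G g s0 by (simp add: mult_neg_pos divide_neg_pos)
  show ?thesis unfolding chicone_def using a b c by linarith
next
  case False
  then have s1: "exp (\<omega> / 2 - 1) < s" by simp
  define M where "M x = - G x + 3 * (g0 x)\<^sup>2 * g1 x / schaaf_denom x" for x
  have Mr: "M r = 0" by (simp add: M_def G_r g0_r)
  \<comment> \<open>With V = - G, the factor \<open>(20 - 6 * g1 x) / x\<^sup>2\<close> is Schaaf's
    expression 5 V'''^2 - 3 V'' V''''. It is positive since \<open>g1 < 0\<close>, so
    \<open>M\<close> falls to its value 0 at \<open>r\<close> and rises afterwards.\<close>
  have dM: "(M has_real_derivative - 2 * (g0 x)^3 * ((20 - 6 * g1 x) / x\<^sup>2) / (schaaf_denom x)\<^sup>2) (at x)"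
    if x: "x \<in> dom" "exp (\<omega> / 2 - 1) < x" for x
  proof -
    have x0: "0 < x" using dom_pos[OF x(1)] .
    have D0: "schaaf_denom x \<noteq> 0" using schaaf_denom_pos[OF x] by simp
    have dD: "(schaaf_denom has_real_derivative - 20 * g1 x / x - 4 * g0 x / x\<^sup>2) (at x)"
      by (rule DERIV_schaaf_denom[OF x0])
    have dn: "((\<lambda>x. 3 * (g0 x)\<^sup>2 * g1 x) has_real_derivative 6 * g0 x * (g1 x)\<^sup>2 - 6 * (g0 x)\<^sup>2 / x) (at x)"
      using x0 by (auto intro!: derivative_eq_intros DERIV_g0 DERIV_g1 simp: power2_eq_square)
    have "(M has_real_derivative - g0 x + ((6 * g0 x * (g1 x)\<^sup>2 - 6 * (g0 x)\<^sup>2 / x) * schaaf_denom x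
        - 3 * (g0 x)\<^sup>2 * g1 x * (- 20 * g1 x / x - 4 * g0 x / x\<^sup>2)) / (schaaf_denom x * schaaf_denom x)) (at x)"
      unfolding M_def by (intro DERIV_add DERIV_minus DERIV_G x0 DERIV_divide dn dD D0)
    moreover have "- g0 x + ((6 * g0 x * (g1 x)\<^sup>2 - 6 * (g0 x)\<^sup>2 / x) * schaaf_denom x
        - 3 * (g0 x)\<^sup>2 * g1 x * (- 20 * g1 x / x - 4 * g0 x / x\<^sup>2)) / (schaaf_denom x * schaaf_denom x)
        = - 2 * (g0 x)^3 * ((20 - 6 * g1 x) / x\<^sup>2) / (schaaf_denom x)\<^sup>2"
    proof -
      have "- g0 x * (schaaf_denom x)\<^sup>2 + ((6 * g0 x * (g1 x)\<^sup>2 - 6 * (g0 x)\<^sup>2 / x) * schaaf_denom x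
        - 3 * (g0 x)\<^sup>2 * g1 x * (- 20 * g1 x / x - 4 * g0 x / x\<^sup>2)) = - 2 * (g0 x)^3 * ((20 - 6 * g1 x) / x\<^sup>2)"
        unfolding schaaf_denom_def
        by (simp add: divide_inverse power2_eq_square power3_eq_cube algebra_simps)
      then show ?thesis using D0 by (simp add: field_simps power2_eq_square)
    qed
    ultimately show ?thesis by simp
  qed
  have "0 < M s"
  proof (cases "s < r")
    case True
    have "M r < M s"
    proof (rule DERIV_neg_imp_decreasing_open[OF True])
      show "\<exists>y. (M has_real_derivative y) (at x) \<and> y < 0" if "s < x" "x < r" for x
      proof (intro exI conjI)
        have xd: "x \<in> dom" "exp (\<omega> / 2 - 1) < x" using that dom_upward[OF s(1), of x] s1 by auto
        show "(M has_real_derivative - 2 * (g0 x)^3 * ((20 - 6 * g1 x) / x\<^sup>2) / (schaaf_denom x)\<^sup>2) (at x)"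
          by (rule dM[OF xd])
        have "0 < 20 - 6 * g1 x" using g1_neg[OF xd(2)] by simp
        then show "- 2 * (g0 x)^3 * ((20 - 6 * g1 x) / x\<^sup>2) / (schaaf_denom x)\<^sup>2 < 0"
          using g0_pos[OF xd(1)] that dom_pos[OF xd(1)] schaaf_denom_pos[OF xd]
          by (intro divide_neg_pos mult_neg_pos) auto
      qed
      show "continuous_on {s..r} M"
      proof (rule DERIV_atLeastAtMost_imp_continuous_on)
        show "\<exists>y. (M has_real_derivative y) (at x)" if "s \<le> x" "x \<le> r" for x
          using dM[of x] dom_upward[OF s(1), of x] s1 that by force
      qed
    qed
    then show ?thesis using Mr by simp
  next
    case False
    then have rs: "r < s" using s by simp
    have "M r < M s"
    proof (rule DERIV_pos_imp_increasing_open[OF rs])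
      show "\<exists>y. (M has_real_derivative y) (at x) \<and> 0 < y" if "r < x" "x < s" for x
      proof (intro exI conjI)
        have xd: "x \<in> dom" "exp (\<omega> / 2 - 1) < x" using that dom_upward[OF r_in_dom, of x] r_gt by auto
        show "(M has_real_derivative - 2 * (g0 x)^3 * ((20 - 6 * g1 x) / x\<^sup>2) / (schaaf_denom x)\<^sup>2) (at x)"
          by (rule dM[OF xd])
        have "0 < 20 - 6 * g1 x" using g1_neg[OF xd(2)] by simp
        moreover have "0 < - 2 * (g0 x)^3" using g0_neg[OF that(1)] by (simp add: power_less_zero_eq)
        ultimately have "0 < - 2 * (g0 x)^3 * ((20 - 6 * g1 x) / x\<^sup>2)"
          using dom_pos[OF xd(1)] by (intro mult_pos_pos[of "- 2 * (g0 x)^3"]) auto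
        then show "0 < - 2 * (g0 x)^3 * ((20 - 6 * g1 x) / x\<^sup>2) / (schaaf_denom x)\<^sup>2"
          using schaaf_denom_pos[OF xd] by (intro divide_pos_pos) auto
      qed
      show "continuous_on {r..s} M"
      proof (rule DERIV_atLeastAtMost_imp_continuous_on)
        show "\<exists>y. (M has_real_derivative y) (at x)" if "r \<le> x" "x \<le> s" for x
          using dM[of x] dom_upward[OF r_in_dom, of x] r_gt that by force
      qed
    qed
    then show ?thesis using Mr by simp
  qed
  moreover have "chicone s = schaaf_denom s * M s"
  proof -
    have "schaaf_denom s \<noteq> 0" using schaaf_denom_pos[OF s(1) s1] by simp
    then have "schaaf_denom s * M s = - G s * schaaf_denom s + 3 * (g0 s)\<^sup>2 * g1 s"
      by (simp add: M_def field_simps)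
    then show ?thesis using dom_pos[OF s(1)] by (simp add: chicone_def schaaf_denom_def field_simps)
  qed
  ultimately show ?thesis using schaaf_denom_pos[OF s(1) s1] by simp
qed

text \<open>The value at \<open>r\<close> comes from the leading terms:
  \<open>g1 r * (s - r)\<close> for \<open>g0\<close> and \<open>g1 r * (s - r)\<^sup>2 / 2\<close>
  for \<open>G\<close>.\<close>

definition ratio :: "real \<Rightarrow> real" where
  "ratio s = (if s = r then 1 / (2 * g1 r) else G s / (g0 s)\<^sup>2)"

text \<open>Half the derivative of Chicone's function - G/g0^2, so that its monotonicity is the
  convexity in question. The factor one half makes \<open>g0 * chicone_slope\<close> equal to
  \<open>g1 * ratio - 1 / 2\<close> off \<open>r\<close>.\<close>

definition chicone_slope :: "real \<Rightarrow> real" where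
  "chicone_slope s = (if s = r then - 1 / (3 * r * (g1 r)\<^sup>2)
     else (2 * G s * g1 s - (g0 s)\<^sup>2) / (2 * (g0 s)^3))"

lemma eventually_near_r: "eventually (\<lambda>s. 0 < s \<and> s \<noteq> r \<and> g0 s \<noteq> 0 \<and> g1 s < 0) (at r)"
proof -
  have e1: "eventually (\<lambda>s. s \<in> {exp (\<omega> / 2 - 1)<..}) (at r)"
    using r_gt by (intro eventually_at_in_open') auto
  have e2: "eventually (\<lambda>s. s \<noteq> r) (at r)" by (simp add: eventually_at_filter)
  have *: "g0 s \<noteq> 0" if "exp (\<omega> / 2 - 1) < s" "s \<noteq> r" for s
  proof -
    have s0: "0 < s" using that by (meson exp_gt_zero less_trans)
    show ?thesis
    proof (cases "s < r")
      case True
      have "g0 r < g0 s"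
        by (rule DERIV_neg_imp_decreasing[OF True])
          (use s0 that(1) g1_neg DERIV_g0 in \<open>meson less_le_trans\<close>)
      then show ?thesis using g0_r by simp
    next
      case False
      then show ?thesis using g0_neg[of s] that by auto
    qed
  qed
  show ?thesis
    using e1 e2 by eventually_elim (use g1_neg * in \<open>auto intro: less_trans[OF exp_gt_zero]\<close>)
qed

lemma tendsto_at_r:
  "(g0 \<longlongrightarrow> 0) (at r)" "(G \<longlongrightarrow> 0) (at r)" "(g1 \<longlongrightarrow> g1 r) (at r)"
  using DERIV_isCont[OF DERIV_g0[OF r_pos]] DERIV_isCont[OF DERIV_G[OF r_pos]]
    DERIV_isCont[OF DERIV_g1[OF r_pos]] g0_r G_r by (auto simp: isCont_def)

lemma ratio_tendsto: "((\<lambda>s. G s / (g0 s)\<^sup>2) \<longlongrightarrow> 1 / (2 * g1 r)) (at r)"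
proof (rule lhopital[where f' = g0 and g' = "\<lambda>s. 2 * g0 s * g1 s"])
  show "((\<lambda>s. (g0 s)\<^sup>2) \<longlongrightarrow> 0) (at r)"
    using tendsto_power[OF tendsto_at_r(1), of 2] by simp
  show "\<forall>\<^sub>F s in at r. (g0 s)\<^sup>2 \<noteq> 0"
    using eventually_near_r by eventually_elim auto
  show "\<forall>\<^sub>F s in at r. 2 * g0 s * g1 s \<noteq> 0"
    using eventually_near_r by eventually_elim auto
  show "\<forall>\<^sub>F s in at r. (G has_real_derivative g0 s) (at s)"
    using eventually_near_r by eventually_elim (auto intro: DERIV_G)
  show "\<forall>\<^sub>F s in at r. ((\<lambda>s. (g0 s)\<^sup>2) has_real_derivative 2 * g0 s * g1 s) (at s)"
    using eventually_near_r
    by eventually_elim (auto intro!: derivative_eq_intros DERIV_g0)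
  have "((\<lambda>s. 1 / (2 * g1 s)) \<longlongrightarrow> 1 / (2 * g1 r)) (at r)"
    using g1_r by (intro tendsto_intros tendsto_at_r) auto
  moreover have "\<forall>\<^sub>F s in at r. 1 / (2 * g1 s) = g0 s / (2 * g0 s * g1 s)"
    using eventually_near_r by eventually_elim auto
  ultimately show "((\<lambda>s. g0 s / (2 * g0 s * g1 s)) \<longlongrightarrow> 1 / (2 * g1 r)) (at r)"
    by (rule Lim_transform_eventually)
qed (rule tendsto_at_r)

text \<open>In the derivative of the numerator the terms with \<open>g0 * g1\<close> cancel, leaving
  \<open>- 4 * G s / s\<close>. After one application of l'Hopital the quotient is therefore
  \<open>ratio\<close> times a continuous factor.\<close>

lemma chicone_slope_tendsto:
  "((\<lambda>s. (2 * G s * g1 s - (g0 s)\<^sup>2) / (2 * (g0 s)^3)) \<longlongrightarrow> - 1 / (3 * r * (g1 r)\<^sup>2)) (at r)"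
proof (rule lhopital[where f' = "\<lambda>s. - 4 * G s / s" and g' = "\<lambda>s. 6 * (g0 s)\<^sup>2 * g1 s"])
  have "((\<lambda>s. 2 * G s * g1 s - (g0 s)\<^sup>2) \<longlongrightarrow> 2 * 0 * g1 r - 0\<^sup>2) (at r)"
    by (intro tendsto_intros tendsto_at_r)
  then show "((\<lambda>s. 2 * G s * g1 s - (g0 s)\<^sup>2) \<longlongrightarrow> 0) (at r)" by simp
  have "((\<lambda>s. 2 * (g0 s)^3) \<longlongrightarrow> 2 * 0^3) (at r)"
    by (intro tendsto_intros tendsto_at_r)
  then show "((\<lambda>s. 2 * (g0 s)^3) \<longlongrightarrow> 0) (at r)" by simp
  show "\<forall>\<^sub>F s in at r. 2 * (g0 s)^3 \<noteq> 0"
    using eventually_near_r by eventually_elim auto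
  show "\<forall>\<^sub>F s in at r. 6 * (g0 s)\<^sup>2 * g1 s \<noteq> 0"
    using eventually_near_r by eventually_elim auto
  show "\<forall>\<^sub>F s in at r. ((\<lambda>s. 2 * G s * g1 s - (g0 s)\<^sup>2) has_real_derivative - 4 * G s / s) (at s)"
    using eventually_near_r
    by eventually_elim (auto intro!: derivative_eq_intros DERIV_g0 DERIV_g1 DERIV_G)
  show "\<forall>\<^sub>F s in at r. ((\<lambda>s. 2 * (g0 s)^3) has_real_derivative 6 * (g0 s)\<^sup>2 * g1 s) (at s)"
    using eventually_near_r
    by eventually_elim (auto intro!: derivative_eq_intros DERIV_g0)
  have l1: "((\<lambda>s. - 2 / 3 * (G s / (g0 s)\<^sup>2) / (s * g1 s)) \<longlongrightarrow> - 2 / 3 * (1 / (2 * g1 r)) / (r * g1 r)) (at r)"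
    using g1_r r_pos by (intro tendsto_intros tendsto_at_r ratio_tendsto) auto
  have l2: "\<forall>\<^sub>F s in at r. - 2 / 3 * (G s / (g0 s)\<^sup>2) / (s * g1 s) = (- 4 * G s / s) / (6 * (g0 s)\<^sup>2 * g1 s)"
    using eventually_near_r by eventually_elim (auto simp: field_simps)
  have l3: "- 2 / 3 * (1 / (2 * g1 r)) / (r * g1 r) = - 1 / (3 * r * (g1 r)\<^sup>2)"
    using g1_r r_pos by (simp add: field_simps power2_eq_square)
  show "((\<lambda>s. (- 4 * G s / s) / (6 * (g0 s)\<^sup>2 * g1 s)) \<longlongrightarrow> - 1 / (3 * r * (g1 r)\<^sup>2)) (at r)"
    using Lim_transform_eventually[OF l1 l2] unfolding l3 .
qed

lemma isCont_ratio: assumes "s \<in> dom" shows "isCont ratio s"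
proof (cases "s = r")
  case True
  then show ?thesis
    using isCont_if_removable[OF ratio_tendsto] by (simp add: ratio_def[abs_def])
next
  case False
  have "isCont (\<lambda>s. G s / (g0 s)\<^sup>2) s"
    using DERIV_isCont[OF DERIV_G] DERIV_isCont[OF DERIV_g0] dom_pos[OF assms] g0_nonzero[OF assms False]
    by (intro continuous_intros) auto
  from isCont_if_away[OF this False] show ?thesis by (simp add: ratio_def[abs_def])
qed

lemma isCont_chicone_slope: assumes "s \<in> dom" shows "isCont chicone_slope s"
proof (cases "s = r")
  case True
  then show ?thesis
    using isCont_if_removable[OF chicone_slope_tendsto] by (simp add: chicone_slope_def[abs_def])
next
  case False
  have "isCont (\<lambda>s. (2 * G s * g1 s - (g0 s)\<^sup>2) / (2 * (g0 s)^3)) s"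
    using DERIV_isCont[OF DERIV_G] DERIV_isCont[OF DERIV_g0] DERIV_isCont[OF DERIV_g1]
      dom_pos[OF assms] g0_nonzero[OF assms False]
    by (intro continuous_intros) auto
  from isCont_if_away[OF this False] show ?thesis by (simp add: chicone_slope_def[abs_def])
qed

lemma DERIV_chicone_slope:
  assumes s: "s \<in> dom" "s \<noteq> r"
  shows "(chicone_slope has_real_derivative chicone s / (2 * (g0 s)^4)) (at s)"
proof -
  have s0: "0 < s" and g: "g0 s \<noteq> 0" using dom_pos g0_nonzero s by auto
  have "((\<lambda>s. 2 * G s * g1 s - (g0 s)\<^sup>2) has_real_derivative - 4 * G s / s) (at s)"
    using s0 by (auto intro!: derivative_eq_intros DERIV_g0 DERIV_g1 DERIV_G)
  moreover have "((\<lambda>s. 2 * (g0 s)^3) has_real_derivative 6 * (g0 s)\<^sup>2 * g1 s) (at s)"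
    using s0 by (auto intro!: derivative_eq_intros DERIV_g0)
  ultimately have "((\<lambda>s. (2 * G s * g1 s - (g0 s)\<^sup>2) / (2 * (g0 s)^3)) has_real_derivative
     ((- 4 * G s / s) * (2 * (g0 s)^3) - (2 * G s * g1 s - (g0 s)\<^sup>2) * (6 * (g0 s)\<^sup>2 * g1 s))
      / ((2 * (g0 s)^3) * (2 * (g0 s)^3))) (at s)"
    using g by (intro DERIV_divide) auto
  moreover have "((- 4 * G s / s) * (2 * (g0 s)^3) - (2 * G s * g1 s - (g0 s)\<^sup>2) * (6 * (g0 s)\<^sup>2 * g1 s))
      / ((2 * (g0 s)^3) * (2 * (g0 s)^3)) = chicone s / (2 * (g0 s)^4)"
    using g s0 unfolding chicone_def by (simp add: field_simps power2_eq_square power3_eq_cube power4_eq_xxxx)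
  ultimately have d: "((\<lambda>s. (2 * G s * g1 s - (g0 s)\<^sup>2) / (2 * (g0 s)^3)) has_real_derivative
      chicone s / (2 * (g0 s)^4)) (at s)" by simp
  have "\<forall>\<^sub>F t in nhds s. chicone_slope t = (2 * G t * g1 t - (g0 t)\<^sup>2) / (2 * (g0 t)^3)"
    by (rule eventually_mono[OF t1_space_nhds[OF s(2)]]) (auto simp: chicone_slope_def)
  with d show ?thesis by (subst DERIV_cong_ev[OF refl _ refl]) auto
qed

lemma DERIV_g0_ratio:
  assumes s: "s \<in> dom"
  shows "((\<lambda>s. g0 s * ratio s) has_real_derivative 1 - g1 s * ratio s) (at s)"
proof (cases "s = r")
  case True
  obtain k where k: "\<And>z. g0 z - g0 r = k z * (z - r)" "isCont k r" "k r = g1 r"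
    using DERIV_g0[OF r_pos] unfolding CARAT_DERIV by blast
  have "((\<lambda>s. g0 s * ratio s) has_real_derivative g1 r * ratio r) (at r)"
    \<comment> \<open>At \<open>r\<close> only continuity of \<open>ratio\<close> is at hand. Since
      \<open>g0 r = 0\<close>, the product has Caratheodory slope \<open>k * ratio\<close>; its
      value 1/2 agrees with \<open>1 - g1 r * ratio r\<close>.\<close>
    unfolding CARAT_DERIV
  proof (intro exI conjI allI)
    show "g0 z * ratio z - g0 r * ratio r = (k z * ratio z) * (z - r)" for z
      using k(1)[of z] g0_r by simp
    show "isCont (\<lambda>z. k z * ratio z) r"
      using k(2) isCont_ratio[OF r_in_dom] by (intro continuous_intros)
  qed (simp add: k)
  moreover have "g1 r * ratio r = 1 - g1 r * ratio r"
    using g1_r by (simp add: ratio_def)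
  ultimately show ?thesis using True by metis
next
  case False
  have s0: "0 < s" and g: "g0 s \<noteq> 0" using dom_pos g0_nonzero s False by auto
  have "((\<lambda>s. G s / g0 s) has_real_derivative (g0 s * g0 s - G s * g1 s) / (g0 s * g0 s)) (at s)"
    using s0 g by (intro DERIV_divide DERIV_G DERIV_g0)
  moreover have "(g0 s * g0 s - G s * g1 s) / (g0 s * g0 s) = 1 - g1 s * ratio s"
    using g False by (simp add: ratio_def field_simps power2_eq_square)
  ultimately have d: "((\<lambda>s. G s / g0 s) has_real_derivative 1 - g1 s * ratio s) (at s)" by simp
  have "\<forall>\<^sub>F t in nhds s. g0 t * ratio t = G t / g0 t"
    by (rule eventually_mono[OF t1_space_nhds[OF False]]) (auto simp: ratio_def power2_eq_square)
  with d show ?thesis by (subst DERIV_cong_ev[OF refl _ refl]) auto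
qed

end

section \<open>Non-degeneracy of positive periodic orbits\<close>

lemma gronwall_zero:
  fixes E :: "real \<Rightarrow> real"
  assumes E: "\<And>x. (E has_real_derivative E' x) (at x)"
    and nonneg: "\<And>x. 0 \<le> E x" and bound: "\<And>x. \<bar>E' x\<bar> \<le> K * E x" and zero: "E a = 0"
  shows "E x = 0"
proof (cases "a \<le> x")
  case True
  have "E x * exp (- K * x) \<le> E a * exp (- K * a)"
  proof (rule DERIV_nonpos_imp_nonincreasing[OF True])
    fix t
    have "((\<lambda>t. E t * exp (- K * t)) has_real_derivative (E' t - K * E t) * exp (- K * t)) (at t)"
      by (auto intro!: derivative_eq_intros E simp: algebra_simps)
    moreover have "(E' t - K * E t) * exp (- K * t) \<le> 0"
      using bound[of t] by (intro mult_nonpos_nonneg) auto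
    ultimately show "\<exists>y. ((\<lambda>t. E t * exp (- K * t)) has_real_derivative y) (at t) \<and> y \<le> 0" by blast
  qed
  then show ?thesis using nonneg[of x] zero by (simp add: mult_le_0_iff)
next
  case False
  then have xa: "x \<le> a" by simp
  have "E x * exp (K * x) \<le> E a * exp (K * a)"
  proof (rule DERIV_nonneg_imp_nondecreasing[OF xa])
    fix t
    have "((\<lambda>t. E t * exp (K * t)) has_real_derivative (E' t + K * E t) * exp (K * t)) (at t)"
      by (auto intro!: derivative_eq_intros E simp: algebra_simps)
    moreover have "0 \<le> (E' t + K * E t) * exp (K * t)"
      using bound[of t] by (intro mult_nonneg_nonneg) auto
    ultimately show "\<exists>y. ((\<lambda>t. E t * exp (K * t)) has_real_derivative y) (at t) \<and> 0 \<le> y" by blast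
  qed
  then show ?thesis using nonneg[of x] zero by (simp add: mult_le_0_iff)
qed

text \<open>An accumulation point of zeros would be a zero at which difference quotients vanish
  arbitrarily close by, contradicting a nonzero derivative.\<close>

lemma finite_simple_zeros:
  fixes y :: "real \<Rightarrow> real"
  assumes y: "\<And>x. (y has_real_derivative d x) (at x)" and simple: "\<And>x. y x = 0 \<Longrightarrow> d x \<noteq> 0"
  shows "finite {x \<in> {a..b}. y x = 0}"
proof (rule ccontr)
  let ?S = "{x \<in> {a..b}. y x = 0}"
  assume "infinite ?S"
  then obtain x where x: "x islimpt ?S"
    using compact_eq_Bolzano_Weierstrass[of "{a..b}"] by (metis (no_types, lifting) compact_Icc mem_Collect_eq subsetI)
  have cont: "continuous_on UNIV y"
    using y by (meson DERIV_isCont continuous_at_imp_continuous_on)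
  have "closed {x. y x = 0}" using cont by (intro closed_Collect_eq) auto
  moreover have "x islimpt {x. y x = 0}" by (rule islimpt_subset[OF x]) auto
  ultimately have yx: "y x = 0" by (auto simp: closed_limpt)
  have "((\<lambda>t. (y t - y x) / (t - x)) \<longlongrightarrow> d x) (at x)"
    using y[of x] by (simp add: has_field_derivative_iff)
  then have "\<forall>\<^sub>F t in at x. (y t - y x) / (t - x) \<noteq> 0"
    using simple[OF yx] by (rule tendsto_imp_eventually_ne)
  then have "\<forall>\<^sub>F t in at x. t \<notin> ?S"
    by eventually_elim (auto simp: yx)
  then show False using x by (simp add: islimpt_iff_eventually)
qed

text \<open>Continuity bridges the exceptional points: the induction cuts the interval at one of
  them and adds up the two strict decreases.\<close>

lemma decreasing_except_finite:
  fixes f :: "real \<Rightarrow> real"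
  assumes "finite S" and "a < b" and cont: "continuous_on UNIV f"
    and "\<And>x. a < x \<Longrightarrow> x < b \<Longrightarrow> x \<notin> S \<Longrightarrow> \<exists>y. (f has_real_derivative y) (at x) \<and> y < 0"
  shows "f b < f a"
  using assms(1,2,4)
proof (induction S arbitrary: a b rule: finite_induct)
  case empty
  then show ?case
    using cont by (intro DERIV_neg_imp_decreasing_open[of a b f]) (auto intro: continuous_on_subset)
next
  case (insert s S)
  show ?case
  proof (cases "a < s \<and> s < b")
    case True
    have "f s < f a" using True insert.prems(2) by (intro insert.IH) auto
    moreover have "f b < f s" using True insert.prems(2) by (intro insert.IH) auto
    ultimately show ?thesis by simp
  next
    case False
    show ?thesis using False insert.prems by (intro insert.IH) auto
  qed
qed

locale positive_orbit = log_potential +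
  fixes L :: real and u u' :: "real \<Rightarrow> real"
  assumes L: "0 < L" and ep: "even_periodic L u" and pos: "\<And>x. 0 < u x"
    and u: "\<And>x. (u has_real_derivative u' x) (at x)"
    and u': "\<And>x. (u' has_real_derivative g0 (u x)) (at x)"
    and below: "\<exists>x. u x < r" and above: "\<exists>x. r < u x"
begin

text \<open>Since \<open>dom\<close> is upward closed, only the minimum value \<open>c\<close>
  matters. If \<open>g0 c\<close> were negative, \<open>u\<close> would dip below its minimum; if
  zero, \<open>u\<close> would be the constant \<open>c\<close>. So \<open>g0 c > 0\<close>, and as
  \<open>g0\<close> first rises and then falls to its zero \<open>r\<close>, it is positive on all
  of \<open>[c, r)\<close>.\<close>

lemma u_in_dom: "u x \<in> dom"
proof -
  obtain x0 where min: "\<And>x. u x0 \<le> u x" using even_periodic_attains_inf[OF L ep] by blast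
  define c where "c = u x0"
  have c0: "0 < c" using pos by (simp add: c_def)
  have cr: "c < r" using below min unfolding c_def by (meson le_less_trans)
  have u'0: "u' x0 = 0"
    by (rule DERIV_local_min[OF u, of 1]) (use min in auto)
  have dec: "0 < g0 t" if "exp (\<omega> / 2 - 1) < t" "t < r" for t
  proof -
    have "g0 r < g0 t"
      by (rule DERIV_neg_imp_decreasing[OF that(2)])
        (use that(1) g1_neg DERIV_g0 in \<open>meson less_le_trans exp_gt_zero less_trans\<close>)
    then show ?thesis using g0_r by simp
  qed
  have "0 < g0 c"
  proof (rule ccontr)
    assume "\<not> 0 < g0 c"
    then consider "g0 c < 0" | "g0 c = 0" by linarith
    then show False
    proof cases
      case 1
      then obtain d where d: "0 < d" "\<And>h. 0 < h \<Longrightarrow> h < d \<Longrightarrow> u' (x0 + h) < u' x0"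
        using DERIV_neg_dec_right[OF u'[of x0]] by (auto simp: c_def)
      have "u (x0 + d / 2) < u x0"
      proof (rule DERIV_neg_imp_decreasing_open[of x0 "x0 + d / 2" u])
        show "\<exists>y. (u has_real_derivative y) (at x) \<and> y < 0" if "x0 < x" "x < x0 + d / 2" for x
          using d(2)[of "x - x0"] that u[of x] d(1) u'0 by auto
        show "continuous_on {x0..x0 + d / 2} u"
          using ep by (auto simp: even_periodic_def intro: continuous_on_subset)
      qed (use d in auto)
      then show False using min[of "x0 + d / 2"] by simp
    next
      case 2
      obtain B where B: "0 < B" "\<And>x. \<bar>u x\<bar> \<le> B" using even_periodic_bounded[OF L ep] by blast
      \<comment> \<open>\<open>g1\<close> is monotone, so its values between \<open>c\<close> and
        \<open>B\<close> are bounded by those at the two ends.\<close>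
      define K where "K = \<bar>g1 c\<bar> + \<bar>g1 B\<bar>"
      have lip: "\<bar>g0 s\<bar> \<le> K * \<bar>s - c\<bar>" if "c \<le> s" "s \<le> B" for s
      proof -
        have "norm (g0 s - g0 c) \<le> K * norm (s - c)"
        proof (rule field_differentiable_bound[of "{c..B}"])
          show "(g0 has_field_derivative g1 z) (at z within {c..B})" if "z \<in> {c..B}" for z
            using that c0 by (auto intro: has_field_derivative_at_within[OF DERIV_g0])
          show "norm (g1 z) \<le> K" if "z \<in> {c..B}" for z
          proof -
            have "ln c \<le> ln z" "ln z \<le> ln B" using that c0 by auto
            then show ?thesis unfolding K_def g1_def by (simp add: abs_if)
          qed
        qed (use that in auto)
        then show ?thesis using 2 by simp
      qed
      \<comment> \<open>The squared distance of \<open>(u, u')\<close> to the rest point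
        \<open>(c, 0)\<close> vanishes at \<open>x0\<close>, hence everywhere; but \<open>u\<close>
        also takes values above \<open>r\<close>.\<close>
      have "(u x - c)\<^sup>2 + (u' x)\<^sup>2 = 0" for x
      proof (rule gronwall_zero[where E = "\<lambda>x. (u x - c)\<^sup>2 + (u' x)\<^sup>2" and K = "1 + K" and a = x0])
        show "((\<lambda>x. (u x - c)\<^sup>2 + (u' x)\<^sup>2) has_real_derivative
            2 * (u x - c) * u' x + 2 * u' x * g0 (u x)) (at x)" for x
          by (auto intro!: derivative_eq_intros u u')
        show "\<bar>2 * (u x - c) * u' x + 2 * u' x * g0 (u x)\<bar> \<le> (1 + K) * ((u x - c)\<^sup>2 + (u' x)\<^sup>2)" for x
        proof -
          have K0: "0 \<le> K" by (simp add: K_def)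
          have "\<bar>g0 (u x)\<bar> \<le> K * \<bar>u x - c\<bar>"
            using lip[of "u x"] min[of x] B(2)[of x] by (auto simp: c_def)
          then have "\<bar>u' x\<bar> * \<bar>g0 (u x)\<bar> \<le> \<bar>u' x\<bar> * (K * \<bar>u x - c\<bar>)"
            by (intro mult_left_mono) auto
          moreover have "\<bar>2 * (u x - c) * u' x + 2 * u' x * g0 (u x)\<bar>
              \<le> 2 * \<bar>u x - c\<bar> * \<bar>u' x\<bar> + 2 * (\<bar>u' x\<bar> * \<bar>g0 (u x)\<bar>)"
            by (rule order_trans[OF abs_triangle_ineq]) (simp only: abs_mult abs_numeral mult.assoc order_refl)
          ultimately have "\<bar>2 * (u x - c) * u' x + 2 * u' x * g0 (u x)\<bar> \<le> (1 + K) * (2 * \<bar>u x - c\<bar> * \<bar>u' x\<bar>)"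
            by (simp add: algebra_simps)
          also have "\<dots> \<le> (1 + K) * ((u x - c)\<^sup>2 + (u' x)\<^sup>2)"
            using K0 sum_squares_bound[of "\<bar>u x - c\<bar>" "\<bar>u' x\<bar>"] by (intro mult_left_mono) auto
          finally show ?thesis .
        qed
        show "(u x0 - c)\<^sup>2 + (u' x0)\<^sup>2 = 0" by (simp add: c_def u'0)
      qed auto
      then have "u x = c" for x by (metis (no_types) sum_power2_eq_zero_iff right_minus_eq)
      then show False using above cr by auto
    qed
  qed
  then have "0 < g0 t" if "c \<le> t" "t < r" for t
  proof (cases "exp (\<omega> / 2 - 1) < t")
    case True
    then show ?thesis using dec that by blast
  next
    case False
    have "g0 c \<le> g0 t"
      by (rule DERIV_nonneg_imp_nondecreasing[OF that(1)])
        (use False c0 g1_nonneg DERIV_g0 in \<open>meson less_le_trans not_less order_trans\<close>)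
    then show ?thesis using \<open>0 < g0 c\<close> by simp
  qed
  then have "c \<in> dom" unfolding dom_def using c0 by auto
  then show ?thesis using dom_upward min by (simp add: c_def)
qed

definition energy :: real where "energy = (u' 0)\<^sup>2 / 2 - G (u 0)"

lemma energy: "(u' x)\<^sup>2 / 2 - G (u x) = energy"
proof -
  have "((\<lambda>x. (u' x)\<^sup>2 / 2 - G (u x)) has_real_derivative 0) (at x)" for x
  proof -
    have "((\<lambda>x. G (u x)) has_real_derivative g0 (u x) * u' x) (at x)"
      by (rule DERIV_chain2[OF DERIV_G[OF pos] u])
    then show ?thesis by (auto intro!: derivative_eq_intros u')
  qed
  then show ?thesis
    unfolding energy_def using DERIV_isconst_all[of "\<lambda>x. (u' x)\<^sup>2 / 2 - G (u x)" x 0] by blast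
qed

lemma energy_pos: "0 < energy"
proof -
  obtain x where "u x < r" using below by blast
  then have "G (u x) < 0" using G_neg[OF u_in_dom] by auto
  then show ?thesis using energy[of x] by (smt (verit) zero_le_power2 divide_nonneg_pos)
qed

lemma neumann: "u' 0 = 0" "u' (L / 2) = 0"
  using symmetric_deriv_zero[OF even_periodic_symmetric(1)[OF ep] u]
    symmetric_deriv_zero[OF even_periodic_symmetric(2)[OF ep] u] by blast+

text \<open>At the level \<open>r\<close> the potential term is zero and the whole positive energy
  is kinetic. Consequently the zeros of \<open>u - r\<close> are simple, and so are those of
  \<open>u'\<close>, which never fall on this level.\<close>

lemma crossing: "u x = r \<Longrightarrow> u' x \<noteq> 0"
  using energy[of x] energy_pos G_r by auto

lemma g0_ratio: "g0 (u x) * (g0 (u x) * ratio (u x)) = G (u x)"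
  using g0_nonzero[OF u_in_dom, of x] g0_r G_r by (auto simp: ratio_def power2_eq_square)

text \<open>With \<open>P' = g1(u) G(u)/g0(u)\<^sup>2 - 1/2\<close>, the function \<open>P u' + G(u)/g0(u)\<close> is a second solution of the
  linearised equation. The primitive \<open>P\<close> plays the role of the derivative of the period with respect to
  the energy; it is compared with \<open>u' K(u)\<close>, \<open>K = chicone_slope\<close>, which vanishes at both end points
  and grows faster than \<open>P\<close> because \<open>K\<close> is increasing.\<close>

lemma green_bound: "\<exists>C. green_bound L (\<lambda>x. g1 (u x)) C"
proof -
  have comp: "continuous_on UNIV (\<lambda>x. F (u x))" if "\<And>s. s \<in> dom \<Longrightarrow> isCont F s" for F :: "real \<Rightarrow> real"
    by (rule continuous_at_imp_continuous_on) (use isCont_o2[OF DERIV_isCont[OF u] that[OF u_in_dom]] in blast)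
  have c1: "continuous_on UNIV (\<lambda>x. g1 (u x))"
    by (rule comp) (use DERIV_isCont[OF DERIV_g1] dom_pos in auto)
  have c2: "continuous_on UNIV (\<lambda>x. ratio (u x))"
    by (rule comp[OF isCont_ratio])
  obtain P where P: "\<And>x. (P has_real_derivative g1 (u x) * ratio (u x) - 1 / 2) (at x)" "P 0 = 0"
    by (rule antiderivative_on_reals[of "\<lambda>x. g1 (u x) * ratio (u x) - 1 / 2"])
      (auto intro!: continuous_intros c1 c2)
  define B where "B x = u' x * chicone_slope (u x)" for x
  \<comment> \<open>Excluded are the crossings of \<open>r\<close>, where
    \<open>DERIV_chicone_slope\<close> says nothing, and the turning points, where the strict term
    with the square of \<open>u'\<close> vanishes. Both are simple zeros, hence finitely
    many.\<close>
  have "P (L / 2) - B (L / 2) < P 0 - B 0"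
  proof (rule decreasing_except_finite[where f = "\<lambda>x. P x - B x" and a = 0 and b = "L / 2"
        and S = "{x \<in> {0..L/2}. u x - r = 0} \<union> {x \<in> {0..L/2}. u' x = 0}"])
    show "finite ({x \<in> {0..L/2}. u x - r = 0} \<union> {x \<in> {0..L/2}. u' x = 0})"
    proof (intro finite_UnI)
      show "finite {x \<in> {0..L/2}. u x - r = 0}"
        by (rule finite_simple_zeros[where d = u']) (use crossing in \<open>auto intro!: derivative_eq_intros u\<close>)
      show "finite {x \<in> {0..L/2}. u' x = 0}"
        by (rule finite_simple_zeros[OF u']) (use crossing g0_nonzero[OF u_in_dom] in auto)
    qed
    show "continuous_on UNIV (\<lambda>x. P x - B x)"
      unfolding B_def
      by (intro continuous_intros comp isCont_chicone_slope)
        (use P(1) u' in \<open>auto intro!: continuous_at_imp_continuous_on DERIV_isCont\<close>)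
    fix x assume x: "0 < x" "x < L / 2"
      "x \<notin> {x \<in> {0..L/2}. u x - r = 0} \<union> {x \<in> {0..L/2}. u' x = 0}"
    then have ne: "u x \<noteq> r" "u' x \<noteq> 0" by auto
    have g: "g0 (u x) \<noteq> 0" using g0_nonzero[OF u_in_dom ne(1)] .
    have "((\<lambda>x. chicone_slope (u x)) has_real_derivative chicone (u x) / (2 * (g0 (u x))^4) * u' x) (at x)"
      by (rule DERIV_chain2[OF DERIV_chicone_slope[OF u_in_dom ne(1)] u])
    then have "(B has_real_derivative
        g0 (u x) * chicone_slope (u x) + (chicone (u x) / (2 * (g0 (u x))^4) * u' x) * u' x) (at x)"
      unfolding B_def by (rule DERIV_mult[OF u'])
    from DERIV_diff[OF P(1) this]
    have "((\<lambda>x. P x - B x) has_real_derivative (g1 (u x) * ratio (u x) - 1 / 2)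
        - (g0 (u x) * chicone_slope (u x) + (chicone (u x) / (2 * (g0 (u x))^4) * u' x) * u' x)) (at x)" .
    moreover have "g0 (u x) * chicone_slope (u x) = g1 (u x) * ratio (u x) - 1 / 2"
      using g ne by (simp add: chicone_slope_def ratio_def field_simps power2_eq_square power3_eq_cube)
    moreover have "0 < chicone (u x) / (2 * (g0 (u x))^4) * u' x * u' x"
    proof -
      have "0 < chicone (u x) / (2 * (g0 (u x))^4)"
        using chicone_pos[OF u_in_dom ne(1)] g by (intro divide_pos_pos) auto
      moreover have "0 < u' x * u' x" using ne(2) by (auto simp: zero_less_mult_iff)
      ultimately show ?thesis by (metis mult.assoc mult_pos_pos)
    qed
    ultimately show "\<exists>y. ((\<lambda>x. P x - B x) has_real_derivative y) (at x) \<and> y < 0"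
      by (intro exI conjI) auto
  qed (use L in auto)
  then have Pneg: "P (L / 2) < 0" using neumann P(2) by (simp add: B_def)
  \<comment> \<open>The product \<open>g0 * ratio\<close> is the continuous form of G/g0. Different
    \<open>c\<close> differ by multiples of \<open>u'\<close>: the choice \<open>c = 0\<close> meets
    the Neumann condition at \<open>0\<close>, and \<open>c = P (L / 2)\<close> the one at
    \<open>L / 2\<close>.\<close>
  define w where "w c x = (P x - c) * u' x + g0 (u x) * ratio (u x)" for c x
  define d where "d c x = u' x / 2 + (P x - c) * g0 (u x)" for c x
  have w: "(w c has_real_derivative d c x) (at x)" for c x
  proof -
    have "((\<lambda>x. g0 (u x) * ratio (u x)) has_real_derivative (1 - g1 (u x) * ratio (u x)) * u' x) (at x)"
      by (rule DERIV_chain2[OF DERIV_g0_ratio[OF u_in_dom] u])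
    from DERIV_add[OF _ this, of "\<lambda>x. (P x - c) * u' x"]
    have "(w c has_real_derivative d0 + (1 - g1 (u x) * ratio (u x)) * u' x) (at x)"
      if "((\<lambda>x. (P x - c) * u' x) has_real_derivative d0) (at x)" for d0
      using that unfolding w_def by blast
    moreover have "((\<lambda>x. (P x - c) * u' x) has_real_derivative
        (g1 (u x) * ratio (u x) - 1 / 2) * u' x + g0 (u x) * (P x - c)) (at x)"
      by (auto intro!: derivative_eq_intros P u')
    ultimately have "(w c has_real_derivative (g1 (u x) * ratio (u x) - 1 / 2) * u' x + g0 (u x) * (P x - c)
        + (1 - g1 (u x) * ratio (u x)) * u' x) (at x)" by blast
    then show ?thesis unfolding d_def by (simp add: algebra_simps)
  qed
  have d: "(d c has_real_derivative g1 (u x) * w c x) (at x)" for c x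
  proof -
    have "((\<lambda>x. g0 (u x)) has_real_derivative g1 (u x) * u' x) (at x)"
      by (rule DERIV_chain2[OF DERIV_g0[OF pos] u])
    then show ?thesis
      unfolding w_def d_def by (auto intro!: derivative_eq_intros P u' simp: algebra_simps)
  qed
  \<comment> \<open>The two solutions differ by \<open>P (L/2) * u'\<close>, and the Wronskian of
    \<open>u'\<close> with a second solution is, up to sign, the energy.\<close>
  have W: "d 0 x * w (P (L/2)) x - w 0 x * d (P (L/2)) x = - P (L/2) * energy" for x
  proof -
    have "d 0 x * w (P (L/2)) x - w 0 x * d (P (L/2)) x
      = P (L/2) * (g0 (u x) * (g0 (u x) * ratio (u x)) - (u' x)\<^sup>2 / 2)"
      unfolding w_def d_def by (simp add: algebra_simps power2_eq_square)
    also have "\<dots> = - P (L/2) * energy" unfolding g0_ratio energy[symmetric, of x] by (simp add: algebra_simps)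
    finally show ?thesis .
  qed
  have "even_periodic L (\<lambda>x. g1 (u x))"
    using ep c1 by (simp add: even_periodic_def)
  then show ?thesis
  proof (rule green_bound_fundamental_system[OF L _ w d w d W])
    show "- P (L/2) * energy \<noteq> 0" using Pneg energy_pos by simp
    show "d 0 0 = 0" using neumann P(2) by (simp add: d_def)
    show "d (P (L/2)) (L/2) = 0" using neumann by (simp add: d_def)
    have "u (L/2) \<noteq> r" using crossing neumann by blast
    then have "g0 (u (L/2)) \<noteq> 0" using g0_nonzero[OF u_in_dom] by blast
    then show "d 0 (L/2) \<noteq> 0" using Pneg neumann by (simp add: d_def)
  qed
qed

end

section \<open>Perturbation and regularity\<close>

text \<open>\<open>D\<close> is the supremum of \<open>\<bar>f\<bar>\<close>. The crude bound
  \<open>B\<close> makes it finite, without which half of it could not be moved to the other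
  side.\<close>

lemma absorb_half:
  fixes f :: "'a \<Rightarrow> real"
  assumes bdd: "\<And>x. \<bar>f x\<bar> \<le> B"
    and step: "\<And>D x. (\<And>x. \<bar>f x\<bar> \<le> D) \<Longrightarrow> \<bar>f x\<bar> \<le> a + D / 2"
  shows "\<bar>f x\<bar> \<le> 2 * a"
proof -
  define D where "D = (SUP x. \<bar>f x\<bar>)"
  have up: "\<bar>f x\<bar> \<le> D" for x
    unfolding D_def using bdd by (intro cSUP_upper bdd_aboveI2[where M = B]) auto
  have "D \<le> a + D / 2"
    unfolding D_def by (rule cSUP_least) (use step up in \<open>auto simp: D_def\<close>)
  then show ?thesis using up[of x] by simp
qed

text \<open>The linear solution operator has sup norm at most \<open>C\<close>. The Lipschitz
  constant \<open>1 / (2 * C)\<close> of \<open>N\<close> thus gives the contraction factor 1/2, and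
  the size of \<open>N\<close> at zero keeps the ball of radius \<open>\<rho>\<close>
  invariant.\<close>

lemma green_contraction:
  fixes N :: "(real \<Rightarrow> real) \<Rightarrow> real \<Rightarrow> real"
  assumes gb: "green_bound L Q C" and \<rho>: "0 \<le> \<rho>"
    and N_ep: "\<And>y. even_periodic L y \<Longrightarrow> (\<And>x. \<bar>y x\<bar> \<le> \<rho>) \<Longrightarrow> even_periodic L (N y)"
    and N_lip: "\<And>y z M x. even_periodic L y \<Longrightarrow> even_periodic L z \<Longrightarrow> (\<And>x. \<bar>y x\<bar> \<le> \<rho>) \<Longrightarrow>
       (\<And>x. \<bar>z x\<bar> \<le> \<rho>) \<Longrightarrow> (\<And>x. \<bar>y x - z x\<bar> \<le> M) \<Longrightarrow> \<bar>N y x - N z x\<bar> \<le> M / (2 * C)"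
    and N_0: "\<And>x. \<bar>N (\<lambda>x. 0) x\<bar> \<le> \<rho> / (2 * C)"
  shows "\<exists>y. even_periodic L y \<and> (\<forall>x. \<bar>y x\<bar> \<le> \<rho>) \<and> second_deriv y (\<lambda>x. Q x * y x - N y x)"
proof -
  have C: "0 < C" using gb by (simp add: green_bound_def)
  have solv: "\<exists>y. even_periodic L y \<and> second_deriv y (\<lambda>x. Q x * y x - h x)" if "even_periodic L h" for h
    using gb that by (simp add: green_bound_def)
  have est: "\<bar>y x\<bar> \<le> C * M" if "even_periodic L y" "even_periodic L h"
    "second_deriv y (\<lambda>x. Q x * y x - h x)" "\<And>x. \<bar>h x\<bar> \<le> M" for y h M x
    using gb that unfolding green_bound_def by blast
  define S where "S h = (SOME y. even_periodic L y \<and> second_deriv y (\<lambda>x. Q x * y x - h x))" for h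
  have S: "even_periodic L (S h)" "second_deriv (S h) (\<lambda>x. Q x * S h x - h x)" if "even_periodic L h" for h
    using someI_ex[OF solv[OF that]] unfolding S_def by blast+
  define X where "X = {f :: real \<Rightarrow>\<^sub>C real. even_periodic L f \<and> (\<forall>x. \<bar>f x\<bar> \<le> \<rho>)}"
  \<comment> \<open>The fixed point is sought in the complete space of bounded continuous functions.
    The conversion by \<open>Bcontfun\<close> is meaningful on \<open>X\<close>, where the image is
    bounded by \<open>\<rho>\<close>.\<close>
  define T where "T f = (Bcontfun (S (N (apply_bcontfun f))) :: real \<Rightarrow>\<^sub>C real)" for f :: "real \<Rightarrow>\<^sub>C real"
  have XD: "even_periodic L f" "\<And>x. \<bar>f x\<bar> \<le> \<rho>" if "f \<in> X" for f :: "real \<Rightarrow>\<^sub>C real"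
    using that by (auto simp: X_def)
  have N_bd: "\<bar>N (apply_bcontfun f) x\<bar> \<le> \<rho> / C" if "f \<in> X" for f x
  proof -
    have "\<bar>N (apply_bcontfun f) x - N (\<lambda>x. 0) x\<bar> \<le> \<rho> / (2 * C)"
      using XD[OF that] \<rho> by (intro N_lip even_periodic_const) auto
    then have "\<bar>N (apply_bcontfun f) x\<bar> \<le> \<rho> / (2 * C) + \<rho> / (2 * C)" using N_0[of x] by linarith
    then show ?thesis using C by (simp add: field_simps)
  qed
  have S_bd: "\<bar>S (N (apply_bcontfun f)) x\<bar> \<le> \<rho>" if "f \<in> X" for f x
  proof -
    have ep: "even_periodic L (N (apply_bcontfun f))" using XD[OF that] by (intro N_ep)
    have "\<bar>S (N (apply_bcontfun f)) x\<bar> \<le> C * (\<rho> / C)"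
      by (rule est[OF S(1)[OF ep] ep S(2)[OF ep] N_bd[OF that]])
    then show ?thesis using C by simp
  qed
  have T: "apply_bcontfun (T f) = S (N (apply_bcontfun f))" if "f \<in> X" for f
    unfolding T_def
  proof (rule Bcontfun_inverse, rule bcontfun_normI)
    show "continuous_on UNIV (S (N (apply_bcontfun f)))"
      using S(1)[OF N_ep] XD[OF that] unfolding even_periodic_def by blast
    show "norm (S (N (apply_bcontfun f)) x) \<le> \<rho>" for x using S_bd[OF that] by simp
  qed
  have "\<exists>!f\<in>X. T f = f"
  proof (rule Banach_fix[where c = "1 / 2"])
    show "complete X"
      \<comment> \<open>Evenness, periodicity and the bound survive pointwise limits; continuity of
        the limit is part of its type.\<close>
      unfolding complete_eq_closed closed_sequential_limits
    proof (intro allI impI, elim conjE)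
      fix s and l :: "real \<Rightarrow>\<^sub>C real"
      assume s: "\<forall>n. s n \<in> X" and lim: "s \<longlonglongrightarrow> l"
      have pt: "(\<lambda>n. s n x) \<longlonglongrightarrow> l x" for x
        using tendsto_uniform_limitI[OF tendsto_bcontfun_uniform_limit[OF lim], of x] by simp
      have "l (- x) = l x" for x
      proof -
        have "(\<lambda>n. s n (- x)) = (\<lambda>n. s n x)" using s by (auto simp: X_def even_periodic_def)
        then show ?thesis using pt[of x] pt[of "- x"] LIMSEQ_unique by metis
      qed
      moreover have "l (x + L) = l x" for x
      proof -
        have "(\<lambda>n. s n (x + L)) = (\<lambda>n. s n x)" using s by (auto simp: X_def even_periodic_def)
        then show ?thesis using pt[of x] pt[of "x + L"] LIMSEQ_unique by metis
      qed
      moreover have "\<bar>l x\<bar> \<le> \<rho>" for x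
        by (rule LIMSEQ_le_const2[OF tendsto_rabs[OF pt[of x]]]) (use s in \<open>auto simp: X_def\<close>)
      ultimately show "l \<in> X" by (simp add: X_def even_periodic_def)
    qed
    show "X \<noteq> {}" using \<rho> by (auto simp: X_def even_periodic_def intro!: exI[of _ 0])
    show "T ` X \<subseteq> X"
    proof
      fix f assume "f \<in> T ` X"
      then obtain k where k: "k \<in> X" "f = T k" by blast
      show "f \<in> X"
        unfolding X_def k(2) using T[OF k(1)] S_bd[OF k(1)] S(1)[OF N_ep[OF XD[OF k(1)]]] by simp
    qed
    show "dist (T f) (T k) \<le> 1 / 2 * dist f k" if f: "f \<in> X" and k: "k \<in> X" for f k
    proof (rule dist_bound)
      fix x
      let ?f = "N (apply_bcontfun f)" and ?k = "N (apply_bcontfun k)"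
      have ef: "even_periodic L ?f" and ek: "even_periodic L ?k"
        using XD f k by (auto intro!: N_ep)
      have "\<bar>S ?f x - S ?k x\<bar> \<le> C * (dist f k / (2 * C))"
      proof (rule est[of "\<lambda>x. S ?f x - S ?k x" "\<lambda>x. ?f x - ?k x"])
        show "second_deriv (\<lambda>x. S ?f x - S ?k x) (\<lambda>x. Q x * (S ?f x - S ?k x) - (?f x - ?k x))"
          by (rule second_deriv_cong[OF second_deriv_diff[OF S(2)[OF ef] S(2)[OF ek]]]) (simp add: algebra_simps)
        show "\<bar>?f x - ?k x\<bar> \<le> dist f k / (2 * C)" for x
        proof (rule N_lip)
          show "\<bar>apply_bcontfun f x - apply_bcontfun k x\<bar> \<le> dist f k" for x
            using dist_bounded[of f x k] by (simp add: dist_real_def)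
        qed (use XD f k in auto)
      qed (use S(1) ef ek in \<open>auto intro: even_periodic_diff\<close>)
      then show "dist (T f x) (T k x) \<le> 1 / 2 * dist f k"
        using C T f k by (simp add: dist_real_def)
    qed
  qed auto
  then obtain f where f: "f \<in> X" "T f = f" by blast
  have ep: "even_periodic L (N (apply_bcontfun f))" using XD[OF f(1)] by (intro N_ep)
  have "apply_bcontfun f = S (N (apply_bcontfun f))" using T[OF f(1)] f(2) by simp
  then have "second_deriv f (\<lambda>x. Q x * f x - N (apply_bcontfun f) x)" using S(2)[OF ep] by metis
  then show ?thesis using XD[OF f(1)] by blast
qed

text \<open>The change of potential is moved into the source, where it costs at most half the sup
  norm of the solution; absorbing that half doubles the constant.\<close>

lemma green_bound_perturb:
  assumes L: "0 < L" and gb: "green_bound L Q C" and Q: "even_periodic L Q" "even_periodic L Q1"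
    and close: "\<And>x. \<bar>Q x - Q1 x\<bar> \<le> 1 / (2 * C)"
  shows "green_bound L Q1 (2 * C)"
proof -
  have C: "0 < C" using gb by (simp add: green_bound_def)
  show ?thesis
    unfolding green_bound_def
  proof (intro conjI allI impI)
    show "0 < 2 * C" using C by simp
    show "\<exists>y. even_periodic L y \<and> second_deriv y (\<lambda>x. Q1 x * y x - h x)" if h: "even_periodic L h" for h
    proof -
      obtain B where B: "B > 0" "\<And>x. \<bar>h x\<bar> \<le> B" using even_periodic_bounded[OF L h] by blast
      have "\<exists>y. even_periodic L y \<and> (\<forall>x. \<bar>y x\<bar> \<le> 2 * C * B) \<and>
          second_deriv y (\<lambda>x. Q x * y x - (h x + (Q x - Q1 x) * y x))"
      proof (rule green_contraction[OF gb])
        show "even_periodic L (\<lambda>x. h x + (Q x - Q1 x) * y x)" if "even_periodic L y" for y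
          using that h Q by (intro even_periodic_intros)
        show "\<bar>(h x + (Q x - Q1 x) * y x) - (h x + (Q x - Q1 x) * z x)\<bar> \<le> M / (2 * C)"
          if "\<And>x. \<bar>y x - z x\<bar> \<le> M" for y z :: "real \<Rightarrow> real" and M x
        proof -
          have eq: "(h x + (Q x - Q1 x) * y x) - (h x + (Q x - Q1 x) * z x) = (Q x - Q1 x) * (y x - z x)"
            by (simp add: algebra_simps)
          have "\<bar>(h x + (Q x - Q1 x) * y x) - (h x + (Q x - Q1 x) * z x)\<bar> \<le> 1 / (2 * C) * M"
            unfolding eq abs_mult
            using close[of x] that[of x] C by (intro mult_mono) auto
          then show ?thesis by simp
        qed
        show "\<bar>h x + (Q x - Q1 x) * 0\<bar> \<le> 2 * C * B / (2 * C)" for x using B(2)[of x] C by simp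
      qed (use C B in auto)
      then obtain y where y: "even_periodic L y" "second_deriv y (\<lambda>x. Q x * y x - (h x + (Q x - Q1 x) * y x))"
        by blast
      have "second_deriv y (\<lambda>x. Q1 x * y x - h x)"
        by (rule second_deriv_cong[OF y(2)]) (simp add: algebra_simps)
      then show ?thesis using y by blast
    qed
    show "\<bar>y x\<bar> \<le> 2 * C * M"
      if y: "even_periodic L y" and h: "even_periodic L h"
        and sd: "second_deriv y (\<lambda>x. Q1 x * y x - h x)" and M: "\<forall>x. \<bar>h x\<bar> \<le> M" for y h M x
    proof -
      obtain B where B: "\<And>x. \<bar>y x\<bar> \<le> B" using even_periodic_bounded[OF L y] by blast
      have "\<bar>y x\<bar> \<le> 2 * (C * M)"
      proof (rule absorb_half[OF B])
        fix D x assume D: "\<And>x. \<bar>y x\<bar> \<le> D"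
        have ep: "even_periodic L (\<lambda>x. h x + (Q x - Q1 x) * y x)"
          using y h Q by (intro even_periodic_intros)
        have "second_deriv y (\<lambda>x. Q x * y x - (h x + (Q x - Q1 x) * y x))"
          by (rule second_deriv_cong[OF sd]) (simp add: algebra_simps)
        moreover have "\<bar>h x + (Q x - Q1 x) * y x\<bar> \<le> M + 1 / (2 * C) * D" for x
        proof -
          have "\<bar>(Q x - Q1 x) * y x\<bar> \<le> 1 / (2 * C) * D"
            unfolding abs_mult using close[of x] D[of x] C by (intro mult_mono) auto
          then show ?thesis using M[rule_format, of x] by linarith
        qed
        ultimately have "\<bar>y x\<bar> \<le> C * (M + 1 / (2 * C) * D)"
          using gb y ep unfolding green_bound_def by blast
        then show "\<bar>y x\<bar> \<le> C * M + D / 2" using C by (simp add: algebra_simps)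
      qed
      then show ?thesis by simp
    qed
  qed
qed

section \<open>Classical solutions and the space H^2\<close>

lemma second_deriv_unfold:
  assumes "second_deriv y z"
  shows "(y has_real_derivative deriv y x) (at x)" "(deriv y has_real_derivative z x) (at x)"
    "deriv (deriv y) = z"
proof -
  obtain d where d: "\<And>x. (y has_real_derivative d x) (at x)" "\<And>x. (d has_real_derivative z x) (at x)"
    using assms unfolding second_deriv_def by blast
  have "deriv y = d" using d(1) by (auto intro: DERIV_imp_deriv)
  then show "(y has_real_derivative deriv y x) (at x)" "(deriv y has_real_derivative z x) (at x)"
    "deriv (deriv y) = z" using d by (auto intro: DERIV_imp_deriv)
qed

lemma H2pe_second_deriv:
  assumes L: "0 < L" and ep: "even_periodic L y" and sd: "second_deriv y z" and z: "continuous_on UNIV z"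
  shows "H2pe L y"
proof -
  note d = second_deriv_unfold[OF sd]
  have zi: "set_integrable lebesgue {a..b} z" for a b
    using z by (intro absolutely_integrable_continuous_real) (auto intro: continuous_on_subset)
  have zi2: "set_integrable lebesgue {0..L} (\<lambda>t. (z t)\<^sup>2)"
    using z by (intro absolutely_integrable_continuous_real continuous_intros) (auto intro: continuous_on_subset)
  have hi: "(z has_integral (deriv y b - deriv y a)) {a..b}" if "a \<le> b" for a b
    using that d(2)
    by (intro fundamental_theorem_of_calculus)
      (auto simp: has_real_derivative_iff_has_vector_derivative[symmetric] intro: has_field_derivative_at_within)
  have "deriv y b - deriv y a = (LINT t:{a..b}|lebesgue. z t)" if "a \<le> b" for a b
    using set_lebesgue_integral_eq_integral(2)[OF zi, of a b] integral_unique[OF hi[OF that]] by simp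
  moreover have "y differentiable (at x)" for x
    using d(1) real_differentiable_def by blast
  ultimately show ?thesis
    unfolding H2pe_def d(3) using L ep zi zi2 by (auto simp: even_periodic_def)
qed

text \<open>By evenness y' starts from 0, so it is at most \<open>M * L\<close> on one period.
  Integrating M^2 + (M L)^2 + M^2 over length L gives the constant.\<close>

lemma h2norm_le:
  assumes L: "0 < L" and ep: "even_periodic L y" and sd: "second_deriv y z" and z: "continuous_on UNIV z"
    and bd: "\<And>x. \<bar>y x\<bar> \<le> M" "\<And>x. \<bar>z x\<bar> \<le> M"
  shows "h2norm L y \<le> sqrt (L * (2 + L\<^sup>2)) * M"
proof -
  note d = second_deriv_unfold[OF sd]
  have M: "0 \<le> M" using bd(1)[of 0] by linarith
  have "deriv y 0 = 0"
    using symmetric_deriv_zero[OF even_periodic_symmetric(1)[OF ep] d(1)] .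
  have d_bd: "\<bar>deriv y x\<bar> \<le> M * L" if "x \<in> {0..L}" for x
  proof -
    have "norm (deriv y x - deriv y 0) \<le> M * norm (x - 0)"
      by (rule field_differentiable_bound[of "{0..L}"])
        (use that L bd d(2) in \<open>auto intro: has_field_derivative_at_within\<close>)
    also have "\<dots> \<le> M * L" using that M by (intro mult_left_mono) auto
    finally show ?thesis using \<open>deriv y 0 = 0\<close> by simp
  qed
  let ?f = "\<lambda>t. (y t)\<^sup>2 + (deriv y t)\<^sup>2 + (z t)\<^sup>2"
  have cd: "continuous_on UNIV (deriv y)" "continuous_on UNIV y"
    using d(1,2) by (meson DERIV_isCont continuous_at_imp_continuous_on)+
  have cf: "continuous_on {0..L} ?f"
    using cd z by (intro continuous_intros) (auto intro: continuous_on_subset)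
  have "(LINT t:{0..L}|lebesgue. ?f t) = integral {0..L} ?f"
    by (rule set_lebesgue_integral_eq_integral(2)[OF absolutely_integrable_continuous_real[OF cf]])
  also have "\<dots> \<le> integral {0..L} (\<lambda>t. (2 + L\<^sup>2) * M\<^sup>2)"
  proof (rule integral_le)
    show "?f integrable_on {0..L}" by (rule integrable_continuous_real[OF cf])
    show "?f t \<le> (2 + L\<^sup>2) * M\<^sup>2" if "t \<in> {0..L}" for t
    proof -
      have "(y t)\<^sup>2 \<le> M\<^sup>2" "(z t)\<^sup>2 \<le> M\<^sup>2" "(deriv y t)\<^sup>2 \<le> (M * L)\<^sup>2"
        using bd[of t] d_bd[OF that] by (auto intro!: abs_le_square_iff[THEN iffD1] simp: abs_le_iff)
      then show ?thesis by (simp add: algebra_simps power_mult_distrib)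
    qed
  qed auto
  also have "\<dots> = L * (2 + L\<^sup>2) * M\<^sup>2" using L by simp
  finally have "h2norm L y \<le> sqrt (L * (2 + L\<^sup>2) * M\<^sup>2)"
    unfolding h2norm_def d(3) by simp
  also have "\<dots> = sqrt (L * (2 + L\<^sup>2)) * M" using M by (simp add: real_sqrt_mult)
  finally show ?thesis .
qed

text \<open>A bootstrap: increments of \<phi>' are integrals of a function that agrees almost
  everywhere with the right-hand side. The latter is continuous because \<phi> avoids the
  singularity of the logarithm, so \<phi>' is differentiable everywhere.\<close>

lemma solves_second_deriv:
  assumes H: "H2pe L \<phi>" and sol: "solves \<omega> A \<phi>" and nz: "\<And>x. \<phi> x \<noteq> 0"
  shows "even_periodic L \<phi>" "second_deriv \<phi> (\<lambda>x. \<omega> * \<phi> x - \<phi> x * ln ((\<phi> x)\<^sup>2) + A)"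
proof -
  have diff: "(\<phi> has_real_derivative deriv \<phi> x) (at x)" for x
    using H unfolding H2pe_def by (meson DERIV_deriv_iff_real_differentiable)
  then have c\<phi>: "continuous_on UNIV \<phi>"
    by (meson DERIV_isCont continuous_at_imp_continuous_on)
  then show ep: "even_periodic L \<phi>"
    using H unfolding H2pe_def even_periodic_def by blast
  let ?h = "\<lambda>x. \<omega> * \<phi> x - \<phi> x * ln ((\<phi> x)\<^sup>2) + A"
  have ch: "continuous_on UNIV ?h" using c\<phi> nz by (intro continuous_intros) auto
  obtain F where F: "\<And>x. (F has_real_derivative ?h x) (at x)" "F 0 = 0"
    using antiderivative_on_reals[OF ch] by blast
  have ae: "AE x in lebesgue. deriv (deriv \<phi>) x = ?h x"
    using sol unfolding solves_def by eventually_elim simp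
  have hi: "set_integrable lebesgue {a..b} ?h" for a b
    using ch by (intro absolutely_integrable_continuous_real) (auto intro: continuous_on_subset)
  have inc: "deriv \<phi> b - deriv \<phi> a = F b - F a" if ab: "a \<le> b" for a b
  proof -
    have si: "set_integrable lebesgue {a..b} (deriv (deriv \<phi>))"
      and "deriv \<phi> b - deriv \<phi> a = (LINT t:{a..b}|lebesgue. deriv (deriv \<phi>) t)"
      using H ab unfolding H2pe_def by blast+
    moreover have "(LINT t:{a..b}|lebesgue. deriv (deriv \<phi>) t) = (LINT t:{a..b}|lebesgue. ?h t)"
      unfolding set_lebesgue_integral_def
    proof (rule integral_cong_AE)
      show "(\<lambda>x. indicat_real {a..b} x *\<^sub>R deriv (deriv \<phi>) x) \<in> borel_measurable lebesgue"
        "(\<lambda>x. indicat_real {a..b} x *\<^sub>R ?h x) \<in> borel_measurable lebesgue"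
        using si hi unfolding set_integrable_def by auto
      show "AE x in lebesgue. indicat_real {a..b} x *\<^sub>R deriv (deriv \<phi>) x = indicat_real {a..b} x *\<^sub>R ?h x"
        using ae by eventually_elim simp
    qed
    moreover have "(?h has_integral (F b - F a)) {a..b}"
      using ab F(1)
      by (intro fundamental_theorem_of_calculus)
        (auto simp: has_real_derivative_iff_has_vector_derivative[symmetric] intro: has_field_derivative_at_within)
    ultimately show ?thesis
      using set_lebesgue_integral_eq_integral(2)[OF hi, of a b] by (simp add: integral_unique)
  qed
  have "deriv \<phi> x = deriv \<phi> 0 + F x" for x
    using inc[of 0 x] inc[of x 0] F(2) by (cases "0 \<le> x") auto
  then have eq: "deriv \<phi> = (\<lambda>x. deriv \<phi> 0 + F x)" by (rule ext)
  have "((\<lambda>x. deriv \<phi> 0 + F x) has_real_derivative ?h x) (at x)" for x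
    using F(1)[of x] by (auto intro!: derivative_eq_intros)
  then have "(deriv \<phi> has_real_derivative ?h x) (at x)" for x by (subst eq)
  then show "second_deriv \<phi> ?h" by (rule second_derivI[OF diff])
qed

lemma second_deriv_solves:
  assumes "second_deriv y (\<lambda>x. \<omega> * y x - y x * ln ((y x)\<^sup>2) + A)"
  shows "solves \<omega> A y"
  unfolding solves_def second_deriv_unfold(3)[OF assms] by simp

section \<open>Families of functions with quadratic Taylor remainders\<close>

text \<open>The relative increment \<open>t\<close> is small enough to keep \<open>1 + t\<close>
  positive, so \<open>a\<close> and \<open>b\<close> have the same sign and the logarithms differ by
  \<open>2 * ln (1 + t)\<close>. Both signs of \<open>a\<close> are covered.\<close>

lemma ln_square_ratio:
  fixes a b m :: real
  assumes m: "0 < m" "m \<le> \<bar>a\<bar>" "\<bar>b - a\<bar> \<le> m / 2"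
  defines "t \<equiv> (b - a) / a"
  shows "\<bar>t\<bar> \<le> 1 / 2" "b = a * (1 + t)" "\<bar>ln (b\<^sup>2) - ln (a\<^sup>2) - 2 * t\<bar> \<le> 4 * t\<^sup>2"
proof -
  have a: "a \<noteq> 0" using m by auto
  have "\<bar>t\<bar> = \<bar>b - a\<bar> / \<bar>a\<bar>" by (simp add: t_def)
  also have "\<dots> \<le> (m / 2) / m" using m by (intro frac_le) auto
  finally show t: "\<bar>t\<bar> \<le> 1 / 2" using m by simp
  show b: "b = a * (1 + t)" using a by (simp add: t_def field_simps)
  have "ln (b\<^sup>2) = ln (a\<^sup>2) + 2 * ln (1 + t)"
  proof -
    have "0 < 1 + t" using t by (simp add: abs_le_iff)
    then have "ln (a\<^sup>2 * (1 + t)\<^sup>2) = ln (a\<^sup>2) + ln ((1 + t)\<^sup>2)" using a by (intro ln_mult_pos) auto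
    moreover have "ln ((1 + t)\<^sup>2) = 2 * ln (1 + t)" using \<open>0 < 1 + t\<close> by (simp add: ln_realpow)
    ultimately show ?thesis by (simp add: b power_mult_distrib)
  qed
  then show "\<bar>ln (b\<^sup>2) - ln (a\<^sup>2) - 2 * t\<bar> \<le> 4 * t\<^sup>2"
    using abs_ln_one_plus_x_minus_x_bound[OF t] by (simp add: abs_le_iff)
qed

lemma ln_square_taylor:
  fixes a b m :: real
  assumes m: "0 < m" "m \<le> \<bar>a\<bar>" "\<bar>b - a\<bar> \<le> m / 2"
  shows "\<bar>ln (b\<^sup>2) - ln (a\<^sup>2) - 2 * (b - a) * inverse a\<bar> \<le> 4 / m\<^sup>2 * (b - a)\<^sup>2"
proof -
  have "4 * ((b - a) / a)\<^sup>2 = 4 * (b - a)\<^sup>2 / a\<^sup>2" by (simp add: power_divide)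
  also have "\<dots> \<le> 4 * (b - a)\<^sup>2 / m\<^sup>2"
    using m by (intro divide_left_mono) (auto simp: abs_le_square_iff[symmetric])
  finally show ?thesis
    using ln_square_ratio(3)[OF m] by (simp add: divide_inverse algebra_simps)
qed

lemma ln_square_lipschitz:
  fixes a b m :: real
  assumes m: "0 < m" "m \<le> \<bar>a\<bar>" "\<bar>b - a\<bar> \<le> m / 2"
  shows "\<bar>ln (b\<^sup>2) - ln (a\<^sup>2)\<bar> \<le> 4 / m * \<bar>b - a\<bar>"
proof -
  define t where "t = (b - a) / a"
  have t: "\<bar>t\<bar> \<le> 1 / 2" and e: "\<bar>ln (b\<^sup>2) - ln (a\<^sup>2) - 2 * t\<bar> \<le> 4 * t\<^sup>2"
    using ln_square_ratio[OF m] by (auto simp: t_def)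
  have "t\<^sup>2 = \<bar>t\<bar> * \<bar>t\<bar>" by (simp only: abs_mult_self_eq power2_eq_square)
  also have "\<dots> \<le> \<bar>t\<bar> * (1 / 2)"
    using t by (intro mult_left_mono) auto
  finally have "\<bar>ln (b\<^sup>2) - ln (a\<^sup>2)\<bar> \<le> 4 * \<bar>t\<bar>"
    using e by linarith
  also have "\<bar>t\<bar> \<le> \<bar>b - a\<bar> / m"
    unfolding t_def abs_divide using m by (intro divide_left_mono) auto
  finally show ?thesis by simp
qed

text \<open>The linear coefficient is the derivative of s ln s^2 at \<open>a\<close>. In terms of
  \<open>t\<close> the remainder is \<open>a * (2 * t\<^sup>2 + (1 + t) * e)\<close>, and 2 + (3/2)
  4 = 8 is the constant.\<close>

lemma xlnx_taylor:
  fixes a b m :: real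
  assumes m: "0 < m" "m \<le> \<bar>a\<bar>" "\<bar>b - a\<bar> \<le> m / 2"
  shows "\<bar>b * ln (b\<^sup>2) - a * ln (a\<^sup>2) - (2 + ln (a\<^sup>2)) * (b - a)\<bar> \<le> 8 / m * (b - a)\<^sup>2"
proof -
  define t where "t = (b - a) / a"
  define e where "e = ln (b\<^sup>2) - ln (a\<^sup>2) - 2 * t"
  have t: "\<bar>t\<bar> \<le> 1 / 2" and b: "b = a * (1 + t)" and e: "\<bar>e\<bar> \<le> 4 * t\<^sup>2"
    using ln_square_ratio[OF m] by (auto simp: t_def e_def)
  have "b * ln (b\<^sup>2) - a * ln (a\<^sup>2) - (2 + ln (a\<^sup>2)) * (b - a) = b * (ln (b\<^sup>2) - ln (a\<^sup>2)) - 2 * (b - a)"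
    by (simp add: algebra_simps)
  also have "\<dots> = a * (1 + t) * (2 * t + e) - 2 * (a * t)"
    using b by (simp add: e_def algebra_simps)
  also have "\<dots> = a * (2 * t\<^sup>2 + (1 + t) * e)" by (simp add: algebra_simps power2_eq_square)
  finally have eq: "b * ln (b\<^sup>2) - a * ln (a\<^sup>2) - (2 + ln (a\<^sup>2)) * (b - a) = a * (2 * t\<^sup>2 + (1 + t) * e)" .
  have "\<bar>(1 + t) * e\<bar> \<le> (3 / 2) * (4 * t\<^sup>2)"
    unfolding abs_mult using t e by (intro mult_mono) auto
  then have "\<bar>2 * t\<^sup>2 + (1 + t) * e\<bar> \<le> 8 * t\<^sup>2" by (simp add: abs_le_iff)
  then have "\<bar>a * (2 * t\<^sup>2 + (1 + t) * e)\<bar> \<le> \<bar>a\<bar> * (8 * t\<^sup>2)"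
    unfolding abs_mult by (intro mult_left_mono) auto
  also have "\<dots> = 8 * (b - a)\<^sup>2 / \<bar>a\<bar>"
  proof -
    have "c * (8 * (s / c\<^sup>2)) = 8 * s / c" if "c \<noteq> 0" for c s :: real
      using that by (simp add: power2_eq_square)
    from this[of "\<bar>a\<bar>" "(b - a)\<^sup>2"] show ?thesis
      using m unfolding t_def power_divide power2_abs by auto
  qed
  also have "\<dots> \<le> 8 * (b - a)\<^sup>2 / m" using m by (intro divide_left_mono) auto
  finally show ?thesis unfolding eq by simp
qed

lemma inverse_lipschitz:
  fixes a b m :: real
  assumes m: "0 < m" "m \<le> \<bar>a\<bar>" "m \<le> \<bar>b\<bar>"
  shows "\<bar>inverse b - inverse a\<bar> \<le> 1 / m\<^sup>2 * \<bar>b - a\<bar>"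
proof -
  have ab: "a \<noteq> 0" "b \<noteq> 0" using m by auto
  have "inverse b - inverse a = (a - b) / (a * b)" using ab by (simp add: field_simps)
  then have "\<bar>inverse b - inverse a\<bar> = \<bar>b - a\<bar> / (\<bar>a\<bar> * \<bar>b\<bar>)"
    by (simp add: abs_mult abs_minus_commute)
  also have "\<dots> \<le> \<bar>b - a\<bar> / m\<^sup>2"
    unfolding power2_eq_square using m ab by (intro divide_left_mono mult_mono) auto
  finally show ?thesis by simp
qed

lemma inverse_taylor:
  fixes a b m :: real
  assumes m: "0 < m" "m \<le> \<bar>a\<bar>" "m \<le> \<bar>b\<bar>"
  shows "\<bar>inverse b - inverse a + (b - a) * (inverse a * inverse a)\<bar> \<le> 1 / m^3 * (b - a)\<^sup>2"
proof -
  have ab: "a \<noteq> 0" "b \<noteq> 0" using m by auto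
  have "inverse b - inverse a + (b - a) * (inverse a * inverse a) = (b - a)\<^sup>2 / (a * a * b)"
    using ab by (simp add: field_simps power2_eq_square)
  then have "\<bar>inverse b - inverse a + (b - a) * (inverse a * inverse a)\<bar> = (b - a)\<^sup>2 / (\<bar>a\<bar> * \<bar>a\<bar> * \<bar>b\<bar>)"
    by (simp add: abs_mult)
  also have "\<dots> \<le> (b - a)\<^sup>2 / m^3"
  proof -
    have "0 < \<bar>a\<bar> * \<bar>a\<bar> * \<bar>b\<bar> * m^3" using m ab by (intro mult_pos_pos) auto
    moreover have "m^3 \<le> \<bar>a\<bar> * \<bar>a\<bar> * \<bar>b\<bar>"
      unfolding power3_eq_cube using m by (intro mult_mono) auto
    ultimately show ?thesis by (intro divide_left_mono) auto
  qed
  finally show ?thesis by simp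
qed

text \<open>The first derivative is left out because for even periodic functions the bound on the
  second one controls it.\<close>

definition c2_bound :: "(real \<Rightarrow> real) \<Rightarrow> real \<Rightarrow> bool" where
  "c2_bound y M \<longleftrightarrow> (\<exists>z. second_deriv y z \<and> continuous_on UNIV z \<and> (\<forall>x. \<bar>y x\<bar> \<le> M) \<and> (\<forall>x. \<bar>z x\<bar> \<le> M))"

lemma h2norm_c2_bound:
  assumes "0 < L" "even_periodic L y" "c2_bound y M"
  shows "h2norm L y \<le> sqrt (L * (2 + L\<^sup>2)) * M"
  using assms h2norm_le unfolding c2_bound_def by blast

lemma h2norm_nonneg: "0 \<le> h2norm L y"
  unfolding h2norm_def set_lebesgue_integral_def
  by (intro real_sqrt_ge_zero Bochner_Integration.integral_nonneg) auto

type_synonym family = "real \<times> real \<Rightarrow> real \<Rightarrow> real"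

definition fam_bounded :: "(real \<times> real) set \<Rightarrow> family \<Rightarrow> bool" where
  "fam_bounded U y \<longleftrightarrow> (\<exists>K\<ge>0. \<forall>p\<in>U. \<forall>x. \<bar>y p x\<bar> \<le> K)"

definition fam_lip :: "(real \<times> real) set \<Rightarrow> family \<Rightarrow> bool" where
  "fam_lip U y \<longleftrightarrow> (\<exists>K\<ge>0. \<forall>p\<in>U. \<forall>q\<in>U. \<forall>x. \<bar>y q x - y p x\<bar> \<le> K * norm (q - p))"

text \<open>Frechet differentiability in the sup norm, strengthened to a quadratic remainder uniform
  over all pairs in \<open>U\<close>. In this form it passes through products and solution operators
  with explicit constants.\<close>

definition fam_deriv :: "(real \<times> real) set \<Rightarrow> family \<Rightarrow> family \<Rightarrow> family \<Rightarrow> bool" where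
  "fam_deriv U y D1 D2 \<longleftrightarrow> (\<exists>K\<ge>0. \<forall>p\<in>U. \<forall>q\<in>U. \<forall>x.
     \<bar>y q x - y p x - fst (q - p) * D1 p x - snd (q - p) * D2 p x\<bar> \<le> K * (norm (q - p))\<^sup>2)"

lemma abs_components_le_norm:
  fixes v :: "real \<times> real"
  shows "\<bar>fst v\<bar> \<le> norm v" "\<bar>snd v\<bar> \<le> norm v"
  using norm_fst_le[of "fst v" "snd v"] norm_snd_le[of "snd v" "fst v"] by auto

lemma linear_part_bound:
  fixes q p :: "real \<times> real"
  assumes "\<bar>a\<bar> \<le> A" "\<bar>b\<bar> \<le> B"
  shows "\<bar>fst (q - p) * a + snd (q - p) * b\<bar> \<le> (A + B) * norm (q - p)"
proof -
  have "\<bar>fst (q - p) * a\<bar> \<le> norm (q - p) * A" "\<bar>snd (q - p) * b\<bar> \<le> norm (q - p) * B"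
    unfolding abs_mult using assms abs_components_le_norm[of "q - p"] by (intro mult_mono; auto)+
  then show ?thesis by (simp add: algebra_simps abs_le_iff)
qed

lemma fam_lip_add:
  assumes "fam_lip U a" "fam_lip U b"
  shows "fam_lip U (\<lambda>p x. a p x + b p x)"
proof -
  obtain K1 where K1: "0 \<le> K1" "\<And>p q x. p \<in> U \<Longrightarrow> q \<in> U \<Longrightarrow> \<bar>a q x - a p x\<bar> \<le> K1 * norm (q - p)"
    using assms(1) unfolding fam_lip_def by blast
  obtain K2 where K2: "0 \<le> K2" "\<And>p q x. p \<in> U \<Longrightarrow> q \<in> U \<Longrightarrow> \<bar>b q x - b p x\<bar> \<le> K2 * norm (q - p)"
    using assms(2) unfolding fam_lip_def by blast
  have "\<bar>(a q x + b q x) - (a p x + b p x)\<bar> \<le> (K1 + K2) * norm (q - p)" if "p \<in> U" "q \<in> U" for p q x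
    using K1(2)[OF that, of x] K2(2)[OF that, of x] by (simp add: algebra_simps abs_le_iff)
  then show ?thesis unfolding fam_lip_def using K1(1) K2(1) by (intro exI[of _ "K1 + K2"]) auto
qed

lemma fam_lip_mult:
  assumes "fam_lip U a" "fam_lip U b" "fam_bounded U a" "fam_bounded U b"
  shows "fam_lip U (\<lambda>p x. a p x * b p x)"
proof -
  obtain K1 where K1: "0 \<le> K1" "\<And>p q x. p \<in> U \<Longrightarrow> q \<in> U \<Longrightarrow> \<bar>a q x - a p x\<bar> \<le> K1 * norm (q - p)"
    using assms(1) unfolding fam_lip_def by blast
  obtain K2 where K2: "0 \<le> K2" "\<And>p q x. p \<in> U \<Longrightarrow> q \<in> U \<Longrightarrow> \<bar>b q x - b p x\<bar> \<le> K2 * norm (q - p)"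
    using assms(2) unfolding fam_lip_def by blast
  obtain A B where A: "0 \<le> A" "\<And>p x. p \<in> U \<Longrightarrow> \<bar>a p x\<bar> \<le> A" and B: "0 \<le> B" "\<And>p x. p \<in> U \<Longrightarrow> \<bar>b p x\<bar> \<le> B"
    using assms(3,4) unfolding fam_bounded_def by blast
  have "\<bar>a q x * b q x - a p x * b p x\<bar> \<le> (K1 * B + A * K2) * norm (q - p)" if pq: "p \<in> U" "q \<in> U" for p q x
  proof -
    have "\<bar>(a q x - a p x) * b q x\<bar> \<le> (K1 * norm (q - p)) * B"
      unfolding abs_mult using K1(1) K1(2)[OF pq] B(2)[OF pq(2)] by (intro mult_mono) auto
    moreover have "\<bar>a p x * (b q x - b p x)\<bar> \<le> A * (K2 * norm (q - p))"
      unfolding abs_mult using K2(2)[OF pq] A(1) A(2)[OF pq(1)] by (intro mult_mono) auto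
    moreover have "a q x * b q x - a p x * b p x = (a q x - a p x) * b q x + a p x * (b q x - b p x)"
      by (simp add: algebra_simps)
    ultimately show ?thesis by (simp add: algebra_simps abs_le_iff)
  qed
  then show ?thesis unfolding fam_lip_def using K1(1) K2(1) A(1) B(1)
    by (intro exI[of _ "K1 * B + A * K2"]) auto
qed

lemma fam_deriv_add:
  assumes "fam_deriv U a a1 a2" "fam_deriv U b b1 b2"
  shows "fam_deriv U (\<lambda>p x. a p x + b p x) (\<lambda>p x. a1 p x + b1 p x) (\<lambda>p x. a2 p x + b2 p x)"
proof -
  obtain K1 where K1: "0 \<le> K1" "\<And>p q x. p \<in> U \<Longrightarrow> q \<in> U \<Longrightarrow>
      \<bar>a q x - a p x - fst (q - p) * a1 p x - snd (q - p) * a2 p x\<bar> \<le> K1 * (norm (q - p))\<^sup>2"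
    using assms(1) unfolding fam_deriv_def by blast
  obtain K2 where K2: "0 \<le> K2" "\<And>p q x. p \<in> U \<Longrightarrow> q \<in> U \<Longrightarrow>
      \<bar>b q x - b p x - fst (q - p) * b1 p x - snd (q - p) * b2 p x\<bar> \<le> K2 * (norm (q - p))\<^sup>2"
    using assms(2) unfolding fam_deriv_def by blast
  have "\<bar>(a q x + b q x) - (a p x + b p x) - fst (q - p) * (a1 p x + b1 p x) - snd (q - p) * (a2 p x + b2 p x)\<bar>
      \<le> (K1 + K2) * (norm (q - p))\<^sup>2" if "p \<in> U" "q \<in> U" for p q x
    using K1(2)[OF that, of x] K2(2)[OF that, of x]
    unfolding distrib_left distrib_right by linarith
  then show ?thesis unfolding fam_deriv_def using K1(1) K2(1) by (intro exI[of _ "K1 + K2"]) auto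
qed

lemma fam_deriv_mult:
  assumes "fam_deriv U a a1 a2" "fam_deriv U b b1 b2" "fam_lip U b"
    "fam_bounded U a" "fam_bounded U b" "fam_bounded U a1" "fam_bounded U a2"
  shows "fam_deriv U (\<lambda>p x. a p x * b p x) (\<lambda>p x. a1 p x * b p x + a p x * b1 p x)
    (\<lambda>p x. a2 p x * b p x + a p x * b2 p x)"
proof -
  obtain K1 where K1: "0 \<le> K1" "\<And>p q x. p \<in> U \<Longrightarrow> q \<in> U \<Longrightarrow>
      \<bar>a q x - a p x - fst (q - p) * a1 p x - snd (q - p) * a2 p x\<bar> \<le> K1 * (norm (q - p))\<^sup>2"
    using assms(1) unfolding fam_deriv_def by blast
  obtain K2 where K2: "0 \<le> K2" "\<And>p q x. p \<in> U \<Longrightarrow> q \<in> U \<Longrightarrow>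
      \<bar>b q x - b p x - fst (q - p) * b1 p x - snd (q - p) * b2 p x\<bar> \<le> K2 * (norm (q - p))\<^sup>2"
    using assms(2) unfolding fam_deriv_def by blast
  obtain K3 where K3: "0 \<le> K3" "\<And>p q x. p \<in> U \<Longrightarrow> q \<in> U \<Longrightarrow> \<bar>b q x - b p x\<bar> \<le> K3 * norm (q - p)"
    using assms(3) unfolding fam_lip_def by blast
  obtain A B A1 A2 where A: "0 \<le> A" "\<And>p x. p \<in> U \<Longrightarrow> \<bar>a p x\<bar> \<le> A"
    and B: "0 \<le> B" "\<And>p x. p \<in> U \<Longrightarrow> \<bar>b p x\<bar> \<le> B"
    and A1: "0 \<le> A1" "\<And>p x. p \<in> U \<Longrightarrow> \<bar>a1 p x\<bar> \<le> A1"
    and A2: "0 \<le> A2" "\<And>p x. p \<in> U \<Longrightarrow> \<bar>a2 p x\<bar> \<le> A2"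
    using assms(4-7) unfolding fam_bounded_def by blast
  let ?K = "K1 * B + (A1 + A2) * K3 + A * K2"
  have "\<bar>a q x * b q x - a p x * b p x - fst (q - p) * (a1 p x * b p x + a p x * b1 p x)
      - snd (q - p) * (a2 p x * b p x + a p x * b2 p x)\<bar> \<le> ?K * (norm (q - p))\<^sup>2"
    if pq: "p \<in> U" "q \<in> U" for p q x
  proof -
    let ?n = "norm (q - p)"
    let ?ra = "a q x - a p x - fst (q - p) * a1 p x - snd (q - p) * a2 p x"
    let ?rb = "b q x - b p x - fst (q - p) * b1 p x - snd (q - p) * b2 p x"
    let ?la = "fst (q - p) * a1 p x + snd (q - p) * a2 p x"
    have "\<bar>?ra * b q x\<bar> \<le> (K1 * ?n\<^sup>2) * B"
      unfolding abs_mult[of ?ra] using K1(1) K1(2)[OF pq] B(2)[OF pq(2)] by (intro mult_mono) auto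
    moreover have "\<bar>?la * (b q x - b p x)\<bar> \<le> ((A1 + A2) * ?n) * (K3 * ?n)"
      unfolding abs_mult[of ?la] using linear_part_bound[OF A1(2)[OF pq(1)] A2(2)[OF pq(1)]] K3(2)[OF pq] A1(1) A2(1)
      by (intro mult_mono) auto
    moreover have "\<bar>a p x * ?rb\<bar> \<le> A * (K2 * ?n\<^sup>2)"
      unfolding abs_mult[of "a p x"] using K2(2)[OF pq] A(1) A(2)[OF pq(1)] by (intro mult_mono) auto
    \<comment> \<open>The exact splitting: the remainder of \<open>a\<close> against
      \<open>b q\<close>, the linear part of \<open>a\<close> against the increment of
      \<open>b\<close>, and \<open>a p\<close> against the remainder of \<open>b\<close>.\<close>
    moreover have "a q x * b q x - a p x * b p x - fst (q - p) * (a1 p x * b p x + a p x * b1 p x)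
      - snd (q - p) * (a2 p x * b p x + a p x * b2 p x) = ?ra * b q x + ?la * (b q x - b p x) + a p x * ?rb"
      by (simp add: algebra_simps)
    moreover have "?K * ?n\<^sup>2 = (K1 * ?n\<^sup>2) * B + ((A1 + A2) * ?n) * (K3 * ?n) + A * (K2 * ?n\<^sup>2)"
      by (simp add: algebra_simps power2_eq_square)
    ultimately show ?thesis by linarith
  qed
  then show ?thesis unfolding fam_deriv_def using K1(1) K2(1) K3(1) A(1) B(1) A1(1) A2(1)
    by (intro exI[of _ ?K]) auto
qed

section \<open>Smooth dependence on the parameters\<close>

text \<open>Continuity of the family in the parameter is not assumed. In its place stands the mutual
  distance \<open>d\<close> of the members, so small against the Green constant \<open>C\<close>
  that the quadratic remainder 8/m d^2 can be absorbed.\<close>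

locale solution_family =
  fixes L C m d R :: real and U :: "(real \<times> real) set" and \<psi> :: family
  assumes L: "0 < L" and m: "0 < m" and U_bdd: "\<And>p. p \<in> U \<Longrightarrow> norm p \<le> R"
    and ep_psi: "\<And>p. p \<in> U \<Longrightarrow> even_periodic L (\<psi> p)"
    and sd_psi: "\<And>p. p \<in> U \<Longrightarrow>
      second_deriv (\<psi> p) (\<lambda>x. fst p * \<psi> p x - \<psi> p x * ln ((\<psi> p x)\<^sup>2) + snd p)"
    and psi_low: "\<And>p x. p \<in> U \<Longrightarrow> m \<le> \<bar>\<psi> p x\<bar>"
    and gb: "\<And>p. p \<in> U \<Longrightarrow> green_bound L (\<lambda>x. fst p - 2 - ln ((\<psi> p x)\<^sup>2)) C"
    and osc: "\<And>p q x. p \<in> U \<Longrightarrow> q \<in> U \<Longrightarrow> \<bar>\<psi> q x - \<psi> p x\<bar> \<le> d"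
    and d: "0 \<le> d" "d \<le> m / 2" "C * (8 / m * d) \<le> 1 / 2"
begin

section \<open>Bounds uniform over the parameter set\<close>

definition pot :: family where "pot p x = fst p - 2 - ln ((\<psi> p x)\<^sup>2)"

lemma psi_nonzero: "p \<in> U \<Longrightarrow> \<psi> p x \<noteq> 0"
  using psi_low[of p x] m by auto

lemma ep_pot: "p \<in> U \<Longrightarrow> even_periodic L (pot p)"
  unfolding pot_def[abs_def] using ep_psi psi_nonzero by (intro even_periodic_intros)

lemma osc_imp_bounded:
  assumes ep: "\<And>p. p \<in> U \<Longrightarrow> even_periodic L (y p)"
    and osc: "\<And>p q x. p \<in> U \<Longrightarrow> q \<in> U \<Longrightarrow> \<bar>y q x - y p x\<bar> \<le> K"
  shows "fam_bounded U y"
proof (cases "U = {}")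
  case True
  then show ?thesis by (auto simp: fam_bounded_def)
next
  case False
  then obtain p0 where p0: "p0 \<in> U" by blast
  obtain B where B: "B > 0" "\<And>x. \<bar>y p0 x\<bar> \<le> B" using even_periodic_bounded[OF L ep[OF p0]] by blast
  have K: "0 \<le> K" using osc[OF p0 p0, of 0] by simp
  have "\<bar>y q x\<bar> \<le> B + K" if "q \<in> U" for q x
    using osc[OF p0 that, of x] B(2)[of x] by linarith
  then show ?thesis unfolding fam_bounded_def using B K by (intro exI[of _ "B + K"]) auto
qed

lemma norm_diff_U: "p \<in> U \<Longrightarrow> q \<in> U \<Longrightarrow> norm (q - p) \<le> 2 * R"
  using U_bdd[of p] U_bdd[of q] norm_triangle_ineq4[of q p] by linarith

lemma lip_imp_bounded:
  assumes ep: "\<And>p. p \<in> U \<Longrightarrow> even_periodic L (y p)" and lip: "fam_lip U y"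
  shows "fam_bounded U y"
proof -
  obtain K where K: "0 \<le> K" "\<And>p q x. p \<in> U \<Longrightarrow> q \<in> U \<Longrightarrow> \<bar>y q x - y p x\<bar> \<le> K * norm (q - p)"
    using lip unfolding fam_lip_def by blast
  have "\<bar>y q x - y p x\<bar> \<le> K * (2 * R)" if "p \<in> U" "q \<in> U" for p q x
    using K(2)[OF that, of x] mult_left_mono[OF norm_diff_U[OF that] K(1)] by linarith
  then show ?thesis using osc_imp_bounded[of y "K * (2 * R)"] ep by blast
qed

lemma psi_bounded: "fam_bounded U \<psi>"
  by (rule osc_imp_bounded[OF ep_psi osc])

lemma ln_psi_lip:
  assumes "p \<in> U" "q \<in> U"
  shows "\<bar>ln ((\<psi> q x)\<^sup>2) - ln ((\<psi> p x)\<^sup>2)\<bar> \<le> 4 / m * \<bar>\<psi> q x - \<psi> p x\<bar>"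
  using ln_square_lipschitz[OF m psi_low[OF assms(1)]] osc[OF assms, of x] d(2) by auto

lemma pot_bounded: "fam_bounded U pot"
proof (rule osc_imp_bounded[OF ep_pot])
  fix p q x assume pq: "p \<in> U" "q \<in> U"
  have "\<bar>fst q - fst p\<bar> \<le> 2 * R"
    using abs_components_le_norm(1)[of "q - p"] norm_diff_U[OF pq] by simp
  moreover have "4 / m * \<bar>\<psi> q x - \<psi> p x\<bar> \<le> 4 / m * d"
    using osc[OF pq] m by (intro mult_left_mono) auto
  ultimately show "\<bar>pot q x - pot p x\<bar> \<le> 2 * R + 4 / m * d"
    unfolding pot_def using ln_psi_lip[OF pq, of x] by linarith
qed

lemma C_pos: "p \<in> U \<Longrightarrow> 0 < C"
  using gb unfolding green_bound_def by blast

lemma sup_estimate: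
  assumes "p \<in> U" "even_periodic L y" "even_periodic L h"
    "second_deriv y (\<lambda>x. pot p x * y x - h x)" "\<And>x. \<bar>h x\<bar> \<le> M"
  shows "\<bar>y x\<bar> \<le> C * M"
  using gb[OF assms(1)] assms(2-) unfolding green_bound_def pot_def by blast

text \<open>The equation expresses the second derivative by \<open>y\<close> and \<open>h\<close>,
  which lifts the sup bound to a C^2 bound: \<open>C\<close> for \<open>y\<close> itself,
  \<open>B * C + 1\<close> for its second derivative.\<close>

lemma elliptic_estimate:
  "\<exists>K\<ge>0. \<forall>p\<in>U. \<forall>y h M. even_periodic L y \<longrightarrow> even_periodic L h \<longrightarrow>
     second_deriv y (\<lambda>x. pot p x * y x - h x) \<longrightarrow> (\<forall>x. \<bar>h x\<bar> \<le> M) \<longrightarrow> c2_bound y (K * M)"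
proof (cases "U = {}")
  case True
  then show ?thesis by auto
next
  case False
  then have C: "0 < C" using C_pos by blast
  obtain B where B: "0 \<le> B" "\<And>p x. p \<in> U \<Longrightarrow> \<bar>pot p x\<bar> \<le> B"
    using pot_bounded unfolding fam_bounded_def by blast
  define K where "K = C + B * C + 1"
  have "c2_bound y (K * M)"
    if p: "p \<in> U" and y: "even_periodic L y" and h: "even_periodic L h"
      and sd: "second_deriv y (\<lambda>x. pot p x * y x - h x)" and M: "\<forall>x. \<bar>h x\<bar> \<le> M" for p y h M
  proof -
    have M0: "0 \<le> M" using M[rule_format, of 0] by linarith
    have y_bd: "\<bar>y x\<bar> \<le> C * M" for x using sup_estimate[OF p y h sd] M by blast
    have nn: "0 \<le> B * C * M" "0 \<le> C * M" using B C M0 by auto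
    have KM: "K * M = C * M + B * C * M + M" by (simp add: K_def algebra_simps)
    have z_bd: "\<bar>pot p x * y x - h x\<bar> \<le> K * M" for x
    proof -
      have "\<bar>pot p x * y x\<bar> \<le> B * (C * M)"
        unfolding abs_mult using B(1) B(2)[OF p, of x] y_bd[of x] by (intro mult_mono) auto
      then have "\<bar>pot p x * y x\<bar> \<le> B * C * M" by (simp only: mult.assoc)
      then show ?thesis using M[rule_format, of x] nn(2) KM by linarith
    qed
    have "continuous_on UNIV (\<lambda>x. pot p x * y x - h x)"
      using even_periodic_diff[OF even_periodic_mult[OF ep_pot[OF p] y] h] by (simp add: even_periodic_def)
    moreover have "\<bar>y x\<bar> \<le> K * M" for x
      using y_bd[of x] nn M0 KM by linarith
    ultimately show ?thesis unfolding c2_bound_def using sd z_bd by blast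
  qed
  then show ?thesis using B C by (intro exI[of _ K]) (auto simp: K_def)
qed

definition ellK :: real where
  "ellK = (SOME K. K \<ge> 0 \<and> (\<forall>p\<in>U. \<forall>y h M. even_periodic L y \<longrightarrow> even_periodic L h \<longrightarrow>
     second_deriv y (\<lambda>x. pot p x * y x - h x) \<longrightarrow> (\<forall>x. \<bar>h x\<bar> \<le> M) \<longrightarrow> c2_bound y (K * M)))"

lemma ellK: "0 \<le> ellK"
  "\<And>p y h M. p \<in> U \<Longrightarrow> even_periodic L y \<Longrightarrow> even_periodic L h \<Longrightarrow>
     second_deriv y (\<lambda>x. pot p x * y x - h x) \<Longrightarrow> (\<And>x. \<bar>h x\<bar> \<le> M) \<Longrightarrow> c2_bound y (ellK * M)"
  using someI_ex[OF elliptic_estimate] unfolding ellK_def by blast+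

definition S :: "real \<times> real \<Rightarrow> (real \<Rightarrow> real) \<Rightarrow> real \<Rightarrow> real" where
  "S p h = (SOME y. even_periodic L y \<and> second_deriv y (\<lambda>x. pot p x * y x - h x))"

lemma S:
  assumes "p \<in> U" "even_periodic L h"
  shows "even_periodic L (S p h)" "second_deriv (S p h) (\<lambda>x. pot p x * S p h x - h x)"
proof -
  have "\<exists>y. even_periodic L y \<and> second_deriv y (\<lambda>x. pot p x * y x - h x)"
    using gb[OF assms(1)] assms(2) unfolding green_bound_def pot_def by blast
  from someI_ex[OF this] show "even_periodic L (S p h)"
    "second_deriv (S p h) (\<lambda>x. pot p x * S p h x - h x)" unfolding S_def by blast+
qed

section \<open>Lipschitz dependence\<close>

definition rem :: "real \<times> real \<Rightarrow> real \<times> real \<Rightarrow> real \<Rightarrow> real" where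
  "rem p q x = \<psi> q x * ln ((\<psi> q x)\<^sup>2) - \<psi> p x * ln ((\<psi> p x)\<^sup>2) - (2 + ln ((\<psi> p x)\<^sup>2)) * (\<psi> q x - \<psi> p x)"

lemma rem_bound: "p \<in> U \<Longrightarrow> q \<in> U \<Longrightarrow> \<bar>rem p q x\<bar> \<le> 8 / m * (\<psi> q x - \<psi> p x)\<^sup>2"
  unfolding rem_def using xlnx_taylor[OF m psi_low] osc d(2) by (meson order_trans)

lemma ep_rem: "p \<in> U \<Longrightarrow> q \<in> U \<Longrightarrow> even_periodic L (rem p q)"
  unfolding rem_def[abs_def] using ep_psi psi_nonzero by (intro even_periodic_intros)

text \<open>The source for which the increment \<open>\<psi> q - \<psi> p\<close> solves the
  equation linearised at \<open>p\<close> exactly, the nonlinearity being hidden in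
  \<open>rem\<close>.\<close>

definition src :: "real \<times> real \<Rightarrow> real \<times> real \<Rightarrow> real \<Rightarrow> real" where
  "src p q x = rem p q x - fst (q - p) * \<psi> q x - snd (q - p)"

lemma ep_src: "p \<in> U \<Longrightarrow> q \<in> U \<Longrightarrow> even_periodic L (src p q)"
  unfolding src_def[abs_def] using ep_psi ep_rem by (intro even_periodic_intros)

lemma sd_psi_diff:
  assumes "p \<in> U" "q \<in> U"
  shows "second_deriv (\<lambda>x. \<psi> q x - \<psi> p x) (\<lambda>x. pot p x * (\<psi> q x - \<psi> p x) - src p q x)"
  by (rule second_deriv_cong[OF second_deriv_diff[OF sd_psi[OF assms(2)] sd_psi[OF assms(1)]]])
    (simp add: pot_def src_def rem_def algebra_simps)

text \<open>The source contains the square of the unknown increment. One factor is bounded by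
  \<open>d\<close>, and the smallness condition on \<open>d\<close> turns this into half the sup
  norm, which is absorbed; the parameter change remains.\<close>

lemma psi_lip2: "\<exists>K\<ge>0. \<forall>p\<in>U. \<forall>q\<in>U. c2_bound (\<lambda>x. \<psi> q x - \<psi> p x) (K * norm (q - p))"
proof (cases "U = {}")
  case False
  then have C: "0 < C" using C_pos by blast
  obtain B where B: "0 \<le> B" "\<And>p x. p \<in> U \<Longrightarrow> \<bar>\<psi> p x\<bar> \<le> B"
    using psi_bounded unfolding fam_bounded_def by blast
  have "c2_bound (\<lambda>x. \<psi> q x - \<psi> p x) (ellK * (2 * (B + 1)) * norm (q - p))" if pq: "p \<in> U" "q \<in> U" for p q
  proof -
    let ?n = "norm (q - p)"
    have src_bd: "\<bar>src p q x\<bar> \<le> (B + 1) * ?n + 8 / m * d * D" if D: "\<bar>\<psi> q x - \<psi> p x\<bar> \<le> D" for D x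
    proof -
      have "(\<psi> q x - \<psi> p x)\<^sup>2 = \<bar>\<psi> q x - \<psi> p x\<bar> * \<bar>\<psi> q x - \<psi> p x\<bar>"
        by (simp only: abs_mult_self_eq power2_eq_square)
      also have "\<dots> \<le> d * D" using osc[OF pq, of x] D d(1) by (intro mult_mono) auto
      finally have "8 / m * (\<psi> q x - \<psi> p x)\<^sup>2 \<le> 8 / m * (d * D)" using m by (intro mult_left_mono) auto
      then have "\<bar>rem p q x\<bar> \<le> 8 / m * d * D" using rem_bound[OF pq, of x] by simp
      moreover have "\<bar>fst (q - p) * \<psi> q x + snd (q - p) * 1\<bar> \<le> (B + 1) * ?n"
        by (rule linear_part_bound) (use B(2)[OF pq(2)] in auto)
      ultimately show ?thesis unfolding src_def by (simp add: abs_le_iff)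
    qed
    have lip: "\<bar>\<psi> q x - \<psi> p x\<bar> \<le> 2 * (C * ((B + 1) * ?n))" for x
    proof (rule absorb_half[where f = "\<lambda>x. \<psi> q x - \<psi> p x", OF osc[OF pq]])
      fix D x assume D: "\<And>x. \<bar>\<psi> q x - \<psi> p x\<bar> \<le> D"
      have D0: "0 \<le> D" using D[of 0] by linarith
      have "\<bar>\<psi> q x - \<psi> p x\<bar> \<le> C * ((B + 1) * ?n + 8 / m * d * D)"
        by (rule sup_estimate[OF pq(1) even_periodic_diff[OF ep_psi ep_psi] ep_src[OF pq] sd_psi_diff[OF pq]])
          (use pq src_bd[OF D] in auto)
      also have "\<dots> = C * ((B + 1) * ?n) + C * (8 / m * d) * D" by (simp add: algebra_simps)
      also have "C * (8 / m * d) * D \<le> 1 / 2 * D" using d(3) D0 by (intro mult_right_mono) auto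
      finally show "\<bar>\<psi> q x - \<psi> p x\<bar> \<le> C * ((B + 1) * ?n) + D / 2" by simp
    qed
    have "\<bar>src p q x\<bar> \<le> 2 * (B + 1) * ?n" for x
    proof -
      have "\<bar>src p q x\<bar> \<le> (B + 1) * ?n + 8 / m * d * (2 * (C * ((B + 1) * ?n)))" by (rule src_bd[OF lip])
      also have "\<dots> = (B + 1) * ?n + (C * (8 / m * d)) * (2 * ((B + 1) * ?n))" by (simp add: algebra_simps)
      also have "(C * (8 / m * d)) * (2 * ((B + 1) * ?n)) \<le> 1 / 2 * (2 * ((B + 1) * ?n))"
        using d(3) B(1) by (intro mult_right_mono) auto
      finally show ?thesis by (simp add: algebra_simps)
    qed
    from ellK(2)[OF pq(1) even_periodic_diff[OF ep_psi[OF pq(2)] ep_psi[OF pq(1)]] ep_src[OF pq] sd_psi_diff[OF pq] this]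
    show ?thesis by (simp add: algebra_simps)
  qed
  then show ?thesis using ellK(1) B(1) by (intro exI[of _ "ellK * (2 * (B + 1))"]) auto
qed auto

lemma c2_lip_imp_lip:
  assumes "\<exists>K\<ge>0. \<forall>p\<in>U. \<forall>q\<in>U. c2_bound (\<lambda>x. y q x - y p x) (K * norm (q - p))"
  shows "fam_lip U y"
  using assms unfolding c2_bound_def fam_lip_def by blast

lemma psi_lip: "fam_lip U \<psi>"
  by (rule c2_lip_imp_lip[OF psi_lip2])

lemma pot_lip: "fam_lip U pot"
proof -
  obtain K where K: "0 \<le> K" "\<And>p q x. p \<in> U \<Longrightarrow> q \<in> U \<Longrightarrow> \<bar>\<psi> q x - \<psi> p x\<bar> \<le> K * norm (q - p)"
    using psi_lip unfolding fam_lip_def by blast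
  have "\<bar>pot q x - pot p x\<bar> \<le> (1 + 4 / m * K) * norm (q - p)" if pq: "p \<in> U" "q \<in> U" for p q x
  proof -
    have "4 / m * \<bar>\<psi> q x - \<psi> p x\<bar> \<le> 4 / m * (K * norm (q - p))"
      using K(2)[OF pq] m by (intro mult_left_mono) auto
    then have "\<bar>pot q x - pot p x\<bar> \<le> norm (q - p) + 4 / m * (K * norm (q - p))"
      unfolding pot_def using ln_psi_lip[OF pq, of x] abs_components_le_norm(1)[of "q - p"]
      by (simp only: fst_diff)
    then show ?thesis by (simp add: algebra_simps)
  qed
  then show ?thesis unfolding fam_lip_def using K(1) m by (intro exI[of _ "1 + 4 / m * K"]) auto
qed

lemma inverse_psi_lip: "fam_lip U (\<lambda>p x. inverse (\<psi> p x))"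
proof -
  obtain K where K: "0 \<le> K" "\<And>p q x. p \<in> U \<Longrightarrow> q \<in> U \<Longrightarrow> \<bar>\<psi> q x - \<psi> p x\<bar> \<le> K * norm (q - p)"
    using psi_lip unfolding fam_lip_def by blast
  have "\<bar>inverse (\<psi> q x) - inverse (\<psi> p x)\<bar> \<le> (1 / m\<^sup>2 * K) * norm (q - p)" if pq: "p \<in> U" "q \<in> U" for p q x
  proof -
    have "1 / m\<^sup>2 * \<bar>\<psi> q x - \<psi> p x\<bar> \<le> 1 / m\<^sup>2 * (K * norm (q - p))"
      using K(2)[OF pq] by (intro mult_left_mono) auto
    then show ?thesis using inverse_lipschitz[OF m psi_low[OF pq(1)] psi_low[OF pq(2)]]
      by (metis (no_types, lifting) mult.assoc order_trans)
  qed
  then show ?thesis unfolding fam_lip_def using K(1) by (intro exI[of _ "1 / m\<^sup>2 * K"]) auto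
qed

text \<open>The difference of the two solutions satisfies the equation at \<open>p\<close> once the
  change of potential, multiplied by the solution at \<open>q\<close>, is counted as source.\<close>

lemma S_lip2:
  assumes ep: "\<And>p. p \<in> U \<Longrightarrow> even_periodic L (h p)" and lip: "fam_lip U h"
  shows "\<exists>K\<ge>0. \<forall>p\<in>U. \<forall>q\<in>U. c2_bound (\<lambda>x. S q (h q) x - S p (h p) x) (K * norm (q - p))"
proof (cases "U = {}")
  case False
  then have C: "0 < C" using C_pos by blast
  obtain Kh where Kh: "0 \<le> Kh" "\<And>p q x. p \<in> U \<Longrightarrow> q \<in> U \<Longrightarrow> \<bar>h q x - h p x\<bar> \<le> Kh * norm (q - p)"
    using lip unfolding fam_lip_def by blast
  obtain Kp where Kp: "0 \<le> Kp" "\<And>p q x. p \<in> U \<Longrightarrow> q \<in> U \<Longrightarrow> \<bar>pot q x - pot p x\<bar> \<le> Kp * norm (q - p)"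
    using pot_lip unfolding fam_lip_def by blast
  obtain B where B: "0 \<le> B" "\<And>p x. p \<in> U \<Longrightarrow> \<bar>h p x\<bar> \<le> B"
    using lip_imp_bounded[OF ep lip] unfolding fam_bounded_def by blast
  have S_bd: "\<bar>S p (h p) x\<bar> \<le> C * B" if "p \<in> U" for p x
    by (rule sup_estimate[OF that S(1)[OF that ep[OF that]] ep[OF that] S(2)[OF that ep[OF that]] B(2)[OF that]])
  have "c2_bound (\<lambda>x. S q (h q) x - S p (h p) x) (ellK * (Kh + Kp * (C * B)) * norm (q - p))"
    if pq: "p \<in> U" "q \<in> U" for p q
  proof -
    let ?n = "norm (q - p)"
    let ?o = "\<lambda>x. (h q x - h p x) - (pot q x - pot p x) * S q (h q) x"
    note Sp = S[OF pq(1) ep[OF pq(1)]] and Sq = S[OF pq(2) ep[OF pq(2)]]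
    have "c2_bound (\<lambda>x. S q (h q) x - S p (h p) x) (ellK * ((Kh + Kp * (C * B)) * ?n))"
    proof (rule ellK(2)[OF pq(1) even_periodic_diff[OF Sq(1) Sp(1)], where h = ?o])
      show "even_periodic L ?o"
        using ep pq ep_pot Sq(1) by (intro even_periodic_intros)
      show "second_deriv (\<lambda>x. S q (h q) x - S p (h p) x) (\<lambda>x. pot p x * (S q (h q) x - S p (h p) x) - ?o x)"
        by (rule second_deriv_cong[OF second_deriv_diff[OF Sq(2) Sp(2)]]) (simp add: algebra_simps)
      show "\<bar>?o x\<bar> \<le> (Kh + Kp * (C * B)) * ?n" for x
      proof -
        have "\<bar>(pot q x - pot p x) * S q (h q) x\<bar> \<le> (Kp * ?n) * (C * B)"
          unfolding abs_mult using Kp(1) Kp(2)[OF pq] S_bd[OF pq(2)] by (intro mult_mono) auto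
        moreover have "(Kh + Kp * (C * B)) * ?n = Kh * ?n + (Kp * ?n) * (C * B)" by (simp add: algebra_simps)
        ultimately show ?thesis using Kh(2)[OF pq, of x] by linarith
      qed
    qed
    then show ?thesis by (simp add: mult.assoc)
  qed
  then show ?thesis using ellK(1) Kh(1) Kp(1) B(1) C by (intro exI[of _ "ellK * (Kh + Kp * (C * B))"]) auto
qed auto

section \<open>Differentiation in the parameters\<close>

text \<open>Formal expressions in the solution family, closed under differentiation with respect to the parameters.\<close>

inductive expr :: "family \<Rightarrow> bool" where
  psi: "expr \<psi>"
| inv: "expr (\<lambda>p x. inverse (\<psi> p x))"
| pot: "expr pot"
| const: "expr (\<lambda>p x. c)"
| add: "expr a \<Longrightarrow> expr b \<Longrightarrow> expr (\<lambda>p x. a p x + b p x)"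
| mult: "expr a \<Longrightarrow> expr b \<Longrightarrow> expr (\<lambda>p x. a p x * b p x)"
| sol: "expr h \<Longrightarrow> expr (\<lambda>p. S p (h p))"

lemma expr_regular: "expr y \<Longrightarrow> (\<forall>p\<in>U. even_periodic L (y p)) \<and> fam_lip U y"
proof (induction rule: expr.induct)
  case psi
  then show ?case using ep_psi psi_lip by blast
next
  case inv
  then show ?case using ep_psi psi_nonzero inverse_psi_lip by (auto intro: even_periodic_inverse)
next
  case pot
  then show ?case using ep_pot pot_lip by blast
next
  case (const c)
  then show ?case by (auto simp: fam_lip_def even_periodic_const intro!: exI[of _ 0])
next
  case (add a b)
  then show ?case by (auto intro: even_periodic_add fam_lip_add)
next
  case (mult a b)
  then show ?case by (auto intro!: even_periodic_mult fam_lip_mult lip_imp_bounded)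
next
  case (sol h)
  then show ?case using S(1) c2_lip_imp_lip[OF S_lip2] by auto
qed

lemma expr_ep: "expr y \<Longrightarrow> p \<in> U \<Longrightarrow> even_periodic L (y p)"
  and expr_lip: "expr y \<Longrightarrow> fam_lip U y"
  using expr_regular by blast+

lemma expr_bounded: "expr y \<Longrightarrow> fam_bounded U y"
  using lip_imp_bounded expr_ep expr_lip by blast

text \<open>Differentiating the equation for \<psi> in \<omega> and in A leaves the sources - \<psi>
  and - 1. The spelling \<open>- 1 * \<psi> p x\<close> makes the first one literally a product
  covered by \<open>expr\<close>.\<close>

definition psi1 :: family where "psi1 = (\<lambda>p. S p (\<lambda>x. - 1 * \<psi> p x))"
definition psi2 :: family where "psi2 = (\<lambda>p. S p (\<lambda>x. - 1))"

lemma expr_psi12: "expr psi1" "expr psi2"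
  unfolding psi1_def psi2_def by (intro expr.intros)+

text \<open>The candidates cancel the first-order part of \<open>src\<close>. What remains is
  \<open>rem\<close> and the change of \<omega> times the increment of \<psi>, both quadratic by the
  Lipschitz bound.\<close>

lemma psi_deriv2:
  "\<exists>K\<ge>0. \<forall>p\<in>U. \<forall>q\<in>U.
     c2_bound (\<lambda>x. \<psi> q x - \<psi> p x - fst (q - p) * psi1 p x - snd (q - p) * psi2 p x) (K * (norm (q - p))\<^sup>2)"
proof -
  obtain K where K: "0 \<le> K" "\<And>p q x. p \<in> U \<Longrightarrow> q \<in> U \<Longrightarrow> \<bar>\<psi> q x - \<psi> p x\<bar> \<le> K * norm (q - p)"
    using psi_lip unfolding fam_lip_def by blast
  have "c2_bound (\<lambda>x. \<psi> q x - \<psi> p x - fst (q - p) * psi1 p x - snd (q - p) * psi2 p x)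
      (ellK * (8 / m * K\<^sup>2 + K) * (norm (q - p))\<^sup>2)" if pq: "p \<in> U" "q \<in> U" for p q
  proof -
    let ?n = "norm (q - p)"
    let ?o = "\<lambda>x. rem p q x - fst (q - p) * (\<psi> q x - \<psi> p x)"
    have e1: "even_periodic L (\<lambda>x. - 1 * \<psi> p x)"
      using ep_psi pq by (intro even_periodic_intros)
    have e2: "even_periodic L (\<lambda>x. - 1)" by (rule even_periodic_const)
    note s1 = S[OF pq(1) e1, folded fun_cong[OF psi1_def, of p]]
    note s2 = S[OF pq(1) e2, folded fun_cong[OF psi2_def, of p]]
    have "c2_bound (\<lambda>x. \<psi> q x - \<psi> p x - fst (q - p) * psi1 p x - snd (q - p) * psi2 p x)
        (ellK * ((8 / m * K\<^sup>2 + K) * ?n\<^sup>2))"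
    proof (rule ellK(2)[OF pq(1), where h = ?o])
      show "even_periodic L (\<lambda>x. \<psi> q x - \<psi> p x - fst (q - p) * psi1 p x - snd (q - p) * psi2 p x)"
        using ep_psi pq s1(1) s2(1) by (intro even_periodic_intros)
      show "even_periodic L ?o" using ep_psi pq ep_rem by (intro even_periodic_intros)
      show "second_deriv (\<lambda>x. \<psi> q x - \<psi> p x - fst (q - p) * psi1 p x - snd (q - p) * psi2 p x)
        (\<lambda>x. pot p x * (\<psi> q x - \<psi> p x - fst (q - p) * psi1 p x - snd (q - p) * psi2 p x) - ?o x)"
        by (rule second_deriv_cong[OF second_deriv_diff[OF second_deriv_diff[OF sd_psi_diff[OF pq]
            second_deriv_cmult[OF s1(2)]] second_deriv_cmult[OF s2(2)]]])
          (simp add: src_def algebra_simps)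
      show "\<bar>?o x\<bar> \<le> (8 / m * K\<^sup>2 + K) * ?n\<^sup>2" for x
      proof -
        have "(\<psi> q x - \<psi> p x)\<^sup>2 \<le> (K * ?n)\<^sup>2"
          using K(2)[OF pq, of x] K(1) by (intro abs_le_square_iff[THEN iffD1]) auto
        then have "8 / m * (\<psi> q x - \<psi> p x)\<^sup>2 \<le> 8 / m * (K * ?n)\<^sup>2" using m by (intro mult_left_mono) auto
        then have "\<bar>rem p q x\<bar> \<le> 8 / m * (K * ?n)\<^sup>2" using rem_bound[OF pq, of x] by linarith
        moreover have "\<bar>fst (q - p) * (\<psi> q x - \<psi> p x)\<bar> \<le> ?n * (K * ?n)"
          unfolding abs_mult using abs_components_le_norm(1)[of "q - p"] K(2)[OF pq] by (intro mult_mono) auto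
        moreover have "(8 / m * K\<^sup>2 + K) * ?n\<^sup>2 = 8 / m * (K * ?n)\<^sup>2 + ?n * (K * ?n)"
          by (simp add: algebra_simps power2_eq_square)
        ultimately show ?thesis by linarith
      qed
    qed
    then show ?thesis by (simp add: mult.assoc)
  qed
  then show ?thesis using ellK(1) K(1) m by (intro exI[of _ "ellK * (8 / m * K\<^sup>2 + K)"]) auto
qed

lemma c2_deriv_imp_deriv:
  assumes "\<exists>K\<ge>0. \<forall>p\<in>U. \<forall>q\<in>U.
     c2_bound (\<lambda>x. y q x - y p x - fst (q - p) * y1 p x - snd (q - p) * y2 p x) (K * (norm (q - p))\<^sup>2)"
  shows "fam_deriv U y y1 y2"
  using assms unfolding c2_bound_def fam_deriv_def by blast

lemma psi_deriv: "fam_deriv U \<psi> psi1 psi2"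
  by (rule c2_deriv_imp_deriv[OF psi_deriv2])

text \<open>The chain rule with quadratic remainders, to be used for the reciprocal and the
  logarithm of \<psi>.\<close>

lemma fam_deriv_compose_psi:
  fixes F F' :: "real \<Rightarrow> real"
  assumes taylor: "\<And>p q x. p \<in> U \<Longrightarrow> q \<in> U \<Longrightarrow>
      \<bar>F (\<psi> q x) - F (\<psi> p x) - (\<psi> q x - \<psi> p x) * F' (\<psi> p x)\<bar> \<le> K0 * (\<psi> q x - \<psi> p x)\<^sup>2"
    and K0: "0 \<le> K0" and F': "fam_bounded U (\<lambda>p x. F' (\<psi> p x))"
  shows "fam_deriv U (\<lambda>p x. F (\<psi> p x)) (\<lambda>p x. psi1 p x * F' (\<psi> p x)) (\<lambda>p x. psi2 p x * F' (\<psi> p x))"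
proof -
  obtain K where K: "0 \<le> K" "\<And>p q x. p \<in> U \<Longrightarrow> q \<in> U \<Longrightarrow> \<bar>\<psi> q x - \<psi> p x\<bar> \<le> K * norm (q - p)"
    using psi_lip unfolding fam_lip_def by blast
  obtain K1 where K1: "0 \<le> K1" "\<And>p q x. p \<in> U \<Longrightarrow> q \<in> U \<Longrightarrow>
      \<bar>\<psi> q x - \<psi> p x - fst (q - p) * psi1 p x - snd (q - p) * psi2 p x\<bar> \<le> K1 * (norm (q - p))\<^sup>2"
    using psi_deriv unfolding fam_deriv_def by blast
  obtain B where B: "0 \<le> B" "\<And>p x. p \<in> U \<Longrightarrow> \<bar>F' (\<psi> p x)\<bar> \<le> B"
    using F' unfolding fam_bounded_def by blast
  have "\<bar>F (\<psi> q x) - F (\<psi> p x) - fst (q - p) * (psi1 p x * F' (\<psi> p x)) - snd (q - p) * (psi2 p x * F' (\<psi> p x))\<bar>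
      \<le> (K0 * K\<^sup>2 + K1 * B) * (norm (q - p))\<^sup>2" if pq: "p \<in> U" "q \<in> U" for p q x
  proof -
    let ?n = "norm (q - p)"
    let ?r = "\<psi> q x - \<psi> p x - fst (q - p) * psi1 p x - snd (q - p) * psi2 p x"
    have "(\<psi> q x - \<psi> p x)\<^sup>2 \<le> (K * ?n)\<^sup>2"
      using K(2)[OF pq, of x] K(1) by (intro abs_le_square_iff[THEN iffD1]) auto
    then have "K0 * (\<psi> q x - \<psi> p x)\<^sup>2 \<le> K0 * (K * ?n)\<^sup>2" using K0 by (intro mult_left_mono) auto
    then have "\<bar>F (\<psi> q x) - F (\<psi> p x) - (\<psi> q x - \<psi> p x) * F' (\<psi> p x)\<bar> \<le> K0 * (K * ?n)\<^sup>2"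
      using taylor[OF pq, of x] by linarith
    moreover have "\<bar>?r * F' (\<psi> p x)\<bar> \<le> (K1 * ?n\<^sup>2) * B"
      unfolding abs_mult[of ?r] using K1(1) K1(2)[OF pq] B(2)[OF pq(1)] by (intro mult_mono) auto
    moreover have "(K0 * K\<^sup>2 + K1 * B) * ?n\<^sup>2 = K0 * (K * ?n)\<^sup>2 + (K1 * ?n\<^sup>2) * B"
      by (simp add: algebra_simps power2_eq_square)
    moreover have "F (\<psi> q x) - F (\<psi> p x) - fst (q - p) * (psi1 p x * F' (\<psi> p x)) - snd (q - p) * (psi2 p x * F' (\<psi> p x))
      = (F (\<psi> q x) - F (\<psi> p x) - (\<psi> q x - \<psi> p x) * F' (\<psi> p x)) + ?r * F' (\<psi> p x)"
      by (simp add: algebra_simps)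
    ultimately show ?thesis by linarith
  qed
  then show ?thesis unfolding fam_deriv_def using K0 K1(1) B(1) by (intro exI[of _ "K0 * K\<^sup>2 + K1 * B"]) auto
qed

lemma inverse_psi_deriv:
  "fam_deriv U (\<lambda>p x. inverse (\<psi> p x)) (\<lambda>p x. psi1 p x * (- 1 * (inverse (\<psi> p x) * inverse (\<psi> p x))))
     (\<lambda>p x. psi2 p x * (- 1 * (inverse (\<psi> p x) * inverse (\<psi> p x))))"
proof (rule fam_deriv_compose_psi[where F = inverse and F' = "\<lambda>s. - 1 * (inverse s * inverse s)" and ?K0.0 = "1 / m^3"])
  show "\<bar>inverse (\<psi> q x) - inverse (\<psi> p x) - (\<psi> q x - \<psi> p x) * (- 1 * (inverse (\<psi> p x) * inverse (\<psi> p x)))\<bar>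
      \<le> 1 / m^3 * (\<psi> q x - \<psi> p x)\<^sup>2" if "p \<in> U" "q \<in> U" for p q x
    using inverse_taylor[OF m psi_low[OF that(1)] psi_low[OF that(2)], of x x] by simp
  show "fam_bounded U (\<lambda>p x. - 1 * (inverse (\<psi> p x) * inverse (\<psi> p x)))"
    by (intro expr_bounded expr.intros)
qed (use m in auto)

definition pot1 :: family where "pot1 = (\<lambda>p x. 1 + psi1 p x * (- 2 * inverse (\<psi> p x)))"
definition pot2 :: family where "pot2 = (\<lambda>p x. psi2 p x * (- 2 * inverse (\<psi> p x)))"

lemma expr_pot12: "expr pot1" "expr pot2"
  unfolding pot1_def pot2_def by (intro expr.intros expr_psi12)+

lemma pot_deriv: "fam_deriv U pot pot1 pot2"
proof -
  have "fam_deriv U (\<lambda>p x. fst p) (\<lambda>p x. 1) (\<lambda>p x. 0)"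
    unfolding fam_deriv_def by (intro exI[of _ 0]) auto
  moreover have "fam_deriv U (\<lambda>p x. - 2 - ln ((\<psi> p x)\<^sup>2)) (\<lambda>p x. psi1 p x * (- 2 * inverse (\<psi> p x)))
     (\<lambda>p x. psi2 p x * (- 2 * inverse (\<psi> p x)))"
  proof (rule fam_deriv_compose_psi[where F = "\<lambda>s. - 2 - ln (s\<^sup>2)" and F' = "\<lambda>s. - 2 * inverse s" and ?K0.0 = "4 / m\<^sup>2"])
    show "\<bar>- 2 - ln ((\<psi> q x)\<^sup>2) - (- 2 - ln ((\<psi> p x)\<^sup>2)) - (\<psi> q x - \<psi> p x) * (- 2 * inverse (\<psi> p x))\<bar>
        \<le> 4 / m\<^sup>2 * (\<psi> q x - \<psi> p x)\<^sup>2" if "p \<in> U" "q \<in> U" for p q x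
    proof -
      have "- 2 - ln ((\<psi> q x)\<^sup>2) - (- 2 - ln ((\<psi> p x)\<^sup>2)) - (\<psi> q x - \<psi> p x) * (- 2 * inverse (\<psi> p x))
        = - (ln ((\<psi> q x)\<^sup>2) - ln ((\<psi> p x)\<^sup>2) - 2 * (\<psi> q x - \<psi> p x) * inverse (\<psi> p x))"
        by (simp add: algebra_simps)
      then show ?thesis
        using ln_square_taylor[OF m psi_low[OF that(1)], of "\<psi> q x" x] osc[OF that, of x] d(2)
        by (simp only: abs_minus_cancel)
    qed
    show "fam_bounded U (\<lambda>p x. - 2 * inverse (\<psi> p x))"
      by (intro expr_bounded expr.intros)
  qed (use m in auto)
  ultimately have "fam_deriv U (\<lambda>p x. fst p + (- 2 - ln ((\<psi> p x)\<^sup>2))) pot1 (\<lambda>p x. 0 + pot2 p x)"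
    unfolding pot1_def pot2_def by (rule fam_deriv_add)
  then show ?thesis unfolding pot_def[abs_def] by (simp add: algebra_simps)
qed

text \<open>Formally, - y'' + pot y = h differentiates to the same equation with source h1 - pot1 y.
  The derivative is therefore again a value of \<open>S\<close> on an expression, which is what
  closes the class.\<close>

lemma S_deriv2:
  assumes h: "expr h" "expr h1" "expr h2" "fam_deriv U h h1 h2"
  defines "y \<equiv> \<lambda>p. S p (h p)"
  shows "\<exists>K\<ge>0. \<forall>p\<in>U. \<forall>q\<in>U. c2_bound (\<lambda>x. y q x - y p x
     - fst (q - p) * S p (\<lambda>x. h1 p x + - 1 * (pot1 p x * y p x)) x
     - snd (q - p) * S p (\<lambda>x. h2 p x + - 1 * (pot2 p x * y p x)) x) (K * (norm (q - p))\<^sup>2)"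
proof -
  have y: "expr y" unfolding y_def by (rule expr.sol[OF h(1)])
  obtain Kh where Kh: "0 \<le> Kh" "\<And>p q x. p \<in> U \<Longrightarrow> q \<in> U \<Longrightarrow>
      \<bar>h q x - h p x - fst (q - p) * h1 p x - snd (q - p) * h2 p x\<bar> \<le> Kh * (norm (q - p))\<^sup>2"
    using h(4) unfolding fam_deriv_def by blast
  obtain Kp where Kp: "0 \<le> Kp" "\<And>p q x. p \<in> U \<Longrightarrow> q \<in> U \<Longrightarrow>
      \<bar>pot q x - pot p x - fst (q - p) * pot1 p x - snd (q - p) * pot2 p x\<bar> \<le> Kp * (norm (q - p))\<^sup>2"
    using pot_deriv unfolding fam_deriv_def by blast
  obtain Ky where Ky: "0 \<le> Ky" "\<And>p q x. p \<in> U \<Longrightarrow> q \<in> U \<Longrightarrow> \<bar>y q x - y p x\<bar> \<le> Ky * norm (q - p)"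
    using expr_lip[OF y] unfolding fam_lip_def by blast
  obtain B where B: "0 \<le> B" "\<And>p x. p \<in> U \<Longrightarrow> \<bar>y p x\<bar> \<le> B"
    using expr_bounded[OF y] unfolding fam_bounded_def by blast
  obtain A1 where A1: "0 \<le> A1" "\<And>p x. p \<in> U \<Longrightarrow> \<bar>pot1 p x\<bar> \<le> A1"
    using expr_bounded[OF expr_pot12(1)] unfolding fam_bounded_def by blast
  obtain A2 where A2: "0 \<le> A2" "\<And>p x. p \<in> U \<Longrightarrow> \<bar>pot2 p x\<bar> \<le> A2"
    using expr_bounded[OF expr_pot12(2)] unfolding fam_bounded_def by blast
  let ?K = "Kh + Kp * B + (A1 + A2) * Ky"
  have "c2_bound (\<lambda>x. y q x - y p x
     - fst (q - p) * S p (\<lambda>x. h1 p x + - 1 * (pot1 p x * y p x)) x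
     - snd (q - p) * S p (\<lambda>x. h2 p x + - 1 * (pot2 p x * y p x)) x) (ellK * ?K * (norm (q - p))\<^sup>2)"
    if pq: "p \<in> U" "q \<in> U" for p q
  proof -
    let ?n = "norm (q - p)"
    let ?s1 = "\<lambda>x. h1 p x + - 1 * (pot1 p x * y p x)" and ?s2 = "\<lambda>x. h2 p x + - 1 * (pot2 p x * y p x)"
    let ?rh = "\<lambda>x. h q x - h p x - fst (q - p) * h1 p x - snd (q - p) * h2 p x"
    let ?rp = "\<lambda>x. pot q x - pot p x - fst (q - p) * pot1 p x - snd (q - p) * pot2 p x"
    let ?lp = "\<lambda>x. fst (q - p) * pot1 p x + snd (q - p) * pot2 p x"
    let ?o = "\<lambda>x. ?rh x - ?rp x * y q x - ?lp x * (y q x - y p x)"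
    have e1: "even_periodic L ?s1" and e2: "even_periodic L ?s2"
      using expr_ep[OF _ pq(1)] h y expr_pot12 by (intro even_periodic_intros; blast)+
    note s1 = S[OF pq(1) e1] and s2 = S[OF pq(1) e2]
    note Sp = S[OF pq(1) expr_ep[OF h(1) pq(1)], folded fun_cong[OF y_def[THEN meta_eq_to_obj_eq], of p]]
    note Sq = S[OF pq(2) expr_ep[OF h(1) pq(2)], folded fun_cong[OF y_def[THEN meta_eq_to_obj_eq], of q]]
    have "c2_bound (\<lambda>x. y q x - y p x - fst (q - p) * S p ?s1 x - snd (q - p) * S p ?s2 x) (ellK * (?K * ?n\<^sup>2))"
    proof (rule ellK(2)[OF pq(1), where h = ?o])
      show "even_periodic L (\<lambda>x. y q x - y p x - fst (q - p) * S p ?s1 x - snd (q - p) * S p ?s2 x)"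
        by (intro even_periodic_intros Sp(1) Sq(1) s1(1) s2(1))
      show "even_periodic L ?o"
        using expr_ep pq h y expr_pot12 expr.pot by (intro even_periodic_intros; blast)
      show "second_deriv (\<lambda>x. y q x - y p x - fst (q - p) * S p ?s1 x - snd (q - p) * S p ?s2 x)
        (\<lambda>x. pot p x * (y q x - y p x - fst (q - p) * S p ?s1 x - snd (q - p) * S p ?s2 x) - ?o x)"
        by (rule second_deriv_cong[OF second_deriv_diff[OF second_deriv_diff[OF
            second_deriv_diff[OF Sq(2) Sp(2)] second_deriv_cmult[OF s1(2)]] second_deriv_cmult[OF s2(2)]]])
          (simp add: algebra_simps)
      show "\<bar>?o x\<bar> \<le> ?K * ?n\<^sup>2" for x
      proof -
        have "\<bar>?rp x * y q x\<bar> \<le> (Kp * ?n\<^sup>2) * B"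
          unfolding abs_mult[of "?rp x"] using Kp(1) Kp(2)[OF pq] B(2)[OF pq(2)] by (intro mult_mono) auto
        moreover have "\<bar>?lp x * (y q x - y p x)\<bar> \<le> ((A1 + A2) * ?n) * (Ky * ?n)"
          unfolding abs_mult[of "?lp x"]
          using linear_part_bound[OF A1(2)[OF pq(1)] A2(2)[OF pq(1)]] Ky(2)[OF pq] A1(1) A2(1)
          by (intro mult_mono) auto
        moreover have "?K * ?n\<^sup>2 = Kh * ?n\<^sup>2 + (Kp * ?n\<^sup>2) * B + ((A1 + A2) * ?n) * (Ky * ?n)"
          by (simp add: algebra_simps power2_eq_square)
        ultimately show ?thesis using Kh(2)[OF pq, of x] by linarith
      qed
    qed
    then show ?thesis by (simp add: mult.assoc)
  qed
  then show ?thesis using ellK(1) Kh(1) Kp(1) Ky(1) B(1) A1(1) A2(1)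
    by (intro exI[of _ "ellK * ?K"]) auto
qed

lemma expr_deriv: "expr y \<Longrightarrow> \<exists>D1 D2. expr D1 \<and> expr D2 \<and> fam_deriv U y D1 D2"
proof (induction rule: expr.induct)
  case psi
  then show ?case using psi_deriv expr_psi12 by blast
next
  case inv
  have "expr (\<lambda>p x. psi1 p x * (- 1 * (inverse (\<psi> p x) * inverse (\<psi> p x))))"
    "expr (\<lambda>p x. psi2 p x * (- 1 * (inverse (\<psi> p x) * inverse (\<psi> p x))))"
    by (intro expr.intros expr_psi12)+
  then show ?case using inverse_psi_deriv by blast
next
  case pot
  then show ?case using pot_deriv expr_pot12 by blast
next
  case (const c)
  have "fam_deriv U (\<lambda>p x. c) (\<lambda>p x. 0) (\<lambda>p x. 0)"
    unfolding fam_deriv_def by (intro exI[of _ 0]) auto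
  then show ?case using expr.const by blast
next
  case (add a b)
  then obtain a1 a2 b1 b2 where ab: "expr a1" "expr a2" "fam_deriv U a a1 a2"
    "expr b1" "expr b2" "fam_deriv U b b1 b2" by blast
  show ?case
    by (intro exI conjI, rule expr.add[OF ab(1,4)], rule expr.add[OF ab(2,5)], rule fam_deriv_add[OF ab(3,6)])
next
  case (mult a b)
  then obtain a1 a2 b1 b2 where ab: "expr a1" "expr a2" "fam_deriv U a a1 a2"
    "expr b1" "expr b2" "fam_deriv U b b1 b2" by blast
  have "fam_deriv U (\<lambda>p x. a p x * b p x) (\<lambda>p x. a1 p x * b p x + a p x * b1 p x)
        (\<lambda>p x. a2 p x * b p x + a p x * b2 p x)"
    using ab mult.hyps by (intro fam_deriv_mult expr_lip expr_bounded)
  moreover have "expr (\<lambda>p x. a1 p x * b p x + a p x * b1 p x)" "expr (\<lambda>p x. a2 p x * b p x + a p x * b2 p x)"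
    by (intro expr.add expr.mult ab mult.hyps)+
  ultimately show ?case by blast
next
  case (sol h)
  then obtain h1 h2 where h: "expr h1" "expr h2" "fam_deriv U h h1 h2" by blast
  have "fam_deriv U (\<lambda>p. S p (h p)) (\<lambda>p. S p (\<lambda>x. h1 p x + - 1 * (pot1 p x * S p (h p) x)))
       (\<lambda>p. S p (\<lambda>x. h2 p x + - 1 * (pot2 p x * S p (h p) x)))"
    by (rule c2_deriv_imp_deriv[OF S_deriv2[OF sol.hyps h]])
  moreover have "expr (\<lambda>p. S p (\<lambda>x. h1 p x + - 1 * (pot1 p x * S p (h p) x)))"
    by (rule expr.sol[OF expr.add[OF h(1) expr.mult[OF expr.const expr.mult[OF expr_pot12(1) expr.sol[OF sol.hyps]]]]])
  moreover have "expr (\<lambda>p. S p (\<lambda>x. h2 p x + - 1 * (pot2 p x * S p (h p) x)))"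
    by (rule expr.sol[OF expr.add[OF h(2) expr.mult[OF expr.const expr.mult[OF expr_pot12(2) expr.sol[OF sol.hyps]]]]])
  ultimately show ?case by blast
qed

text \<open>The statement is confined to \<psi> and values of \<open>S\<close>, for which the
  equation upgrades sup estimates to C^2 estimates. Their partial derivatives are again values of
  \<open>S\<close>, so the induction stays within this class.\<close>

lemma h2_Ck_solution:
  assumes "open U" and "y = \<psi> \<or> (\<exists>h. expr h \<and> y = (\<lambda>p. S p (h p)))"
  shows "h2_Ck L k U y"
  using assms(2)
proof (induction k arbitrary: y)
  case 0
  have ey: "expr y" using 0 by (auto intro: expr.psi expr.sol)
  have lip: "\<exists>K\<ge>0. \<forall>p\<in>U. \<forall>q\<in>U. c2_bound (\<lambda>x. y q x - y p x) (K * norm (q - p))"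
    using 0
  proof
    assume "y = \<psi>"
    then show ?thesis using psi_lip2 by simp
  next
    assume "\<exists>h. expr h \<and> y = (\<lambda>p. S p (h p))"
    then obtain h where h: "expr h" "y = (\<lambda>p. S p (h p))" by blast
    show ?thesis unfolding h(2) by (rule S_lip2[OF expr_ep[OF h(1)] expr_lip[OF h(1)]])
  qed
  then obtain K where K: "\<And>p q. p \<in> U \<Longrightarrow> q \<in> U \<Longrightarrow> c2_bound (\<lambda>x. y q x - y p x) (K * norm (q - p))" by blast
  have "H2pe L (y p)" if p: "p \<in> U" for p
  proof -
    have "\<exists>z. second_deriv (y p) z \<and> even_periodic L z"
      using 0
    proof
      assume "y = \<psi>"
      moreover have "even_periodic L (\<lambda>x. fst p * \<psi> p x - \<psi> p x * ln ((\<psi> p x)\<^sup>2) + snd p)"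
        using ep_psi p psi_nonzero by (intro even_periodic_intros)
      ultimately show ?thesis using sd_psi[OF p] by blast
    next
      assume "\<exists>h. expr h \<and> y = (\<lambda>p. S p (h p))"
      then obtain h where h: "expr h" "y = (\<lambda>p. S p (h p))" by blast
      have "even_periodic L (\<lambda>x. pot p x * S p (h p) x - h p x)"
        by (intro even_periodic_intros ep_pot p S(1) expr_ep[OF h(1)])
      then show ?thesis using S(2)[OF p expr_ep[OF h(1) p]] h(2) by blast
    qed
    then show ?thesis using H2pe_second_deriv[OF L expr_ep[OF ey p]] by (auto simp: even_periodic_def)
  qed
  moreover have "((\<lambda>q. h2norm L (\<lambda>x. y q x - y p x)) \<longlongrightarrow> 0) (at p)" if p: "p \<in> U" for p
  proof (rule Lim_null_comparison)
    have "\<forall>\<^sub>F q in at p. q \<in> U" using assms(1) p by (rule eventually_at_in_open')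
    then show "\<forall>\<^sub>F q in at p. norm (h2norm L (\<lambda>x. y q x - y p x)) \<le> sqrt (L * (2 + L\<^sup>2)) * (K * norm (q - p))"
    proof eventually_elim
      case (elim q)
      then show ?case
        using h2norm_c2_bound[OF L even_periodic_diff K] expr_ep[OF ey] p by (auto simp: h2norm_nonneg)
    qed
    have "((\<lambda>q. sqrt (L * (2 + L\<^sup>2)) * (K * norm (q - p))) \<longlongrightarrow> sqrt (L * (2 + L\<^sup>2)) * (K * norm (p - p))) (at p)"
      by (intro tendsto_intros)
    then show "((\<lambda>q. sqrt (L * (2 + L\<^sup>2)) * (K * norm (q - p))) \<longlongrightarrow> 0) (at p)" by simp
  qed
  ultimately show ?case by simp
next
  case (Suc k)
  have ey: "expr y" using Suc.prems by (auto intro: expr.psi expr.sol)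
  have "\<exists>s1 s2. expr s1 \<and> expr s2 \<and> (\<exists>K\<ge>0. \<forall>p\<in>U. \<forall>q\<in>U.
     c2_bound (\<lambda>x. y q x - y p x - fst (q - p) * S p (s1 p) x - snd (q - p) * S p (s2 p) x) (K * (norm (q - p))\<^sup>2))"
    using Suc.prems
  proof
    assume "y = \<psi>"
    moreover have "expr (\<lambda>p x. - 1 * \<psi> p x)" "expr (\<lambda>p x. - 1)"
      by (rule expr.mult[OF expr.const expr.psi], rule expr.const)
    ultimately show ?thesis
      using psi_deriv2 unfolding psi1_def psi2_def
      by (intro exI[of _ "\<lambda>p x. - 1 * \<psi> p x"] exI[of _ "\<lambda>p x. - 1"] conjI) simp_all
  next
    assume "\<exists>h. expr h \<and> y = (\<lambda>p. S p (h p))"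
    then obtain h where h: "expr h" "y = (\<lambda>p. S p (h p))" by blast
    obtain h1 h2 where h12: "expr h1" "expr h2" "fam_deriv U h h1 h2" using expr_deriv[OF h(1)] by blast
    have "expr (\<lambda>p x. h1 p x + - 1 * (pot1 p x * y p x))" "expr (\<lambda>p x. h2 p x + - 1 * (pot2 p x * y p x))"
      by (intro expr.add expr.mult expr.const h12 expr_pot12 ey)+
    then show ?thesis using S_deriv2[OF h(1) h12] unfolding h(2) by blast
  qed
  then obtain s1 s2 K where s: "expr s1" "expr s2" and K: "\<And>p q. p \<in> U \<Longrightarrow> q \<in> U \<Longrightarrow>
     c2_bound (\<lambda>x. y q x - y p x - fst (q - p) * S p (s1 p) x - snd (q - p) * S p (s2 p) x) (K * (norm (q - p))\<^sup>2)"
    by blast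
  have "((\<lambda>q. h2norm L (\<lambda>x. y q x - y p x - fst (q - p) * S p (s1 p) x - snd (q - p) * S p (s2 p) x)
      / norm (q - p)) \<longlongrightarrow> 0) (at p)" if p: "p \<in> U" for p
  proof (rule Lim_null_comparison)
    have "\<forall>\<^sub>F q in at p. q \<in> U" using assms(1) p by (rule eventually_at_in_open')
    moreover have "\<forall>\<^sub>F q in at p. q \<noteq> p" by (simp add: eventually_at_filter)
    ultimately show "\<forall>\<^sub>F q in at p. norm (h2norm L (\<lambda>x. y q x - y p x - fst (q - p) * S p (s1 p) x - snd (q - p) * S p (s2 p) x)
      / norm (q - p)) \<le> sqrt (L * (2 + L\<^sup>2)) * (K * norm (q - p))"
    proof eventually_elim
      case (elim q)
      let ?r = "\<lambda>x. y q x - y p x - fst (q - p) * S p (s1 p) x - snd (q - p) * S p (s2 p) x"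
      have "even_periodic L ?r"
        using expr_ep[OF ey] expr_ep[OF expr.sol[OF s(1)]] expr_ep[OF expr.sol[OF s(2)]] p elim(1)
        by (intro even_periodic_intros)
      then have "h2norm L ?r \<le> sqrt (L * (2 + L\<^sup>2)) * (K * (norm (q - p))\<^sup>2)"
        by (rule h2norm_c2_bound[OF L _ K[OF p elim(1)]])
      then have "h2norm L ?r / norm (q - p) \<le> sqrt (L * (2 + L\<^sup>2)) * (K * (norm (q - p))\<^sup>2) / norm (q - p)"
        by (rule divide_right_mono) simp
      also have "\<dots> = sqrt (L * (2 + L\<^sup>2)) * (K * norm (q - p))"
        using elim(2) by (simp add: power2_eq_square)
      finally show ?case by (simp add: h2norm_nonneg)
    qed
    have "((\<lambda>q. sqrt (L * (2 + L\<^sup>2)) * (K * norm (q - p))) \<longlongrightarrow> sqrt (L * (2 + L\<^sup>2)) * (K * norm (p - p))) (at p)"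
      by (intro tendsto_intros)
    then show "((\<lambda>q. sqrt (L * (2 + L\<^sup>2)) * (K * norm (q - p))) \<longlongrightarrow> 0) (at p)" by simp
  qed
  moreover have "h2_Ck L k U (\<lambda>p. S p (s1 p))" "h2_Ck L k U (\<lambda>p. S p (s2 p))"
    using s by (auto intro!: Suc.IH)
  \<comment> \<open>The induction hypothesis at \<open>y\<close> itself gives order
    \<open>k\<close>, and every order contains order 0.\<close>
  moreover have "h2_Ck L 0 U y"
    using Suc.IH[OF Suc.prems] by (cases k) auto
  ultimately show ?case
    unfolding h2_Ck.simps(2)
    by (intro conjI exI[of _ "\<lambda>p. S p (s1 p)"] exI[of _ "\<lambda>p. S p (s2 p)"]) auto
qed

end

section \<open>Existence of the family\<close>

text \<open>For \<psi> = \<phi> + w the equation is w'' = Q w - N w, where N collects the Taylor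
  remainder and the change of parameters. Its Lipschitz constant is at most 16 \<rho>/m from the
  remainder, 4 \<rho>/m from moving the expansion point, and 1/(4 C) from the change of \<omega>.
  Requiring 20 \<rho>/m to be at most 1/(4 C) explains the 80.\<close>

lemma nonlinear_perturbation_exists:
  fixes \<omega>0 A0 :: real
  assumes ep: "even_periodic L \<phi>" and gb: "green_bound L (\<lambda>x. \<omega>0 - 2 - ln ((\<phi> x)\<^sup>2)) C"
    and sd: "second_deriv \<phi> (\<lambda>x. \<omega>0 * \<phi> x - \<phi> x * ln ((\<phi> x)\<^sup>2) + A0)"
    and m: "0 < m" "\<And>x. 2 * m \<le> \<bar>\<phi> x\<bar>" and \<Phi>: "\<And>x. \<bar>\<phi> x\<bar> \<le> \<Phi>"
    and \<rho>: "0 < \<rho>" "\<rho> \<le> m / 4" "80 * C * \<rho> \<le> m"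
    and p: "4 * C * norm (p - (\<omega>0, A0)) \<le> 1" "2 * C * (\<Phi> + 1) * norm (p - (\<omega>0, A0)) \<le> \<rho>"
  shows "\<exists>\<psi>. even_periodic L \<psi> \<and> (\<forall>x. \<bar>\<psi> x - \<phi> x\<bar> \<le> \<rho>) \<and>
     second_deriv \<psi> (\<lambda>x. fst p * \<psi> x - \<psi> x * ln ((\<psi> x)\<^sup>2) + snd p)"
proof -
  have C: "0 < C" using gb by (simp add: green_bound_def)
  define a where "a = fst (p - (\<omega>0, A0))"
  define b where "b = snd (p - (\<omega>0, A0))"
  define Q where "Q x = \<omega>0 - 2 - ln ((\<phi> x)\<^sup>2)" for x
  define N where "N w x = ((\<phi> x + w x) * ln ((\<phi> x + w x)\<^sup>2) - \<phi> x * ln ((\<phi> x)\<^sup>2)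
      - (2 + ln ((\<phi> x)\<^sup>2)) * w x) - a * (\<phi> x + w x) - b" for w x
  have nz: "\<phi> x \<noteq> 0" for x using m(1) m(2)[of x] by auto
  have low: "m \<le> \<bar>\<phi> x + w\<bar>" if "\<bar>w\<bar> \<le> \<rho>" for w x
    using m(1) m(2)[of x] \<rho>(2) that by linarith
  have "\<exists>y. even_periodic L y \<and> (\<forall>x. \<bar>y x\<bar> \<le> \<rho>) \<and> second_deriv y (\<lambda>x. Q x * y x - N y x)"
  proof (rule green_contraction[OF gb[folded Q_def]])
    show "even_periodic L (N y)" if y: "even_periodic L y" "\<And>x. \<bar>y x\<bar> \<le> \<rho>" for y
    proof -
      have "\<phi> x + y x \<noteq> 0" for x using low[OF y(2), of x x] m(1) by auto
      then show ?thesis unfolding N_def[abs_def] using ep y nz by (intro even_periodic_intros)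
    qed
    show "\<bar>N y x - N z x\<bar> \<le> M / (2 * C)"
      if y: "\<And>x. \<bar>y x\<bar> \<le> \<rho>" and z: "\<And>x. \<bar>z x\<bar> \<le> \<rho>" and M: "\<And>x. \<bar>y x - z x\<bar> \<le> M" for y z M x
    proof -
      have M0: "0 \<le> M" using M[of x] by linarith
      \<comment> \<open>Taylor's formula is used around \<open>t\<close>, not around \<phi>; the
        price is the term with \<open>ln (t\<^sup>2) - ln ((\<phi> x)\<^sup>2)\<close>.\<close>
      define s where "s = \<phi> x + y x"
      define t where "t = \<phi> x + z x"
      have st: "s - t = y x - z x" by (simp add: s_def t_def)
      have "\<bar>s - t\<bar> \<le> m / 2" using y[of x] z[of x] \<rho>(2) st by linarith
      then have "\<bar>s * ln (s\<^sup>2) - t * ln (t\<^sup>2) - (2 + ln (t\<^sup>2)) * (s - t)\<bar> \<le> 8 / m * (s - t)\<^sup>2"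
        using xlnx_taylor[OF m(1), of t s] low[OF z, of x x] by (simp add: t_def)
      also have "8 / m * (s - t)\<^sup>2 \<le> 8 / m * (2 * \<rho> * M)"
      proof (rule mult_left_mono)
        have "(s - t)\<^sup>2 = \<bar>s - t\<bar> * \<bar>s - t\<bar>" by (simp only: abs_mult_self_eq power2_eq_square)
        also have "\<dots> \<le> (2 * \<rho>) * M"
          using y[of x] z[of x] M[of x] st \<rho>(1) by (intro mult_mono) auto
        finally show "(s - t)\<^sup>2 \<le> 2 * \<rho> * M" .
      qed (use m in auto)
      finally have e1: "\<bar>s * ln (s\<^sup>2) - t * ln (t\<^sup>2) - (2 + ln (t\<^sup>2)) * (s - t)\<bar> \<le> 16 * (\<rho> / m) * M"
        by (simp add: algebra_simps)
      have "\<bar>ln (t\<^sup>2) - ln ((\<phi> x)\<^sup>2)\<bar> \<le> 4 / m * \<bar>t - \<phi> x\<bar>"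
        by (rule ln_square_lipschitz) (use m(1) m(2)[of x] z[of x] \<rho>(2) in \<open>auto simp: t_def\<close>)
      also have "\<dots> \<le> 4 / m * \<rho>" using m z[of x] by (intro mult_left_mono) (auto simp: t_def)
      finally have "\<bar>(ln (t\<^sup>2) - ln ((\<phi> x)\<^sup>2)) * (s - t)\<bar> \<le> (4 / m * \<rho>) * M"
        unfolding abs_mult using M[of x] st m \<rho> by (intro mult_mono) auto
      then have e2: "\<bar>(ln (t\<^sup>2) - ln ((\<phi> x)\<^sup>2)) * (s - t)\<bar> \<le> 4 * (\<rho> / m) * M" by simp
      have "\<bar>a\<bar> \<le> 1 / (4 * C)"
      proof -
        have "\<bar>a\<bar> \<le> norm (p - (\<omega>0, A0))" unfolding a_def by (rule abs_components_le_norm)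
        also have "\<dots> \<le> 1 / (4 * C)" using p(1) C by (simp add: field_simps)
        finally show ?thesis .
      qed
      then have e3: "\<bar>a * (s - t)\<bar> \<le> 1 / (4 * C) * M"
        unfolding abs_mult using M[of x] st C by (intro mult_mono) auto
      have "\<rho> / m \<le> 1 / (80 * C)" using \<rho>(3) C m by (simp add: field_simps)
      then have "20 * (\<rho> / m) * M \<le> 20 * (1 / (80 * C)) * M" using M0 by (intro mult_right_mono) auto
      then have e4: "20 * (\<rho> / m) * M \<le> 1 / (4 * C) * M" by simp
      have "N y x - N z x = (s * ln (s\<^sup>2) - t * ln (t\<^sup>2) - (2 + ln (t\<^sup>2)) * (s - t))
          + (ln (t\<^sup>2) - ln ((\<phi> x)\<^sup>2)) * (s - t) - a * (s - t)"
        unfolding N_def s_def t_def by (simp add: algebra_simps)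
      then have "\<bar>N y x - N z x\<bar> \<le> 1 / (4 * C) * M + 1 / (4 * C) * M" using e1 e2 e3 e4 by linarith
      then show ?thesis by simp
    qed
    show "\<bar>N (\<lambda>x. 0) x\<bar> \<le> \<rho> / (2 * C)" for x
    proof -
      have "\<bar>a * \<phi> x + b * 1\<bar> \<le> (\<Phi> + 1) * norm (p - (\<omega>0, A0))"
        unfolding a_def b_def by (rule linear_part_bound) (use \<Phi> in auto)
      also have "\<dots> \<le> \<rho> / (2 * C)" using p(2) C by (simp add: field_simps)
      finally show ?thesis unfolding N_def by (simp add: abs_le_iff)
    qed
  qed (use \<rho> in auto)
  then obtain y where y: "even_periodic L y" "\<And>x. \<bar>y x\<bar> \<le> \<rho>" "second_deriv y (\<lambda>x. Q x * y x - N y x)" by blast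
  have "second_deriv (\<lambda>x. \<phi> x + y x)
      (\<lambda>x. fst p * (\<phi> x + y x) - (\<phi> x + y x) * ln ((\<phi> x + y x)\<^sup>2) + snd p)"
    by (rule second_deriv_cong[OF second_deriv_add[OF sd y(3)]])
      (simp add: Q_def N_def a_def b_def algebra_simps)
  then show ?thesis using y ep by (intro exI[of _ "\<lambda>x. \<phi> x + y x"]) (auto intro: even_periodic_add)
qed

lemma smooth_family_exists:
  fixes \<omega>0 A0 :: real
  assumes L: "0 < L" and ep: "even_periodic L \<phi>" and nz: "\<And>x. \<phi> x \<noteq> 0"
    and gb: "green_bound L (\<lambda>x. \<omega>0 - 2 - ln ((\<phi> x)\<^sup>2)) C"
    and sd: "second_deriv \<phi> (\<lambda>x. \<omega>0 * \<phi> x - \<phi> x * ln ((\<phi> x)\<^sup>2) + A0)"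
  shows "\<exists>U \<Psi>. open U \<and> (\<omega>0, A0) \<in> U \<and> (\<forall>p\<in>U. H2pe L (\<Psi> p) \<and> solves (fst p) (snd p) (\<Psi> p)) \<and>
     h2_smooth L U \<Psi> \<and> \<Psi> (\<omega>0, A0) = \<phi>"
proof -
  have C: "0 < C" using gb by (simp add: green_bound_def)
  have "even_periodic L (\<lambda>x. \<bar>\<phi> x\<bar>)" using ep by (auto simp: even_periodic_def intro: continuous_intros)
  then obtain x0 where x0: "\<And>x. \<bar>\<phi> x0\<bar> \<le> \<bar>\<phi> x\<bar>" using even_periodic_attains_inf[OF L] by blast
  \<comment> \<open>Half the minimum of \<open>\<bar>\<phi>\<bar>\<close>, so that solutions within
    \<open>\<rho>\<close> of \<phi> still have modulus at least \<open>m\<close>.\<close>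
  define m where "m = \<bar>\<phi> x0\<bar> / 2"
  have m: "0 < m" "\<And>x. 2 * m \<le> \<bar>\<phi> x\<bar>" using nz x0 by (auto simp: m_def)
  obtain \<Phi> where \<Phi>: "\<Phi> > 0" "\<And>x. \<bar>\<phi> x\<bar> \<le> \<Phi>" using even_periodic_bounded[OF L ep] by blast
  define \<rho> where "\<rho> = min (m / 4) (m / (80 * C))"
  have \<rho>: "0 < \<rho>" "\<rho> \<le> m / 4" using m C by (auto simp: \<rho>_def)
  have \<rho>C: "80 * C * \<rho> \<le> m"
  proof -
    have "\<rho> \<le> m / (80 * C)" by (simp add: \<rho>_def)
    then show ?thesis using C by (simp add: field_simps)
  qed
  define \<eta> where "\<eta> = min (1 / (4 * C)) (\<rho> / (2 * C * (\<Phi> + 1)))"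
  have \<eta>: "0 < \<eta>" using C \<rho> \<Phi> by (auto simp: \<eta>_def)
  define p0 where "p0 = (\<omega>0, A0)"
  define U where "U = ball p0 \<eta>"
  have near: "4 * C * norm (p - p0) \<le> 1" "2 * C * (\<Phi> + 1) * norm (p - p0) \<le> \<rho>" if "p \<in> U" for p
  proof -
    have "norm (p - p0) \<le> \<eta>" using that by (simp add: U_def dist_norm norm_minus_commute)
    then have "norm (p - p0) \<le> 1 / (4 * C)" "norm (p - p0) \<le> \<rho> / (2 * C * (\<Phi> + 1))"
      by (auto simp: \<eta>_def)
    then show "4 * C * norm (p - p0) \<le> 1" "2 * C * (\<Phi> + 1) * norm (p - p0) \<le> \<rho>"
      using C \<Phi>(1) by (simp_all add: pos_le_divide_eq mult.commute mult.left_commute)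
  qed
  define good where "good p \<psi> \<longleftrightarrow> even_periodic L \<psi> \<and> (\<forall>x. \<bar>\<psi> x - \<phi> x\<bar> \<le> \<rho>) \<and>
     second_deriv \<psi> (\<lambda>x. fst p * \<psi> x - \<psi> x * ln ((\<psi> x)\<^sup>2) + snd p)" for p :: "real \<times> real" and \<psi>
  \<comment> \<open>At \<open>p0\<close> the value is prescribed, so the family passes exactly
    through \<phi>; at other parameters any solution within \<open>\<rho>\<close> of \<phi> may be
    chosen.\<close>
  have "\<exists>\<psi>. good p \<psi> \<and> (p = p0 \<longrightarrow> \<psi> = \<phi>)" if p: "p \<in> U" for p
  proof (cases "p = p0")
    case True
    then show ?thesis using ep sd \<rho>(1) by (intro exI[of _ \<phi>]) (auto simp: good_def p0_def)
  next
    case False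
    then show ?thesis
      using nonlinear_perturbation_exists[OF ep gb sd m \<Phi>(2) \<rho> \<rho>C near[OF p, unfolded p0_def]]
      by (auto simp: good_def)
  qed
  then obtain \<Psi> where \<Psi>: "\<And>p. p \<in> U \<Longrightarrow> good p (\<Psi> p)" "\<And>p. p \<in> U \<Longrightarrow> p = p0 \<Longrightarrow> \<Psi> p = \<phi>" by metis
  have close: "\<bar>\<Psi> p x - \<phi> x\<bar> \<le> \<rho>" if "p \<in> U" for p x using \<Psi>(1)[OF that] by (simp add: good_def)
  have low: "m \<le> \<bar>\<Psi> p x\<bar>" if "p \<in> U" for p x
    using m(1) m(2)[of x] \<rho>(2) close[OF that, of x] by linarith
  \<comment> \<open>Perturbing the potential doubles the Green constant, and two members within
    \<open>\<rho>\<close> of \<phi> are \<open>2 * \<rho>\<close> apart. The smallness condition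
    becomes 32 C \<rho>/m at most 1/2, which 80 C \<rho> at most m ensures.\<close>
  interpret solution_family L "2 * C" m "2 * \<rho>" "norm p0 + \<eta>" U \<Psi>
  proof
    show "norm p \<le> norm p0 + \<eta>" if "p \<in> U" for p
      using that norm_triangle_ineq2[of p p0] by (simp add: U_def dist_norm norm_minus_commute)
    show "green_bound L (\<lambda>x. fst p - 2 - ln ((\<Psi> p x)\<^sup>2)) (2 * C)" if p: "p \<in> U" for p
    proof (rule green_bound_perturb[OF L gb])
      have "\<Psi> p x \<noteq> 0" for x using low[OF p, of x] m(1) by auto
      then show "even_periodic L (\<lambda>x. fst p - 2 - ln ((\<Psi> p x)\<^sup>2))"
        using \<Psi>(1)[OF p] by (intro even_periodic_intros) (auto simp: good_def)
      show "even_periodic L (\<lambda>x. \<omega>0 - 2 - ln ((\<phi> x)\<^sup>2))" using ep nz by (intro even_periodic_intros)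
      show "\<bar>(\<omega>0 - 2 - ln ((\<phi> x)\<^sup>2)) - (fst p - 2 - ln ((\<Psi> p x)\<^sup>2))\<bar> \<le> 1 / (2 * C)" for x
      proof -
        have "\<bar>ln ((\<Psi> p x)\<^sup>2) - ln ((\<phi> x)\<^sup>2)\<bar> \<le> 4 / m * \<bar>\<Psi> p x - \<phi> x\<bar>"
          by (rule ln_square_lipschitz) (use m(1) m(2)[of x] close[OF p, of x] \<rho>(2) in auto)
        also have "\<dots> \<le> 4 / m * \<rho>" using m close[OF p] by (intro mult_left_mono) auto
        also have "\<dots> \<le> 1 / (20 * C)" using \<rho>C C m by (simp add: field_simps)
        also have "\<dots> \<le> 1 / (4 * C)" using C by (simp add: field_simps)
        finally have "\<bar>ln ((\<Psi> p x)\<^sup>2) - ln ((\<phi> x)\<^sup>2)\<bar> \<le> 1 / (4 * C)" .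
        moreover have "\<bar>fst p - \<omega>0\<bar> \<le> 1 / (4 * C)"
        proof -
          have "\<bar>fst p - \<omega>0\<bar> \<le> norm (p - p0)" using abs_components_le_norm(1)[of "p - p0"] by (simp add: p0_def)
          also have "\<dots> \<le> 1 / (4 * C)" using near(1)[OF p] C by (simp add: field_simps)
          finally show ?thesis .
        qed
        moreover have "1 / (2 * C) = 1 / (4 * C) + 1 / (4 * C)" by simp
        ultimately show ?thesis by linarith
      qed
    qed
    show "\<bar>\<Psi> q x - \<Psi> p x\<bar> \<le> 2 * \<rho>" if "p \<in> U" "q \<in> U" for p q x
      using close[OF that(1), of x] close[OF that(2), of x] by linarith
    have "2 * C * (8 / m * (2 * \<rho>)) = 32 * (C * \<rho>) / m" by simp
    also have "\<dots> \<le> 1 / 2" using \<rho>C m(1) \<rho>(1) C by (simp add: field_simps)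
    finally show "2 * C * (8 / m * (2 * \<rho>)) \<le> 1 / 2" .
  qed (use L m \<rho> \<Psi>(1) low in \<open>auto simp: good_def\<close>)
  have "open U" "p0 \<in> U" using \<eta> by (auto simp: U_def)
  moreover have smooth: "h2_Ck L k U \<Psi>" for k by (rule h2_Ck_solution[OF \<open>open U\<close>]) simp
  moreover have "H2pe L (\<Psi> p)" "solves (fst p) (snd p) (\<Psi> p)" if "p \<in> U" for p
    using smooth[of 0] that second_deriv_solves[OF sd_psi[OF that]] by auto
  ultimately show ?thesis
    using \<Psi>(2) unfolding h2_smooth_def p0_def[symmetric] by blast
qed

section \<open>Location of the equilibrium and reduction to positive solutions\<close>

lemma g_minus: "g \<omega> A (- s) = - g \<omega> (- A) s"
  by (simp add: g_def)

lemma smallest_zero_minus: "smallest_zero \<omega> A r \<Longrightarrow> largest_zero \<omega> (- A) (- r)"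
  unfolding smallest_zero_def largest_zero_def by (metis g_minus minus_le_iff minus_minus neg_0_equal_iff_equal)

text \<open>On \<open>P1\<close> the function g is positive at \<open>s0\<close>, where it equals
  \<open>2 * s0 + A\<close>, and it is nonpositive further out, so some zero lies beyond
  \<open>s0\<close>.\<close>

lemma largest_zero_gt:
  assumes P1: "(\<omega>, A) \<in> P1" and r: "largest_zero \<omega> A r"
  shows "exp (\<omega> / 2 - 1) < r"
proof -
  define s0 where "s0 = exp (\<omega> / 2 - 1)"
  \<comment> \<open>With this \<open>k\<close> one has \<open>k * s1 \<ge> \<bar>A\<bar>\<close>, so
    \<open>A - 2 * k * s1\<close>, the value of g at \<open>s1\<close>, cannot be positive.\<close>
  define k where "k = \<bar>A\<bar> / exp (\<omega> / 2)"
  define s1 where "s1 = exp (\<omega> / 2 + k)"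
  have k: "0 \<le> k" by (simp add: k_def)
  have "g \<omega> A s0 = 2 * s0 + A" by (simp add: g_def s0_def ln_realpow algebra_simps)
  then have g0: "0 < g \<omega> A s0" using P1 by (simp add: P1_def s0_def abs_less_iff)
  have "g \<omega> A s1 = A - 2 * k * s1" by (simp add: g_def s1_def ln_realpow algebra_simps)
  moreover have "k * exp (\<omega> / 2) \<le> k * s1" using k by (intro mult_left_mono) (auto simp: s1_def)
  moreover have "k * exp (\<omega> / 2) = \<bar>A\<bar>" by (simp add: k_def)
  ultimately have g1: "g \<omega> A s1 \<le> 0" by linarith
  have le: "s0 \<le> s1" using k by (simp add: s0_def s1_def)
  have "continuous_on {s0..s1} (g \<omega> A)"
    unfolding g_def[abs_def] by (intro continuous_intros) (auto simp: s0_def)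
  from IVT2'[OF g1 _ le this] g0 obtain s where s: "s0 \<le> s" "g \<omega> A s = 0" by auto
  with g0 have "s0 < s" by (cases "s = s0") auto
  then show ?thesis using r s(2) unfolding largest_zero_def s0_def by force
qed

text \<open>Up to the maximum point \<open>\<omega> - 2 * ln r\<close> is at least 2, so g exceeds
  \<open>A\<close> and has no zero there.\<close>

lemma positive_zero_gt:
  assumes "0 < A" "0 < r" "g \<omega> A r = 0"
  shows "exp (\<omega> / 2 - 1) < r"
proof (rule ccontr)
  assume "\<not> exp (\<omega> / 2 - 1) < r"
  then have "ln r \<le> \<omega> / 2 - 1" using assms(2) by (metis ln_exp ln_le_cancel_iff exp_gt_zero not_less)
  then have "0 \<le> r * (\<omega> - 2 * ln r)" using assms(2) by (intro mult_nonneg_nonneg) auto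
  moreover have "g \<omega> A r = r * (\<omega> - 2 * ln r) + A" using assms(2) by (simp add: g_def ln_realpow algebra_simps)
  ultimately show False using assms(1,3) by linarith
qed

text \<open>The reflection \<open>\<phi> \<mapsto> - \<phi>\<close>, \<open>A \<mapsto> - A\<close> reduces all cases to positive solutions around the
  right-hand equilibrium.\<close>

lemma admissible_signed:
  assumes "admissible \<omega> A \<delta> \<phi>"
  obtains \<sigma> r :: real where "\<sigma> = 1 \<or> \<sigma> = - 1" "\<And>x. 0 < \<sigma> * \<phi> x" "g \<omega> (\<sigma> * A) r = 0"
    "exp (\<omega> / 2 - 1) < r" "\<exists>x. \<sigma> * \<phi> x < r" "\<exists>x. r < \<sigma> * \<phi> x"
proof -
  have P1_minus: "(\<omega>, - A) \<in> P1" if "(\<omega>, A) \<in> P1" using that by (simp add: P1_def)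
  \<comment> \<open>In cases a and b, coming from \<open>P1\<close>, \<open>largest_zero_gt\<close>
    places the equilibrium after reflection if necessary. In c and d, coming from \<open>P3\<close>,
    \<open>A\<close> has the sign of \<phi> and \<open>positive_zero_gt\<close> does it.\<close>
  consider (a) r where "(\<omega>, A) \<in> P1" "\<forall>x. 0 < \<phi> x" "largest_zero \<omega> A r" "turns_around \<phi> r"
    | (b) r where "(\<omega>, A) \<in> P1" "\<forall>x. \<phi> x < 0" "smallest_zero \<omega> A r" "turns_around \<phi> r"
    | (c) r where "A < 0" "\<forall>x. \<phi> x < 0" "largest_zero \<omega> A r" "turns_around \<phi> r"
    | (d) r where "0 < A" "\<forall>x. 0 < \<phi> x" "largest_zero \<omega> A r" "turns_around \<phi> r"
    using assms unfolding admissible_def by blast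
  then show ?thesis
  proof cases
    case a
    then show ?thesis
      using largest_zero_gt by (intro that[of 1 r]) (auto simp: turns_around_def largest_zero_def)
  next
    case b
    have "largest_zero \<omega> (- A) (- r)" by (rule smallest_zero_minus[OF b(3)])
    then show ?thesis
      using b largest_zero_gt[OF P1_minus[OF b(1)]]
      by (intro that[of "- 1" "- r"]) (auto simp: turns_around_def largest_zero_def)
  next
    case c
    have "r < 0" using c(2,4) by (auto simp: turns_around_def intro: less_trans)
    moreover have "g \<omega> (- A) (- r) = 0" using c(3) g_minus[of \<omega> "- A" r] by (simp add: largest_zero_def)
    ultimately show ?thesis
      using c positive_zero_gt[of "- A" "- r" \<omega>]
      by (intro that[of "- 1" "- r"]) (auto simp: turns_around_def)
  next
    case d
    have "0 < r" using d(2,4) by (auto simp: turns_around_def intro: less_trans)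
    then show ?thesis
      using d positive_zero_gt[of A r \<omega>]
      by (intro that[of 1 r]) (auto simp: turns_around_def largest_zero_def)
  qed
qed

theorem theorem4p6:
  fixes \<omega>0 A0 :: real
  assumes "(\<omega>0, A0) \<in> P1 \<union> P3"
  shows "\<exists>\<delta>>0. \<forall>(\<phi> :: real \<Rightarrow> real) L0.
           admissible \<omega>0 A0 \<delta> \<phi> \<and> minimal_period L0 \<phi> \<and> H2pe L0 \<phi> \<and> solves \<omega>0 A0 \<phi> \<longrightarrow>
           (\<exists>U (\<Psi> :: real \<times> real \<Rightarrow> real \<Rightarrow> real).
              open U \<and> (\<omega>0, A0) \<in> U \<and>
              (\<forall>p\<in>U. H2pe L0 (\<Psi> p) \<and> solves (fst p) (snd p) (\<Psi> p)) \<and>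
              h2_smooth L0 U \<Psi> \<and>
              \<Psi> (\<omega>0, A0) = \<phi>)"
proof (intro exI[of _ 1] conjI allI impI, simp, elim conjE)
  fix \<phi> :: "real \<Rightarrow> real" and L0
  assume adm: "admissible \<omega>0 A0 1 \<phi>" and H: "H2pe L0 \<phi>" and sol: "solves \<omega>0 A0 \<phi>"
  obtain \<sigma> r :: real where \<sigma>: "\<sigma> = 1 \<or> \<sigma> = - 1" "\<And>x. 0 < \<sigma> * \<phi> x"
    and r: "g \<omega>0 (\<sigma> * A0) r = 0" "exp (\<omega>0 / 2 - 1) < r" "\<exists>x. \<sigma> * \<phi> x < r" "\<exists>x. r < \<sigma> * \<phi> x"
    using admissible_signed[OF adm] by metis
  have L: "0 < L0" using H by (simp add: H2pe_def)
  have nz: "\<phi> x \<noteq> 0" for x using \<sigma>(2)[of x] by auto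
  note sd = solves_second_deriv[OF H sol nz]
  have r0: "0 < r" using r(2) by (meson exp_gt_zero less_trans)
  have ln_sq: "ln ((\<phi> x)\<^sup>2) = 2 * ln (\<sigma> * \<phi> x)" for x
  proof -
    have "(\<phi> x)\<^sup>2 = (\<sigma> * \<phi> x)\<^sup>2" using \<sigma>(1) by auto
    then show ?thesis using ln_realpow[of "\<sigma> * \<phi> x" 2] by simp
  qed
  interpret lp: log_potential \<omega>0 "\<sigma> * A0" r
    using r r0 by unfold_locales (auto simp: g_def ln_realpow)
  \<comment> \<open>s ln s^2 is odd, so \<sigma> \<phi> is a positive solution of the equation in
    which A is replaced by \<sigma> A.\<close>
  interpret positive_orbit \<omega>0 "\<sigma> * A0" r L0 "\<lambda>x. \<sigma> * \<phi> x" "\<lambda>x. \<sigma> * deriv \<phi> x"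
  proof
    show "even_periodic L0 (\<lambda>x. \<sigma> * \<phi> x)" by (intro even_periodic_intros sd(1))
    show "((\<lambda>x. \<sigma> * \<phi> x) has_real_derivative \<sigma> * deriv \<phi> x) (at x)" for x
      by (rule DERIV_cmult[OF second_deriv_unfold(1)[OF sd(2)]])
    have "((\<lambda>x. \<sigma> * deriv \<phi> x) has_real_derivative \<sigma> * (\<omega>0 * \<phi> x - \<phi> x * ln ((\<phi> x)\<^sup>2) + A0)) (at x)" for x
      by (rule DERIV_cmult[OF second_deriv_unfold(2)[OF sd(2)]])
    moreover have "\<sigma> * (\<omega>0 * \<phi> x - \<phi> x * ln ((\<phi> x)\<^sup>2) + A0) = lp.g0 (\<sigma> * \<phi> x)" for x
      unfolding ln_sq lp.g0_def by (simp add: algebra_simps)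
    ultimately show "((\<lambda>x. \<sigma> * deriv \<phi> x) has_real_derivative lp.g0 (\<sigma> * \<phi> x)) (at x)" for x by simp
  qed (use L \<sigma>(2) r in auto)
  \<comment> \<open>The linearised potential sees only \<phi>^2, so the Green bound obtained for
    \<sigma> \<phi> is one for \<phi>.\<close>
  have "(\<lambda>x. lp.g1 (\<sigma> * \<phi> x)) = (\<lambda>x. \<omega>0 - 2 - ln ((\<phi> x)\<^sup>2))"
    by (simp add: lp.g1_def ln_sq)
  then obtain C where "green_bound L0 (\<lambda>x. \<omega>0 - 2 - ln ((\<phi> x)\<^sup>2)) C" using green_bound by metis
  from smooth_family_exists[OF L sd(1) nz this sd(2)]
  show "\<exists>U (\<Psi> :: real \<times> real \<Rightarrow> real \<Rightarrow> real). open U \<and> (\<omega>0, A0) \<in> U \<and>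
      (\<forall>p\<in>U. H2pe L0 (\<Psi> p) \<and> solves (fst p) (snd p) (\<Psi> p)) \<and> h2_smooth L0 U \<Psi> \<and> \<Psi> (\<omega>0, A0) = \<phi>" .
qed

end
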